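(* Let $\Phi:\mathbb{B}(\mathscr{H})\to\mathbb{B}(\mathscr{K})$ be a unital positive linear map and let $0\leq r\leq 1/2$. (1) If $f,g:(0,\infty)\to(0,\infty)$ are operator convex functions such that the function $t\mapsto \frac{f(t)g(t)}{t}$ is operator concave on $(0,\infty)$, then for every positive invertible operator $A\in\mathbb{B}(\mathscr{H})$ there exists a partial isometry $V$ such that $$\left|\Phi\left(f(A)\right)^{-r}\Phi(A)^r\Phi\left(g(A)\right)^{-r}\right|\leq V^*\,\Phi\left(f(A)^{-r}A^rg(A)^{-r}\right)V .$$ (2) If $f,g:(0,\infty)\to(0,\infty)$ and $t\mapsto\frac{t}{f(t)g(t)}$ are operator concave on $(0,\infty)$, then the reverse inequality holds: for every positive invertible operator $A\in\mathbb{B}(\mathscr{H})$ there exists a partial isometry $V$ such that $$\left|\Phi\left(f(A)\right)^{-r}\Phi(A)^r\Phi\left(g(A)\right)^{-r}\right|\geq V^*\,\Phi\left(f(A)^{-r}A^rg(A)^{-r}\right)V .$$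
   Context: $\mathbb{B}(\mathscr{H})$ is the $C^*$-algebra of bounded linear operators on a Hilbert space $\mathscr{H}$, and $\leq$ is the usual (Löwner) order on self-adjoint operators. A linear map $\Phi$ between such algebras is positive if it maps positive operators to positive operators, and unital if $\Phi(I)=I$. $|X|=(X^*X)^{1/2}$. Functions and powers of positive (invertible) operators are defined by the continuous functional calculus. A continuous function $f:J\to\mathbb{R}$ on an interval $J$ is operator convex if $f(\lambda A+(1-\lambda)B)\leq\lambda f(A)+(1-\lambda)f(B)$ for all self-adjoint operators $A,B$ with spectra in $J$ and all $\lambda\in[0,1]$; $f$ is operator concave if $-f$ is operator convex. *)

theory Defs
  imports "HOL-Analysis.Analysis" "HOL-Computational_Algebra.Polynomial"
begin

section \<open>Complex Hilbert spaces\<close>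

text \<open>
  A complex Hilbert space is presented as a real Hilbert space (so that its norm, topology and
  bounded operators are those of the library) with a compatible complex scalar multiplication and
  a sesquilinear form, linear in its first argument, whose real part is the real inner product.
  Positive definiteness is inherited from \<^class>\<open>real_inner\<close>.
\<close>

class complex_hilbert_space = real_inner + banach +
  fixes scaleC :: "complex \<Rightarrow> 'a \<Rightarrow> 'a"  (infixr "*\<^sub>C" 75)
    and cinner :: "'a \<Rightarrow> 'a \<Rightarrow> complex"
  assumes scaleC_add_right: "c *\<^sub>C (x + y) = c *\<^sub>C x + c *\<^sub>C y"
    and scaleC_add_left: "(c + d) *\<^sub>C x = c *\<^sub>C x + d *\<^sub>C x"
    and scaleC_scaleC: "c *\<^sub>C d *\<^sub>C x = (c * d) *\<^sub>C x"
    and scaleC_of_real: "complex_of_real a *\<^sub>C x = a *\<^sub>R x"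
    and cinner_add_left: "cinner (x + y) z = cinner x z + cinner y z"
    and cinner_scaleC_left: "cinner (c *\<^sub>C x) y = c * cinner x y"
    and cinner_commute: "cinner x y = cnj (cinner y x)"
    and Re_cinner: "Re (cinner x y) = inner x y"

lemma cinner_same: "cinner x x = complex_of_real ((norm x)\<^sup>2)"
proof -
  have "Im (cinner x x) = 0"
    using arg_cong[OF cinner_commute[of x x], of Im] by simp
  then show ?thesis
    by (simp add: complex_eq_iff Re_cinner power2_norm_eq_inner)
qed

lemma norm_scaleC: "norm (c *\<^sub>C x) = cmod c * norm x"
proof -
  have "cinner (c *\<^sub>C x) (c *\<^sub>C x) = c * cnj (cinner (c *\<^sub>C x) x)"
    by (subst cinner_scaleC_left, subst cinner_commute) simp
  also have "\<dots> = (c * cnj c) * cnj (cinner x x)"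
    by (simp add: cinner_scaleC_left)
  also have "\<dots> = complex_of_real ((cmod c)\<^sup>2 * (norm x)\<^sup>2)"
    by (simp add: cinner_same flip: complex_norm_square)
  finally have "(norm (c *\<^sub>C x))\<^sup>2 = (cmod c * norm x)\<^sup>2"
    unfolding cinner_same of_real_eq_iff by (simp add: power_mult_distrib)
  then show ?thesis by (simp add: power2_eq_iff_nonneg)
qed


section \<open>Bounded operators\<close>

text \<open>
  \<open>B(H)\<close> is the set of complex-linear elements of the library type of bounded real-linear operators.
\<close>

definition bop :: "('h::complex_hilbert_space \<Rightarrow>\<^sub>L 'h) set" where
  "bop = {T. \<forall>c x. blinfun_apply T (c *\<^sub>C x) = c *\<^sub>C blinfun_apply T x}"

lift_definition scaleC_op ::
  "complex \<Rightarrow> ('h::complex_hilbert_space \<Rightarrow>\<^sub>L 'h) \<Rightarrow> ('h \<Rightarrow>\<^sub>L 'h)"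
  is "\<lambda>c T x. c *\<^sub>C T x"
proof -
  fix c :: complex and T :: "'h \<Rightarrow> 'h"
  assume "bounded_linear T"
  moreover have "bounded_linear ((*\<^sub>C) c :: 'h \<Rightarrow> 'h)"
  proof (rule bounded_linear_intro[where K = "cmod c"])
    fix a and x :: 'h
    show "c *\<^sub>C a *\<^sub>R x = a *\<^sub>R c *\<^sub>C x"
      by (simp add: scaleC_of_real[symmetric] scaleC_scaleC mult.commute)
  qed (simp_all add: scaleC_add_right norm_scaleC mult.commute)
  ultimately show "bounded_linear (\<lambda>x. c *\<^sub>C T x)"
    by (rule bounded_linear_compose[rotated])
qed

definition adj :: "('h::complex_hilbert_space \<Rightarrow>\<^sub>L 'h) \<Rightarrow> ('h \<Rightarrow>\<^sub>L 'h)" where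
  "adj T = (THE S. \<forall>x y. cinner (blinfun_apply S x) y = cinner x (blinfun_apply T y))"

definition selfadjoint :: "('h::complex_hilbert_space \<Rightarrow>\<^sub>L 'h) \<Rightarrow> bool" where
  "selfadjoint T \<longleftrightarrow> T \<in> bop \<and> adj T = T"

definition positive_op :: "('h::complex_hilbert_space \<Rightarrow>\<^sub>L 'h) \<Rightarrow> bool" where
  "positive_op T \<longleftrightarrow> selfadjoint T \<and> (\<forall>x. 0 \<le> Re (cinner (blinfun_apply T x) x))"

definition loewner_le ::
  "('h::complex_hilbert_space \<Rightarrow>\<^sub>L 'h) \<Rightarrow> ('h \<Rightarrow>\<^sub>L 'h) \<Rightarrow> bool"  (infix "\<le>\<^sub>L" 50) where
  "S \<le>\<^sub>L T \<longleftrightarrow> positive_op (T - S)"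

definition invertible_op :: "('h::complex_hilbert_space \<Rightarrow>\<^sub>L 'h) \<Rightarrow> bool" where
  "invertible_op T \<longleftrightarrow>
     T \<in> bop \<and> (\<exists>S\<in>bop. S o\<^sub>L T = id_blinfun \<and> T o\<^sub>L S = id_blinfun)"

definition spectrum :: "('h::complex_hilbert_space \<Rightarrow>\<^sub>L 'h) \<Rightarrow> complex set" where
  "spectrum T = {z. \<not> invertible_op (T - scaleC_op z id_blinfun)}"

definition orthogonal_complement_kernel ::
  "('h::complex_hilbert_space \<Rightarrow>\<^sub>L 'h) \<Rightarrow> 'h set" where
  "orthogonal_complement_kernel V = {x. \<forall>y. blinfun_apply V y = 0 \<longrightarrow> cinner x y = 0}"

definition partial_isometry :: "('h::complex_hilbert_space \<Rightarrow>\<^sub>L 'h) \<Rightarrow> bool" where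
  "partial_isometry V \<longleftrightarrow>
     V \<in> bop \<and> (\<forall>x\<in>orthogonal_complement_kernel V. norm (blinfun_apply V x) = norm x)"


section \<open>Continuous functional calculus\<close>

definition poly_op ::
  "real poly \<Rightarrow> ('h::complex_hilbert_space \<Rightarrow>\<^sub>L 'h) \<Rightarrow> ('h \<Rightarrow>\<^sub>L 'h)" where
  "poly_op p A = (\<Sum>i\<le>degree p. coeff p i *\<^sub>R (((o\<^sub>L) A ^^ i) id_blinfun))"

text \<open>
  \<open>cfc f A\<close> is \<open>f(A)\<close>, for \<open>A\<close> self-adjoint and \<open>f\<close> continuous on the (real) spectrum of \<open>A\<close>: the common
  norm limit of \<open>p\<^sub>n(A)\<close> over all sequences of real polynomials \<open>p\<^sub>n\<close> converging to \<open>f\<close> uniformly on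
  the spectrum.
\<close>

definition cfc ::
  "(real \<Rightarrow> real) \<Rightarrow> ('h::complex_hilbert_space \<Rightarrow>\<^sub>L 'h) \<Rightarrow> ('h \<Rightarrow>\<^sub>L 'h)" where
  "cfc f A = (THE T. \<forall>p :: nat \<Rightarrow> real poly.
     uniform_limit {t. complex_of_real t \<in> spectrum A} (\<lambda>n. poly (p n)) f sequentially \<longrightarrow>
     (\<lambda>n. poly_op (p n) A) \<longlonglongrightarrow> T)"

text \<open>
  Since \<open>0 powr s = 0\<close>, the function \<open>\<lambda>t. t powr s\<close> is continuous on \<open>{0..}\<close> for \<open>s > 0\<close> and on \<open>{0<..}\<close>
  for every \<open>s\<close>. Hence \<open>op_powr A s\<close> is meaningful for positive \<open>A\<close> if \<open>s > 0\<close>, and for positive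
  invertible \<open>A\<close> in general.
\<close>

definition op_powr ::
  "('h::complex_hilbert_space \<Rightarrow>\<^sub>L 'h) \<Rightarrow> real \<Rightarrow> ('h \<Rightarrow>\<^sub>L 'h)"  (infixr "powr\<^sub>o" 80) where
  "A powr\<^sub>o s = cfc (\<lambda>t. t powr s) A"

definition op_abs :: "('h::complex_hilbert_space \<Rightarrow>\<^sub>L 'h) \<Rightarrow> ('h \<Rightarrow>\<^sub>L 'h)" where
  "op_abs X = (adj X o\<^sub>L X) powr\<^sub>o (1/2)"


section \<open>Unital positive linear maps\<close>

text \<open>
  A map \<open>B(H) \<rightarrow> B(K)\<close> is represented by a function on the ambient types; its values outside \<^const>\<open>bop\<close>
  are irrelevant.
\<close>

definition linear_map_bop ::
  "(('h::complex_hilbert_space \<Rightarrow>\<^sub>L 'h) \<Rightarrow> ('k::complex_hilbert_space \<Rightarrow>\<^sub>L 'k)) \<Rightarrow> bool" where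
  "linear_map_bop \<Phi> \<longleftrightarrow>
     \<Phi> ` bop \<subseteq> bop \<and>
     (\<forall>S\<in>bop. \<forall>T\<in>bop. \<Phi> (S + T) = \<Phi> S + \<Phi> T) \<and>
     (\<forall>c. \<forall>T\<in>bop. \<Phi> (scaleC_op c T) = scaleC_op c (\<Phi> T))"

definition positive_map ::
  "(('h::complex_hilbert_space \<Rightarrow>\<^sub>L 'h) \<Rightarrow> ('k::complex_hilbert_space \<Rightarrow>\<^sub>L 'k)) \<Rightarrow> bool" where
  "positive_map \<Phi> \<longleftrightarrow> (\<forall>T. positive_op T \<longrightarrow> positive_op (\<Phi> T))"

definition unital_map ::
  "(('h::complex_hilbert_space \<Rightarrow>\<^sub>L 'h) \<Rightarrow> ('k::complex_hilbert_space \<Rightarrow>\<^sub>L 'k)) \<Rightarrow> bool" where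
  "unital_map \<Phi> \<longleftrightarrow> \<Phi> id_blinfun = id_blinfun"


section \<open>The Hilbert space of square-summable sequences\<close>

typedef ell2 = "{x :: nat \<Rightarrow> complex. summable (\<lambda>n. (cmod (x n))\<^sup>2)}"
  morphisms ell2_nth Abs_ell2
  by (rule exI[of _ "\<lambda>_. 0"]) simp

setup_lifting type_definition_ell2

lemma ell2_eqI:
  assumes "\<And>n. ell2_nth x n = ell2_nth y n"
  shows "x = y"
  using assms by (metis ell2_nth_inject ext)

lemma square_summable_add:
  fixes x y :: "nat \<Rightarrow> complex"
  assumes "summable (\<lambda>n. (cmod (x n))\<^sup>2)" "summable (\<lambda>n. (cmod (y n))\<^sup>2)"
  shows "summable (\<lambda>n. (cmod (x n + y n))\<^sup>2)"
proof (rule summable_comparison_test'[where N = 0])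
  show "summable (\<lambda>n. 2 * (cmod (x n))\<^sup>2 + 2 * (cmod (y n))\<^sup>2)"
    using assms by (intro summable_add summable_mult)
  fix n
  have "(cmod (x n + y n))\<^sup>2 \<le> (cmod (x n) + cmod (y n))\<^sup>2"
    by (intro power_mono norm_triangle_ineq) simp
  also have "\<dots> \<le> 2 * (cmod (x n))\<^sup>2 + 2 * (cmod (y n))\<^sup>2"
    using sum_squares_bound[of "cmod (x n)" "cmod (y n)"] by (simp add: power2_sum)
  finally show "norm ((cmod (x n + y n))\<^sup>2) \<le> 2 * (cmod (x n))\<^sup>2 + 2 * (cmod (y n))\<^sup>2"
    by simp
qed

lemma square_summable_scale:
  fixes x :: "nat \<Rightarrow> complex"
  assumes "summable (\<lambda>n. (cmod (x n))\<^sup>2)"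
  shows "summable (\<lambda>n. (cmod (c * x n))\<^sup>2)"
  using summable_mult[OF assms, of "(cmod c)\<^sup>2"] by (simp add: norm_mult power_mult_distrib)

lemma square_summable_mult:
  fixes x y :: "nat \<Rightarrow> complex"
  assumes "summable (\<lambda>n. (cmod (x n))\<^sup>2)" "summable (\<lambda>n. (cmod (y n))\<^sup>2)"
  shows "summable (\<lambda>n. x n * cnj (y n))"
proof (rule summable_comparison_test'[where N = 0])
  show "summable (\<lambda>n. (cmod (x n))\<^sup>2 + (cmod (y n))\<^sup>2)"
    using assms by (intro summable_add)
  fix n
  have "0 \<le> cmod (x n) * cmod (y n)" by simp
  then have "cmod (x n) * cmod (y n) \<le> (cmod (x n))\<^sup>2 + (cmod (y n))\<^sup>2"
    using sum_squares_bound[of "cmod (x n)" "cmod (y n)"] by linarith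
  then show "norm (x n * cnj (y n)) \<le> (cmod (x n))\<^sup>2 + (cmod (y n))\<^sup>2"
    by (simp add: norm_mult)
qed

instantiation ell2 :: real_vector
begin

lift_definition zero_ell2 :: ell2 is "\<lambda>_. 0" by simp
lift_definition plus_ell2 :: "ell2 \<Rightarrow> ell2 \<Rightarrow> ell2" is "\<lambda>x y n. x n + y n"
  by (rule square_summable_add)
lift_definition uminus_ell2 :: "ell2 \<Rightarrow> ell2" is "\<lambda>x n. - x n" by simp
definition minus_ell2 :: "ell2 \<Rightarrow> ell2 \<Rightarrow> ell2" where "minus_ell2 x y = x + - y"
lift_definition scaleR_ell2 :: "real \<Rightarrow> ell2 \<Rightarrow> ell2" is "\<lambda>a x n. complex_of_real a * x n"
  by (rule square_summable_scale)

instance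
proof
  fix x y z :: ell2 and a b :: real
  show "x + y + z = x + (y + z)" by (rule ell2_eqI) (simp add: plus_ell2.rep_eq)
  show "x + y = y + x" by (rule ell2_eqI) (simp add: plus_ell2.rep_eq)
  show "0 + x = x" by (rule ell2_eqI) (simp add: plus_ell2.rep_eq zero_ell2.rep_eq)
  show "- x + x = 0"
    by (rule ell2_eqI) (simp add: plus_ell2.rep_eq zero_ell2.rep_eq uminus_ell2.rep_eq)
  show "x - y = x + - y" by (rule minus_ell2_def)
  show "a *\<^sub>R (x + y) = a *\<^sub>R x + a *\<^sub>R y"
    by (rule ell2_eqI) (simp add: plus_ell2.rep_eq scaleR_ell2.rep_eq distrib_left)
  show "(a + b) *\<^sub>R x = a *\<^sub>R x + b *\<^sub>R x"
    by (rule ell2_eqI) (simp add: plus_ell2.rep_eq scaleR_ell2.rep_eq distrib_right)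
  show "a *\<^sub>R b *\<^sub>R x = (a * b) *\<^sub>R x"
    by (rule ell2_eqI) (simp add: scaleR_ell2.rep_eq mult.assoc)
  show "1 *\<^sub>R x = x" by (rule ell2_eqI) (simp add: scaleR_ell2.rep_eq)
qed

end

lemma ell2_nth_simps [simp]:
  "ell2_nth 0 n = 0"
  "ell2_nth (x + y) n = ell2_nth x n + ell2_nth y n"
  "ell2_nth (- x) n = - ell2_nth x n"
  "ell2_nth (x - y) n = ell2_nth x n - ell2_nth y n"
  "ell2_nth (a *\<^sub>R x) n = complex_of_real a * ell2_nth x n"
  by (simp_all only: diff_conv_add_uminus zero_ell2.rep_eq plus_ell2.rep_eq uminus_ell2.rep_eq
      scaleR_ell2.rep_eq)

lemma ell2_summable: "summable (\<lambda>n. (cmod (ell2_nth x n))\<^sup>2)"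
  using ell2_nth[of x] by simp

definition cinner_ell2_aux :: "ell2 \<Rightarrow> ell2 \<Rightarrow> complex" where
  "cinner_ell2_aux x y = (\<Sum>n. ell2_nth x n * cnj (ell2_nth y n))"

lemma cinner_ell2_sums: "(\<lambda>n. ell2_nth x n * cnj (ell2_nth y n)) sums cinner_ell2_aux x y"
  unfolding cinner_ell2_aux_def
  by (rule summable_sums[OF square_summable_mult[OF ell2_summable ell2_summable]])

lemma cinner_ell2_aux_add: "cinner_ell2_aux (x + y) z = cinner_ell2_aux x z + cinner_ell2_aux y z"
proof (rule sums_unique2[OF cinner_ell2_sums])
  show "(\<lambda>n. ell2_nth (x + y) n * cnj (ell2_nth z n)) sums
      (cinner_ell2_aux x z + cinner_ell2_aux y z)"
    using sums_add[OF cinner_ell2_sums[of x z] cinner_ell2_sums[of y z]]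
    by (simp add: distrib_right)
qed

lemma cinner_ell2_aux_commute: "cinner_ell2_aux x y = cnj (cinner_ell2_aux y x)"
proof (rule sums_unique2[OF cinner_ell2_sums])
  have "(\<lambda>n. cnj (ell2_nth y n * cnj (ell2_nth x n))) sums cnj (cinner_ell2_aux y x)"
    by (subst sums_cnj) (rule cinner_ell2_sums)
  then show "(\<lambda>n. ell2_nth x n * cnj (ell2_nth y n)) sums cnj (cinner_ell2_aux y x)"
    by (simp add: mult.commute)
qed

lemma cinner_ell2_aux_scale:
  assumes "\<And>n. ell2_nth z n = c * ell2_nth x n"
  shows "cinner_ell2_aux z y = c * cinner_ell2_aux x y"
proof (rule sums_unique2[OF cinner_ell2_sums])
  show "(\<lambda>n. ell2_nth z n * cnj (ell2_nth y n)) sums (c * cinner_ell2_aux x y)"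
    using sums_mult[OF cinner_ell2_sums[of x y], of c] by (simp add: assms mult.assoc)
qed

lemma norm_square_ell2_sums: "(\<lambda>n. (cmod (ell2_nth x n))\<^sup>2) sums Re (cinner_ell2_aux x x)"
  using sums_Re[OF cinner_ell2_sums[of x x]]
  by (simp add: complex_norm_square[symmetric] del: of_real_power)

instantiation ell2 :: real_inner
begin

definition "inner x y = Re (cinner_ell2_aux x y)" for x y :: ell2
definition "norm x = sqrt (inner x x)" for x :: ell2
definition "sgn x = x /\<^sub>R norm x" for x :: ell2
definition "dist x y = norm (x - y)" for x y :: ell2
definition "(uniformity :: (ell2 \<times> ell2) filter) = (INF e\<in>{0 <..}. principal {(x, y). dist x y < e})"
definition "open (U :: ell2 set) = (\<forall>x\<in>U. \<forall>\<^sub>F (x', y) in uniformity. x' = x \<longrightarrow> y \<in> U)"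

instance
proof
  fix x y z :: ell2 and a :: real
  show "dist x y = norm (x - y)" by (fact dist_ell2_def)
  show "sgn x = x /\<^sub>R norm x" by (fact sgn_ell2_def)
  show "norm x = sqrt (inner x x)" by (fact norm_ell2_def)
  show "(uniformity :: (ell2 \<times> ell2) filter) = (INF e\<in>{0 <..}. principal {(x, y). dist x y < e})"
    by (fact uniformity_ell2_def)
  show "open U \<longleftrightarrow> (\<forall>x\<in>U. \<forall>\<^sub>F (x', y) in uniformity. x' = x \<longrightarrow> y \<in> U)" for U :: "ell2 set"
    by (fact open_ell2_def)
  show "inner x y = inner y x"
    unfolding inner_ell2_def by (subst cinner_ell2_aux_commute) simp
  show "inner (x + y) z = inner x z + inner y z"
    unfolding inner_ell2_def cinner_ell2_aux_add by (rule plus_complex.sel(1))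
  have "cinner_ell2_aux (a *\<^sub>R x) y = complex_of_real a * cinner_ell2_aux x y"
    by (rule cinner_ell2_aux_scale) simp
  then show "inner (a *\<^sub>R x) y = a * inner x y"
    by (simp add: inner_ell2_def)
  have s: "(\<lambda>n. (cmod (ell2_nth x n))\<^sup>2) sums inner x x"
    unfolding inner_ell2_def by (rule norm_square_ell2_sums)
  show "0 \<le> inner x x"
    by (rule sums_le[OF _ sums_zero s]) simp
  show "inner x x = 0 \<longleftrightarrow> x = 0"
  proof
    assume "inner x x = 0"
    then have "(\<Sum>n. (cmod (ell2_nth x n))\<^sup>2) = 0"
      by (simp only: sums_unique[OF s, symmetric])
    then have "\<forall>n. (cmod (ell2_nth x n))\<^sup>2 = 0"
      by (subst (asm) suminf_eq_zero_iff[OF ell2_summable]) simp_all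
    then show "x = 0" by (intro ell2_eqI) simp
  next
    assume 0: "x = 0"
    have "(\<lambda>n. 0) sums inner x x" using s unfolding 0 by simp
    then show "inner x x = 0" by (rule sums_unique2[OF _ sums_zero])
  qed
qed

end

lemma norm_ell2_sums: "(\<lambda>n. (cmod (ell2_nth x n))\<^sup>2) sums (norm x)\<^sup>2"
  using norm_square_ell2_sums[of x] by (simp only: power2_norm_eq_inner[of x] inner_ell2_def)

lemma cmod_ell2_nth_le: "cmod (ell2_nth x n) \<le> norm x"
proof -
  have "(\<Sum>i\<in>{n}. (cmod (ell2_nth x i))\<^sup>2) \<le> (\<Sum>i. (cmod (ell2_nth x i))\<^sup>2)"
    by (intro sum_le_suminf ell2_summable) auto
  then have "(cmod (ell2_nth x n))\<^sup>2 \<le> (norm x)\<^sup>2"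
    using sums_unique[OF norm_ell2_sums[of x]] by simp
  then show ?thesis by (rule power2_le_imp_le) simp
qed

instance ell2 :: banach
proof
  fix X :: "nat \<Rightarrow> ell2"
  assume X: "Cauchy X"
  have "Cauchy (\<lambda>n. ell2_nth (X n) i)" for i
  proof (rule CauchyI)
    fix e :: real assume "0 < e"
    then obtain M where M: "\<forall>m\<ge>M. \<forall>n\<ge>M. norm (X m - X n) < e"
      using CauchyD[OF X] by blast
    have "norm (ell2_nth (X m) i - ell2_nth (X n) i) < e" if "m \<ge> M" "n \<ge> M" for m n
      using cmod_ell2_nth_le[of "X m - X n" i] M that by (force intro: le_less_trans)
    then show "\<exists>M. \<forall>m\<ge>M. \<forall>n\<ge>M. norm (ell2_nth (X m) i - ell2_nth (X n) i) < e" by blast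
  qed
  then have "\<forall>i. \<exists>l. (\<lambda>n. ell2_nth (X n) i) \<longlonglongrightarrow> l"
    by (simp add: Cauchy_convergent_iff convergent_def)
  then obtain l where l: "\<And>i. (\<lambda>n. ell2_nth (X n) i) \<longlonglongrightarrow> l i" by metis
  have partial: "(\<Sum>i<k. (cmod (l i - ell2_nth (X n) i))\<^sup>2) \<le> e\<^sup>2"
    if M: "\<forall>m\<ge>M. \<forall>n\<ge>M. norm (X m - X n) < e" and n: "n \<ge> M" for e M n k
  proof (rule tendsto_upperbound)
    show "(\<lambda>m. \<Sum>i<k. (cmod (ell2_nth (X m) i - ell2_nth (X n) i))\<^sup>2)
        \<longlonglongrightarrow> (\<Sum>i<k. (cmod (l i - ell2_nth (X n) i))\<^sup>2)"
      by (intro tendsto_intros l)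
    show "\<forall>\<^sub>F m in sequentially. (\<Sum>i<k. (cmod (ell2_nth (X m) i - ell2_nth (X n) i))\<^sup>2) \<le> e\<^sup>2"
    proof (rule eventually_sequentiallyI[of M])
      fix m assume m: "M \<le> m"
      have "(\<Sum>i<k. (cmod (ell2_nth (X m - X n) i))\<^sup>2) \<le> (\<Sum>i. (cmod (ell2_nth (X m - X n) i))\<^sup>2)"
        by (intro sum_le_suminf ell2_summable) auto
      also have "\<dots> = (norm (X m - X n))\<^sup>2"
        using sums_unique[OF norm_ell2_sums[of "X m - X n"]] by simp
      also have "\<dots> \<le> e\<^sup>2"
        using M m n by (intro power_mono) (auto intro: less_imp_le)
      finally show "(\<Sum>i<k. (cmod (ell2_nth (X m) i - ell2_nth (X n) i))\<^sup>2) \<le> e\<^sup>2" by simp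
    qed
  qed simp
  have summ: "summable (\<lambda>i. (cmod (l i - ell2_nth (X n) i))\<^sup>2)"
    if M: "\<forall>m\<ge>M. \<forall>n\<ge>M. norm (X m - X n) < e" and n: "n \<ge> M" for e M n
    using partial[OF M n] by (intro bounded_imp_summable[where B = "e\<^sup>2"])
      (auto simp: lessThan_Suc_atMost[symmetric] simp del: sum.lessThan_Suc)
  obtain M1 where M1: "\<forall>m\<ge>M1. \<forall>n\<ge>M1. norm (X m - X n) < 1"
    using CauchyD[OF X, of 1] by auto
  have "summable (\<lambda>i. (cmod (l i))\<^sup>2)"
    using square_summable_add[OF summ[OF M1 order_refl] ell2_summable[of "X M1"]] by simp
  then have L: "ell2_nth (Abs_ell2 l) = l"
    by (simp add: Abs_ell2_inverse)
  have "X \<longlonglongrightarrow> Abs_ell2 l"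
  proof (rule LIMSEQ_I)
    fix r :: real assume "0 < r"
    then obtain M where M: "\<forall>m\<ge>M. \<forall>n\<ge>M. norm (X m - X n) < r / 2"
      using CauchyD[OF X, of "r / 2"] by auto
    have "norm (X n - Abs_ell2 l) < r" if n: "n \<ge> M" for n
    proof -
      have "(norm (Abs_ell2 l - X n))\<^sup>2 = (\<Sum>i. (cmod (l i - ell2_nth (X n) i))\<^sup>2)"
        using sums_unique[OF norm_ell2_sums[of "Abs_ell2 l - X n"]] by (simp add: L)
      also have "\<dots> \<le> (r / 2)\<^sup>2"
        by (rule suminf_le_const[OF summ[OF M n]]) (rule partial[OF M n])
      finally have "norm (Abs_ell2 l - X n) \<le> r / 2"
        by (rule power2_le_imp_le) (use \<open>0 < r\<close> in simp)
      then show ?thesis using \<open>0 < r\<close> by (simp add: norm_minus_commute)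
    qed
    then show "\<exists>no. \<forall>n\<ge>no. norm (X n - Abs_ell2 l) < r" by blast
  qed
  then show "convergent X" by (auto simp: convergent_def)
qed

instantiation ell2 :: complex_hilbert_space
begin

lift_definition scaleC_ell2 :: "complex \<Rightarrow> ell2 \<Rightarrow> ell2" is "\<lambda>c x n. c * x n"
  by (rule square_summable_scale)
definition "cinner x y = cinner_ell2_aux x y" for x y :: ell2

instance
proof
  fix x y z :: ell2 and c d :: complex and a :: real
  show "c *\<^sub>C (x + y) = c *\<^sub>C x + c *\<^sub>C y"
    and "(c + d) *\<^sub>C x = c *\<^sub>C x + d *\<^sub>C x"
    and "c *\<^sub>C d *\<^sub>C x = (c * d) *\<^sub>C x"
    and "complex_of_real a *\<^sub>C x = a *\<^sub>R x"
    by (rule ell2_eqI, simp add: scaleC_ell2.rep_eq distrib_left distrib_right mult.assoc)+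
  show "cinner (x + y) z = cinner x z + cinner y z"
    by (simp add: cinner_ell2_def cinner_ell2_aux_add)
  show "cinner (c *\<^sub>C x) y = c * cinner x y"
    unfolding cinner_ell2_def by (rule cinner_ell2_aux_scale) (rule scaleC_ell2.rep_eq[THEN fun_cong])
  show "cinner x y = cnj (cinner y x)"
    unfolding cinner_ell2_def by (rule cinner_ell2_aux_commute)
  show "Re (cinner x y) = inner x y"
    by (simp add: cinner_ell2_def inner_ell2_def)
qed

end


section \<open>Operator convexity\<close>

text \<open>
  Operator convexity on \<open>J\<close> concerns all pairs of self-adjoint operators on all Hilbert spaces. A
  HOL predicate on \<open>f\<close> and \<open>J\<close> cannot quantify over types, so the operators range over \<open>B(\<ell>\<^sup>2)\<close>, the
  standard infinite-dimensional Hilbert space; the notion does not depend on which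
  infinite-dimensional space is taken, and it implies convexity on every Hilbert space.
\<close>

definition operator_convex :: "real set \<Rightarrow> (real \<Rightarrow> real) \<Rightarrow> bool" where
  "operator_convex J f \<longleftrightarrow>
     continuous_on J f \<and>
     (\<forall>(A :: ell2 \<Rightarrow>\<^sub>L ell2) B. \<forall>u\<in>{0..1}.
        selfadjoint A \<and> selfadjoint B \<and>
        spectrum A \<subseteq> complex_of_real ` J \<and> spectrum B \<subseteq> complex_of_real ` J \<longrightarrow>
        cfc f (u *\<^sub>R A + (1 - u) *\<^sub>R B) \<le>\<^sub>L u *\<^sub>R cfc f A + (1 - u) *\<^sub>R cfc f B)"

definition operator_concave :: "real set \<Rightarrow> (real \<Rightarrow> real) \<Rightarrow> bool" where
  "operator_concave J f \<longleftrightarrow> operator_convex J (\<lambda>t. - f t)"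

end

(*
  With P = Phi(A), F = Phi(f(A)) and G = Phi(g(A)), Jensen's operator inequality and the antitonicity of
  t^(-2r) give |X|^2 <= |Y|^2 for X = F^(-r) P^r G^(-r) and Y = f(P)^(-r) P^r G^(-r), hence |X| <= |Y|.
  Since Y is invertible, |Y| = U* |Y*| U with U unitary, and |Y*| <= h(P)^(-r) for h(t) = f(t) g(t) / t by
  the same argument for g. Finally h(P)^(-r) <= Phi(h(A))^(-r) <= Phi(h(A)^(-r)). Part (2) reverses every
  inequality.

  Jensen's inequality for a positive map reduces, through Bernstein polynomials of A, to finitely many
  positive operators with sum 1; an operator convex function on l^2 is then treated by a Naimark dilation
  of their compression to a finite-dimensional Krylov space, and powers by approximation with
  combinations of 1/(t + l).
*)
theory Submission
  imports Defs "HOL-Computational_Algebra.Fundamental_Theorem_Algebra" "HOL-Real_Asymp.Real_Asymp"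
begin

section \<open>Adjoints\<close>

text \<open>A merely positive Phi has no Stinespring dilation, but on the commutative algebra
  generated by A a partition of unity turns it into finitely many positive operators with sum 1, and
  these can be dilated. Operator convexity is given on l^2 only, whereas the target space may be
  finite-dimensional or nonseparable; hence only finitely many vectors are dilated, enough to
  evaluate one polynomial close to f at one vector. The bound r <= 1/2 keeps the exponent 2r in
  [0, 1], where t^(-2r) is operator antitone. In |X|^2 only the leftmost factor of X stands in the
  middle, where it can be compared by congruence; the rightmost factor G^(-r) can be exchanged only
  after passing to the adjoint, and the unitary U is the price of that passage. The functional
  calculus rests on bounding the norm of p(A) by the maximum of |p| on the spectrum. This bound is
  obtained by factoring real polynomials into linear and quadratic factors.\<close>

interpretation cinner: bounded_bilinear "cinner :: 'a::complex_hilbert_space \<Rightarrow> 'a \<Rightarrow> complex"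
proof
  fix x y z :: 'a and a :: real
  show "cinner (x + y) z = cinner x z + cinner y z" by (rule cinner_add_left)
  show "cinner x (y + z) = cinner x y + cinner x z"
    by (metis cinner_add_left cinner_commute complex_cnj_add)
  show sl: "cinner (a *\<^sub>R x) y = a *\<^sub>R cinner x y" for x y :: 'a
    by (metis cinner_scaleC_left scaleC_of_real scaleR_conv_of_real)
  show "cinner x (a *\<^sub>R y) = a *\<^sub>R cinner x y"
    by (subst (1 2) cinner_commute) (simp add: sl)
  show "\<exists>K. \<forall>(x::'a) y. norm (cinner x y) \<le> norm x * norm y * K"
  proof (intro exI[of _ 1] allI)
    fix x y :: 'a
    \<comment> \<open>A phase that makes the product real and nonnegative reduces the complex
      Cauchy-Schwarz inequality to the real one. For \<open>cinner x y = 0\<close> it is 0 instead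
      of unimodular; only \<open>cmod c \<le> 1\<close> matters.\<close>
    define c where "c = cnj (sgn (cinner x y))"
    have "c * cinner x y = complex_of_real (cmod (cinner x y))"
      using complex_norm_square[of "cinner x y"]
      by (cases "cinner x y = 0") (simp_all add: c_def sgn_eq power2_eq_square field_simps)
    then have "cmod (cinner x y) = inner (c *\<^sub>C x) y"
      by (simp add: Re_cinner[symmetric] cinner_scaleC_left)
    also have "\<dots> \<le> norm (c *\<^sub>C x) * norm y" by (rule norm_cauchy_schwarz)
    also have "\<dots> \<le> norm x * norm y"
      by (intro mult_right_mono) (auto simp: norm_scaleC c_def norm_sgn)
    finally show "norm (cinner x y) \<le> norm x * norm y * 1" by simp
  qed
qed

lemma cinner_scaleC_right: "cinner x (c *\<^sub>C y) = cnj c * cinner x y"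
  by (metis cinner_commute cinner_scaleC_left complex_cnj_mult)

lemma Im_cinner: "Im (cinner x y) = inner x (\<i> *\<^sub>C y)"
  by (simp add: Re_cinner[symmetric] cinner_scaleC_right)

lemma cinner_eqI: "(\<And>z. inner x z = inner y z) \<Longrightarrow> x = y"
  by (metis inner_diff_left inner_eq_zero_iff right_minus_eq)

text \<open>The representing vector is the minimiser of |x|^2 - 2 \<open>\<phi> x\<close>.
  Completeness enters through a minimising sequence, which the parallelogram law makes
  Cauchy.\<close>

lemma Riesz_representation:
  fixes \<phi> :: "'a::{real_inner,banach} \<Rightarrow> real"
  assumes "bounded_linear \<phi>"
  shows "\<exists>u. \<forall>v. \<phi> v = inner u v"
proof -
  interpret bounded_linear \<phi> by fact
  obtain K where K: "\<And>x. \<bar>\<phi> x\<bar> \<le> norm x * K" using bounded by auto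
  define F where "F x = (norm x)\<^sup>2 - 2 * \<phi> x" for x
  have low: "- K\<^sup>2 \<le> F x" for x
    using K[of x] zero_le_power2[of "norm x - K"] unfolding F_def
    by (simp add: power2_eq_square algebra_simps)
  define I where "I = Inf (range F)"
  have bdd: "bdd_below (range F)" using low by (intro bdd_belowI) auto
  have I: "I \<le> F x" for x unfolding I_def by (intro cInf_lower bdd) auto
  have "\<exists>x. F x < I + 1 / (real n + 1)" for n
    using cInf_lessD[of "range F" "I + 1 / (real n + 1)"] unfolding I_def by auto
  then obtain x where x: "\<And>n. F (x n) < I + 1 / (real n + 1)" by metis
  have par: "(norm (a - b))\<^sup>2 = 2 * F a + 2 * F b - 4 * F ((1/2) *\<^sub>R (a + b))" for a b
    unfolding F_def power2_norm_eq_inner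
    by (simp add: inner_simps scaleR add inner_commute[of b a] add_divide_distrib)
  have dist: "(norm (a - b))\<^sup>2 \<le> 2 * (F a - I) + 2 * (F b - I)" for a b
  proof -
    have *: "z = 2 * p + 2 * q - 4 * w \<Longrightarrow> i \<le> w \<Longrightarrow> z \<le> 2 * (p - i) + 2 * (q - i)" for z p q w i :: real
      by simp
    show ?thesis by (rule *[OF par I])
  qed
  have "Cauchy x"
  proof (rule CauchyI)
    fix e :: real assume e: "0 < e"
    obtain N :: nat where N: "4 / e\<^sup>2 < real N" using reals_Archimedean2 by blast
    have "norm (x m - x n) < e" if "m \<ge> N" "n \<ge> N" for m n
    proof -
      have small: "F (x k) - I < e\<^sup>2 / 4" if "k \<ge> N" for k
      proof -
        have "1 / (real k + 1) < e\<^sup>2 / 4"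
        proof -
          have "4 < real N * e\<^sup>2" using N e by (simp add: pos_divide_less_eq)
          also have "\<dots> \<le> (real k + 1) * e\<^sup>2" using that by (intro mult_right_mono) auto
          finally show ?thesis by (simp add: divide_simps mult.commute)
        qed
        then show ?thesis using x[of k] by linarith
      qed
      have "(norm (x m - x n))\<^sup>2 < e\<^sup>2"
        using dist[of "x m" "x n"] small[OF that(1)] small[OF that(2)] by argo
      then show ?thesis using e by (simp add: power2_less_imp_less)
    qed
    then show "\<exists>M. \<forall>m\<ge>M. \<forall>n\<ge>M. norm (x m - x n) < e" by blast
  qed
  then obtain u where u: "x \<longlonglongrightarrow> u" by (auto simp: Cauchy_convergent_iff convergent_def)
  have "(\<lambda>n. F (x n)) \<longlonglongrightarrow> F u" unfolding F_def by (intro tendsto_intros u tendsto)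
  moreover have "(\<lambda>n. I + 1 / (real n + 1)) \<longlonglongrightarrow> I + 0"
    by (intro tendsto_intros) real_asymp
  ultimately have "F u \<le> I + 0"
    by (rule LIMSEQ_le) (use x in \<open>auto intro: less_imp_le\<close>)
  then have min: "F u \<le> F v" for v using I[of v] by linarith
  have "\<phi> v = inner u v" for v
  proof (rule ccontr)
    assume ne: "\<phi> v \<noteq> inner u v"
    define d where "d = inner u v - \<phi> v"
    \<comment> \<open>Minimality at \<open>u\<close> makes this quadratic in \<open>t\<close>
      nonnegative. At its vertex, t = -d / |v|^2, its value is -d^2 / |v|^2, so \<open>d\<close> has
      to be 0.\<close>
    have q: "0 \<le> t\<^sup>2 * (norm v)\<^sup>2 + 2 * t * d" for t
      using min[of "u + t *\<^sub>R v"] unfolding F_def d_def power2_norm_eq_inner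
      by (simp add: inner_simps scaleR add inner_commute[of v u]
          power2_eq_square algebra_simps)
    have v: "0 < (norm v)\<^sup>2" using ne zero by auto
    have "(- d / n)\<^sup>2 * n + 2 * (- d / n) * d = - (d\<^sup>2 / n)" if "0 < n" for n
      using that by (simp add: field_simps power2_eq_square)
    then have "0 \<le> - (d\<^sup>2 / (norm v)\<^sup>2)" using q[of "- d / (norm v)\<^sup>2"] v by metis
    moreover have "0 < d\<^sup>2 / (norm v)\<^sup>2" using v ne by (simp add: d_def)
    ultimately show False by simp
  qed
  then show ?thesis by blast
qed

lemma bopD: "T \<in> bop \<Longrightarrow> T (c *\<^sub>C x) = c *\<^sub>C T x"
  by (simp add: bop_def)

lemma scaleC_scaleR: "c *\<^sub>C a *\<^sub>R x = a *\<^sub>R c *\<^sub>C x"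
  by (simp add: scaleC_of_real[symmetric] scaleC_scaleC mult.commute)

lemma scaleC_zero_right [simp]: "c *\<^sub>C 0 = 0"
  using scaleC_scaleR[of c 0 0] by simp

lemma adjoint_unique:
  assumes "\<And>x y. cinner (blinfun_apply S x) y = cinner x (blinfun_apply T y)"
  shows "adj T = S"
  unfolding adj_def
proof (rule the_equality)
  show "\<forall>x y. cinner (S x) y = cinner x (T y)" using assms by blast
  fix R assume R: "\<forall>x y. cinner (blinfun_apply R x) y = cinner x (T y)"
  show "R = S"
  proof (rule blinfun_eqI, rule cinner_eqI)
    fix x z
    show "inner (R x) z = inner (S x) z" using R assms by (metis Re_cinner)
  qed
qed

lemma adjoint_exists:
  fixes T :: "'h::complex_hilbert_space \<Rightarrow>\<^sub>L 'h"
  assumes T: "T \<in> bop"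
  shows "\<exists>S\<in>bop. \<forall>x y. cinner (blinfun_apply S x) y = cinner x (T y)"
proof -
  have "\<exists>u. \<forall>v. inner x (T v) = inner u v" for x
    by (rule Riesz_representation) (intro bounded_linear_intros)
  then obtain s where s: "\<And>x v. inner x (T v) = inner (s x) v" by metis
  have "bounded_linear s"
  proof (rule bounded_linear_intro[where K = "norm T"])
    fix x y :: 'h and a :: real
    show "s (x + y) = s x + s y" "s (a *\<^sub>R x) = a *\<^sub>R s x"
      by (rule cinner_eqI, simp add: s[symmetric] inner_simps)+
    have "(norm (s x))\<^sup>2 \<le> norm x * (norm T * norm (s x))"
      unfolding power2_norm_eq_inner s[symmetric]
      by (intro order_trans[OF norm_cauchy_schwarz] mult_left_mono norm_blinfun) simp
    then show "norm (s x) \<le> norm x * norm T"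
      by (cases "s x = 0") (simp_all add: power2_eq_square mult.assoc[symmetric])
  qed
  then have S: "blinfun_apply (Blinfun s) = s" by (simp add: bounded_linear_Blinfun_apply)
  \<comment> \<open>Riesz gives the identity for the real inner product only. The imaginary part is
    the real product at \<open>\<i> *\<^sub>C y\<close>, and complex linearity of \<open>T\<close>
    carries the identity over.\<close>
  have adj: "cinner (s x) y = cinner x (T y)" for x y
    by (rule complex_eqI) (simp_all add: Re_cinner Im_cinner s[symmetric] bopD[OF T])
  have "s (c *\<^sub>C x) = c *\<^sub>C s x" for c x
    by (rule cinner_eqI) (simp add: Re_cinner[symmetric] adj cinner_scaleC_left)
  then have "Blinfun s \<in> bop" by (simp add: bop_def S)
  then show ?thesis using adj S by (intro bexI[of _ "Blinfun s"]) auto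
qed

lemma cinner_adj_left:
  assumes "T \<in> bop"
  shows "cinner (blinfun_apply (adj T) x) y = cinner x (T y)"
  using adjoint_exists[OF assms] adjoint_unique by metis

lemma cinner_adj_right:
  assumes "T \<in> bop"
  shows "cinner x (blinfun_apply (adj T) y) = cinner (T x) y"
  by (metis assms cinner_adj_left cinner_commute)

lemma adj_bop: "T \<in> bop \<Longrightarrow> adj T \<in> bop"
  using adjoint_exists adjoint_unique by metis

lemma adj_adj: "T \<in> bop \<Longrightarrow> adj (adj T) = T"
  by (rule adjoint_unique) (simp add: cinner_adj_right)

lemma bop_add: "S \<in> bop \<Longrightarrow> T \<in> bop \<Longrightarrow> S + T \<in> bop"
  by (simp add: bop_def blinfun.add_left scaleC_add_right)

lemma bop_scaleR: "T \<in> bop \<Longrightarrow> a *\<^sub>R T \<in> bop"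
  by (simp add: bop_def blinfun.scaleR_left scaleC_scaleR)

lemma bop_diff: "S \<in> bop \<Longrightarrow> T \<in> bop \<Longrightarrow> S - T \<in> bop"
  using bop_add[of S "(- 1) *\<^sub>R T"] bop_scaleR[of T "- 1"] by simp

lemma bop_zero: "0 \<in> bop" by (simp add: bop_def)

lemma bop_id: "id_blinfun \<in> bop" by (simp add: bop_def)

lemma bop_compose: "S \<in> bop \<Longrightarrow> T \<in> bop \<Longrightarrow> S o\<^sub>L T \<in> bop"
  by (simp add: bop_def)

lemma bop_scaleC: "T \<in> bop \<Longrightarrow> scaleC_op c T \<in> bop"
  by (simp add: bop_def scaleC_op.rep_eq scaleC_scaleC mult.commute)

lemma bop_sum: "(\<And>i. i \<in> I \<Longrightarrow> T i \<in> bop) \<Longrightarrow> (\<Sum>i\<in>I. T i) \<in> bop"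
  by (induction I rule: infinite_finite_induct) (auto simp: bop_zero bop_add)

lemmas bop_intros = bop_add bop_scaleR bop_diff bop_zero bop_id bop_compose bop_scaleC bop_sum adj_bop

lemma adj_compose:
  assumes "S \<in> bop" "T \<in> bop"
  shows "adj (S o\<^sub>L T) = adj T o\<^sub>L adj S"
  by (rule adjoint_unique) (simp add: assms cinner_adj_left)

lemma selfadjointI:
  assumes "T \<in> bop" "\<And>x y. cinner (blinfun_apply T x) y = cinner x (T y)"
  shows "selfadjoint T"
  using assms adjoint_unique[of T T] by (simp add: selfadjoint_def)

lemma selfadjoint_bop: "selfadjoint T \<Longrightarrow> T \<in> bop"
  by (simp add: selfadjoint_def)

lemma selfadjoint_adj: "selfadjoint T \<Longrightarrow> adj T = T"
  by (simp add: selfadjoint_def)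

lemma selfadjointD: "selfadjoint T \<Longrightarrow> cinner (T x) y = cinner x (T y)"
  by (metis selfadjoint_def cinner_adj_left)

lemma selfadjoint_inner: "selfadjoint T \<Longrightarrow> inner (T x) y = inner x (T y)"
  by (metis selfadjointD Re_cinner)

lemma selfadjoint_add: "selfadjoint S \<Longrightarrow> selfadjoint T \<Longrightarrow> selfadjoint (S + T)"
  by (rule selfadjointI)
    (auto intro: bop_add dest: selfadjoint_bop
      simp: blinfun.add_left cinner.add_left cinner.add_right selfadjointD)

lemma selfadjoint_scaleR: "selfadjoint T \<Longrightarrow> selfadjoint (a *\<^sub>R T)"
  by (rule selfadjointI)
    (auto intro: bop_scaleR dest: selfadjoint_bop
      simp: blinfun.scaleR_left cinner.scaleR_left cinner.scaleR_right selfadjointD)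

lemma selfadjoint_diff: "selfadjoint S \<Longrightarrow> selfadjoint T \<Longrightarrow> selfadjoint (S - T)"
  using selfadjoint_add[of S "(- 1) *\<^sub>R T"] selfadjoint_scaleR[of T "- 1"] by simp

lemma selfadjoint_id: "selfadjoint id_blinfun"
  by (rule selfadjointI) (auto simp: bop_id)

lemma selfadjoint_zero: "selfadjoint 0"
  by (rule selfadjointI) (auto simp: bop_zero cinner.zero_left cinner.zero_right)

lemma selfadjoint_sum: "(\<And>i. i \<in> I \<Longrightarrow> selfadjoint (T i)) \<Longrightarrow> selfadjoint (\<Sum>i\<in>I. T i)"
  by (induction I rule: infinite_finite_induct) (auto simp: selfadjoint_zero selfadjoint_add)

lemma selfadjoint_congruence:
  assumes "selfadjoint A" "X \<in> bop"
  shows "selfadjoint (adj X o\<^sub>L A o\<^sub>L X)"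
  by (rule selfadjointI)
    (auto intro!: bop_intros
      simp: assms selfadjoint_bop[OF assms(1)] cinner_adj_left cinner_adj_right selfadjointD)

lemma selfadjoint_limit:
  assumes lim: "T \<longlonglongrightarrow> L" and T: "\<And>n::nat. selfadjoint (T n)"
  shows "selfadjoint L"
proof (rule selfadjointI)
  have ap: "(\<lambda>n. T n x) \<longlonglongrightarrow> L x" for x by (intro tendsto_intros lim)
  show "cinner (L x) y = cinner x (L y)" for x y
    using LIMSEQ_unique[OF cinner.tendsto[OF ap tendsto_const, of x y]]
      cinner.tendsto[OF tendsto_const ap, of x y] by (simp add: selfadjointD[OF T])
  have "bounded_linear ((*\<^sub>C) c :: 'a \<Rightarrow> 'a)" for c
    by (rule bounded_linear_intro[where K = "cmod c"])
      (simp_all add: scaleC_add_right scaleC_scaleR norm_scaleC mult.commute)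
  then have "(\<lambda>n. c *\<^sub>C T n x) \<longlonglongrightarrow> c *\<^sub>C L x" for c x
    using bounded_linear.tendsto ap by blast
  then show "L \<in> bop"
    using LIMSEQ_unique[OF ap] by (auto simp: bop_def bopD[OF selfadjoint_bop[OF T], symmetric])
qed


section \<open>The Loewner order\<close>

lemma positive_op_iff: "positive_op T \<longleftrightarrow> selfadjoint T \<and> (\<forall>x. 0 \<le> inner (T x) x)"
  by (simp add: positive_op_def Re_cinner)

lemma loewner_leI:
  assumes "selfadjoint S" "selfadjoint T" "\<And>x. inner (blinfun_apply S x) x \<le> inner (T x) x"
  shows "S \<le>\<^sub>L T"
  using assms by (simp add: loewner_le_def positive_op_iff selfadjoint_diff blinfun.diff_left inner_diff_left)

lemma loewner_leD: "S \<le>\<^sub>L T \<Longrightarrow> inner (S x) x \<le> inner (T x) x"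
  by (simp add: loewner_le_def positive_op_iff blinfun.diff_left inner_diff_left)

lemma loewner_le_trans [trans]:
  assumes "A \<le>\<^sub>L B" "B \<le>\<^sub>L C"
  shows "A \<le>\<^sub>L C"
proof -
  have "C - A = (C - B) + (B - A)" by simp
  then show ?thesis
    using assms unfolding loewner_le_def positive_op_iff
    by (metis selfadjoint_add blinfun.add_left inner_add_left add_nonneg_nonneg)
qed

lemma inner_congruence:
  "X \<in> bop \<Longrightarrow> inner ((adj X o\<^sub>L A o\<^sub>L X) x) x = inner (A (X x)) (X x)"
  by (simp add: Re_cinner[symmetric] cinner_adj_left)

lemma loewner_le_congruence:
  assumes "A \<le>\<^sub>L B" "selfadjoint A" "selfadjoint B" "X \<in> bop"
  shows "adj X o\<^sub>L A o\<^sub>L X \<le>\<^sub>L adj X o\<^sub>L B o\<^sub>L X"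
  by (rule loewner_leI)
    (auto intro!: selfadjoint_congruence loewner_leD
      simp: assms inner_congruence simp del: blinfun_apply_blinfun_compose)

text \<open>Bounds on the quadratic form pass directly through positive maps, convex combinations
  and isometric congruences; \<open>spectrum_between\<close> converts them where the spectrum is
  needed. On the zero space even \<open>a > b\<close> is possible.\<close>

definition op_between :: "real \<Rightarrow> real \<Rightarrow> ('h::complex_hilbert_space \<Rightarrow>\<^sub>L 'h) \<Rightarrow> bool" where
  "op_between a b A \<longleftrightarrow> selfadjoint A \<and>
     (\<forall>x. a * (norm x)\<^sup>2 \<le> inner (blinfun_apply A x) x \<and> inner (blinfun_apply A x) x \<le> b * (norm x)\<^sup>2)"

lemma op_between_selfadjoint: "op_between a b A \<Longrightarrow> selfadjoint A"
  by (simp add: op_between_def)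

lemma op_between_mono: "op_between a b A \<Longrightarrow> a' \<le> a \<Longrightarrow> b \<le> b' \<Longrightarrow> op_between a' b' A"
  unfolding op_between_def by (meson mult_right_mono order_trans zero_le_power2)

lemma inner_le_norm_op: "\<bar>inner (blinfun_apply A x) x\<bar> \<le> norm A * (norm x)\<^sup>2"
proof -
  have "\<bar>inner (A x) x\<bar> \<le> norm (A x) * norm x" by (rule Cauchy_Schwarz_ineq2)
  also have "\<dots> \<le> (norm A * norm x) * norm x" by (intro mult_right_mono norm_blinfun) simp
  finally show ?thesis by (simp add: power2_eq_square mult.assoc)
qed

lemma op_between_norm: "selfadjoint A \<Longrightarrow> op_between (- norm A) (norm A) A"
  using inner_le_norm_op[of A] by (simp add: op_between_def abs_le_iff) (metis minus_le_iff)

lemma op_between_sum: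
  assumes "\<And>i. i \<in> I \<Longrightarrow> positive_op (C i)" "(\<Sum>i\<in>I. C i) = id_blinfun"
    and t: "\<And>i. i \<in> I \<Longrightarrow> a \<le> t i \<and> t i \<le> b"
  shows "op_between a b (\<Sum>i\<in>I. t i *\<^sub>R C i)"
  unfolding op_between_def
proof (intro conjI allI)
  show "selfadjoint (\<Sum>i\<in>I. t i *\<^sub>R C i)"
    using assms(1) by (intro selfadjoint_sum selfadjoint_scaleR) (auto simp: positive_op_iff)
  fix x
  have n: "(norm x)\<^sup>2 = (\<Sum>i\<in>I. inner (C i x) x)"
    using arg_cong[OF assms(2), of "\<lambda>T. inner (blinfun_apply T x) x"]
    by (simp add: blinfun.sum_left inner_sum_left power2_norm_eq_inner)
  have p: "0 \<le> inner (C i x) x" if "i \<in> I" for i using assms(1)[OF that] by (simp add: positive_op_iff)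
  show "a * (norm x)\<^sup>2 \<le> inner ((\<Sum>i\<in>I. t i *\<^sub>R C i) x) x"
    "inner ((\<Sum>i\<in>I. t i *\<^sub>R C i) x) x \<le> b * (norm x)\<^sup>2"
    unfolding n blinfun.sum_left inner_sum_left blinfun.scaleR_left inner_scaleR_left sum_distrib_left
    by (auto intro!: sum_mono mult_right_mono p t simp: t)
qed


section \<open>Coercive operators and the spectrum\<close>

lemma invertible_opI:
  assumes "T \<in> bop" "S \<in> bop" "S o\<^sub>L T = id_blinfun" "T o\<^sub>L S = id_blinfun"
  shows "invertible_op T"
  using assms by (auto simp: invertible_op_def)

text \<open>Lax-Milgram argument: a solution of T x = y is a fixed point of x - s (T x - y), a
  contraction for suitable \<open>s\<close>. No symmetry may be assumed, because the lemma is
  applied to multiples of A - z with complex z.\<close>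

lemma coercive_invertible:
  fixes T :: "'h::complex_hilbert_space \<Rightarrow>\<^sub>L 'h"
  assumes T: "T \<in> bop" and c: "0 < c"
    and coercive: "\<And>x. c * (norm x)\<^sup>2 \<le> inner (T x) x"
  shows "invertible_op T"
proof -
  have lower: "c * norm x \<le> norm (T x)" for x
  proof (cases "x = 0")
    case False
    have "(c * norm x) * norm x \<le> norm (T x) * norm x"
      using coercive[of x] norm_cauchy_schwarz[of "T x" x] by (simp add: power2_eq_square mult.assoc)
    then show ?thesis using False by simp
  qed simp
  \<comment> \<open>Adding \<open>c\<close> to the norm makes \<open>M\<close> positive and at least
    \<open>c\<close>, so that \<open>k\<close> lies in [0, 1).\<close>
  define M where "M = norm T + c"
  have M: "0 < M" "c \<le> M" using c by (auto simp: M_def add_nonneg_pos)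
  \<comment> \<open>The minimiser of 1 - 2 s c + s^2 M^2, which bounds the squared contraction
    factor; the minimum is \<open>k\<close>.\<close>
  define s where "s = c / M\<^sup>2"
  have s: "0 < s" using c M by (simp add: s_def)
  define k where "k = 1 - c\<^sup>2 / M\<^sup>2"
  have k: "0 \<le> k" "k < 1"
    using c M by (auto simp: k_def power2_eq_square intro!: mult_mono)
  have contr: "(norm (x - s *\<^sub>R T x))\<^sup>2 \<le> k * (norm x)\<^sup>2" for x
  proof -
    have "norm (T x) \<le> norm T * norm x" by (rule norm_blinfun)
    also have "\<dots> \<le> M * norm x" using c by (intro mult_right_mono) (auto simp: M_def)
    finally have "(norm (T x))\<^sup>2 \<le> (M * norm x)\<^sup>2" by (intro power_mono) auto
    then have "s\<^sup>2 * (norm (T x))\<^sup>2 \<le> s\<^sup>2 * (M * norm x)\<^sup>2" by (intro mult_left_mono) auto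
    moreover have "s\<^sup>2 * (M * norm x)\<^sup>2 = (c\<^sup>2 / M\<^sup>2) * (norm x)\<^sup>2"
      using M by (simp add: s_def power2_eq_square field_simps)
    moreover have "2 * s * (c * (norm x)\<^sup>2) \<le> 2 * s * inner (T x) x"
      using s coercive by (intro mult_left_mono) auto
    moreover have "2 * s * (c * (norm x)\<^sup>2) = 2 * (c\<^sup>2 / M\<^sup>2) * (norm x)\<^sup>2"
      by (simp add: s_def power2_eq_square)
    moreover have "(norm (x - s *\<^sub>R T x))\<^sup>2 = (norm x)\<^sup>2 - 2 * s * inner (T x) x + s\<^sup>2 * (norm (T x))\<^sup>2"
      unfolding power2_norm_eq_inner
      by (simp add: inner_simps inner_commute[of x "T x"] power2_eq_square algebra_simps)
    moreover have "k * (norm x)\<^sup>2 = (norm x)\<^sup>2 - (c\<^sup>2 / M\<^sup>2) * (norm x)\<^sup>2"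
      by (simp add: k_def algebra_simps)
    ultimately show ?thesis by simp
  qed
  have surj: "\<exists>x. T x = y" for y
  proof -
    have "\<exists>!x. x - s *\<^sub>R (T x - y) = x"
    proof (rule banach_fix_type[of "sqrt k"])
      show "0 \<le> sqrt k" "sqrt k < 1" using k by auto
      show "\<forall>x z. dist (x - s *\<^sub>R (T x - y)) (z - s *\<^sub>R (T z - y)) \<le> sqrt k * dist x z"
      proof (intro allI)
        fix x z
        have "norm ((x - z) - s *\<^sub>R T (x - z)) \<le> sqrt (k * (norm (x - z))\<^sup>2)"
          by (rule real_le_rsqrt) (rule contr)
        moreover have "(x - z) - s *\<^sub>R T (x - z) = (x - s *\<^sub>R (T x - y)) - (z - s *\<^sub>R (T z - y))"
          by (simp add: blinfun.diff_right algebra_simps)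
        ultimately show "dist (x - s *\<^sub>R (T x - y)) (z - s *\<^sub>R (T z - y)) \<le> sqrt k * dist x z"
          by (simp add: dist_norm real_sqrt_mult)
      qed
    qed
    then show ?thesis using s by (auto simp: ex1_implies_ex)
  qed
  have inj: "x = z" if "T x = T z" for x z
    using lower[of "x - z"] that c by (simp add: blinfun.diff_right mult_le_0_iff)
  obtain R where R: "\<And>y. T (R y) = y" using surj by metis
  have "bounded_linear R"
  proof (rule bounded_linear_intro[where K = "1 / c"])
    show "R (x + y) = R x + R y" for x y by (rule inj) (simp add: R blinfun.add_right)
    show "R (a *\<^sub>R x) = a *\<^sub>R R x" for a x by (rule inj) (simp add: R blinfun.scaleR_right)
    show "norm (R x) \<le> norm x * (1 / c)" for x
      using lower[of "R x"] c by (simp add: R field_simps)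
  qed
  then have ap: "blinfun_apply (Blinfun R) = R" by (simp add: bounded_linear_Blinfun_apply)
  show ?thesis
  proof (rule invertible_opI[OF T])
    have "R (c *\<^sub>C x) = c *\<^sub>C R x" for c x by (rule inj) (simp add: R bopD[OF T])
    then show "Blinfun R \<in> bop" by (simp add: bop_def ap)
    have "R (T x) = x" for x by (rule inj) (rule R)
    then show "Blinfun R o\<^sub>L T = id_blinfun" by (intro blinfun_eqI) (simp add: ap)
    show "T o\<^sub>L Blinfun R = id_blinfun" by (rule blinfun_eqI) (simp add: R ap)
  qed
qed

lemma invertible_op_scaleC:
  assumes "invertible_op T" "c \<noteq> 0"
  shows "invertible_op (scaleC_op c T)"
proof -
  obtain S where S: "T \<in> bop" "S \<in> bop" "S o\<^sub>L T = id_blinfun" "T o\<^sub>L S = id_blinfun"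
    using assms by (auto simp: invertible_op_def)
  have one: "1 *\<^sub>C x = x" for x :: 'a using scaleC_of_real[of 1 x] by simp
  have ap: "S (T x) = x" "T (S x) = x" for x
    using S by (metis blinfun_apply_blinfun_compose blinfun_apply_id_blinfun)+
  show ?thesis
    by (rule invertible_opI[where S = "scaleC_op (1 / c) S"])
      (auto intro!: bop_scaleC blinfun_eqI S
        simp: scaleC_op.rep_eq bopD S scaleC_scaleC ap one assms)
qed

lemma scaleC_op_of_real: "scaleC_op (complex_of_real t) T = t *\<^sub>R T"
  by (rule blinfun_eqI) (simp add: scaleC_op.rep_eq blinfun.scaleR_left scaleC_of_real)

lemma scaleC_op_scaleC_op: "scaleC_op c (scaleC_op d T) = scaleC_op (c * d) T"
  by (rule blinfun_eqI) (simp add: scaleC_op.rep_eq scaleC_scaleC)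

lemma scaleC_op_one: "scaleC_op 1 T = T"
  using scaleC_op_of_real[of 1 T] by simp

lemma spectrum_between:
  assumes A: "op_between a b A"
  shows "spectrum A \<subseteq> complex_of_real ` {a..b}"
proof
  fix z assume "z \<in> spectrum A"
  then have ni: "\<not> invertible_op (A - scaleC_op z id_blinfun)" by (simp add: spectrum_def)
  define T where "T = A - scaleC_op z id_blinfun"
  have sa: "selfadjoint A" using A by (rule op_between_selfadjoint)
  have T: "T \<in> bop" unfolding T_def by (intro bop_intros selfadjoint_bop sa)
  have Im0: "Im (cinner (A x) x) = 0" for x
    using arg_cong[OF cinner_commute[of "A x" x], of Im] selfadjointD[OF sa, of x x] by simp
  have Txx: "cinner (T x) x = cinner (A x) x - z * complex_of_real ((norm x)\<^sup>2)" for x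
    by (simp add: T_def blinfun.diff_left cinner.diff_left scaleC_op.rep_eq cinner_scaleC_left cinner_same)
  \<comment> \<open>If some multiple of \<open>T\<close> is coercive, \<open>T\<close> is
    invertible, against \<open>z\<close> being spectral. The multiples used below are
    \<open>\<i>\<close> with the sign of \<open>Im z\<close>, and then 1 and -1 for a real
    \<open>z\<close> to the left or right of \<open>{a..b}\<close>.\<close>
  have scaled: "c = 0 \<or> \<not> (\<exists>d>0. \<forall>x. d * (norm x)\<^sup>2 \<le> Re (c * cinner (T x) x))" for c
  proof (rule ccontr)
    assume "\<not> ?thesis"
    then obtain d where c: "c \<noteq> 0" and d: "0 < d" "\<And>x. d * (norm x)\<^sup>2 \<le> Re (c * cinner (T x) x)" by blast
    have "invertible_op (scaleC_op c T)"
      by (rule coercive_invertible[OF bop_scaleC[OF T] d(1)])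
        (metis d(2) Re_cinner cinner_scaleC_left scaleC_op.rep_eq)
    from invertible_op_scaleC[OF this, of "1 / c"] show False
      using ni c by (simp add: scaleC_op_scaleC_op scaleC_op_one T_def)
  qed
  have Imz: "Im z = 0"
  proof (rule ccontr)
    assume ne: "Im z \<noteq> 0"
    define c where "c = \<i> * complex_of_real (sgn (Im z))"
    have "\<bar>Im z\<bar> * (norm x)\<^sup>2 \<le> Re (c * cinner (T x) x)" for x
      by (simp add: Txx c_def Im0 abs_sgn del: of_real_power)
    moreover have "c \<noteq> 0" using ne by (simp add: c_def sgn_zero_iff)
    ultimately show False using scaled[of c] ne zero_less_abs_iff by blast
  qed
  have "a \<le> Re z"
  proof (rule ccontr)
    assume "\<not> ?thesis"
    moreover have "(a - Re z) * (norm x)\<^sup>2 \<le> Re (1 * cinner (T x) x)" for x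
      using A Imz by (simp add: Txx op_between_def Re_cinner algebra_simps del: of_real_power)
    ultimately show False using scaled[of 1] by (metis diff_gt_0_iff_gt linorder_not_le one_neq_zero)
  qed
  moreover have "Re z \<le> b"
  proof (rule ccontr)
    assume "\<not> ?thesis"
    moreover have "(Re z - b) * (norm x)\<^sup>2 \<le> Re ((- 1) * cinner (T x) x)" for x
      using A Imz by (simp add: Txx op_between_def Re_cinner algebra_simps del: of_real_power)
    ultimately show False using scaled[of "- 1"] by (metis diff_gt_0_iff_gt linorder_not_le one_neq_zero neg_equal_0_iff_equal)
  qed
  ultimately show "z \<in> complex_of_real ` {a..b}"
    using Imz by (intro image_eqI[of _ _ "Re z"]) (auto simp: complex_eq_iff)
qed

lemma invertible_op_bounded_below:
  assumes "invertible_op T"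
  shows "\<exists>c>0. \<forall>x. c * norm x \<le> norm (blinfun_apply T x)"
proof -
  obtain S where S: "S o\<^sub>L T = id_blinfun" using assms by (auto simp: invertible_op_def)
  have "norm x \<le> (norm S + 1) * norm (T x)" for x
  proof -
    have "x = S (T x)" using S by (metis blinfun_apply_blinfun_compose blinfun_apply_id_blinfun)
    then have "norm x \<le> norm S * norm (T x)" by (metis norm_blinfun)
    also have "\<dots> \<le> (norm S + 1) * norm (T x)" by (intro mult_right_mono) auto
    finally show ?thesis .
  qed
  moreover have "0 < norm S + 1" by (simp add: add_nonneg_pos)
  ultimately show ?thesis
    by (intro exI[of _ "1 / (norm S + 1)"]) (simp add: pos_divide_le_eq mult.commute)
qed

text \<open>A lower bound on |A x| has to become one on the quadratic form. Square roots of
  \<open>A\<close> are not at hand yet; positivity at the vector x - s A x gives s |A x|^2 <= <A x,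
  x> instead.\<close>

lemma positive_invertible_op_between:
  assumes A: "positive_op A" and inv: "invertible_op A"
  shows "\<exists>m M. 0 < m \<and> m < M \<and> op_between m M A"
proof -
  obtain c where c: "0 < c" "\<And>x. c * norm x \<le> norm (A x)"
    using invertible_op_bounded_below[OF inv] by blast
  have sa: "selfadjoint A" and pos: "\<And>x. 0 \<le> inner (A x) x" using A by (auto simp: positive_op_iff)
  define N where "N = norm A + 1"
  have N: "0 < N" "norm A \<le> N" by (auto simp: N_def add_nonneg_pos)
  define m where "m = c\<^sup>2 / N"
  have m: "0 < m" using c N by (simp add: m_def)
  have low: "m * (norm x)\<^sup>2 \<le> inner (A x) x" for x
  proof -
    \<comment> \<open>As \<open>N\<close> exceeds the norm of \<open>A\<close>, the term of order
      s^2 in the expansion is at most s |A x|^2, half of the term of order s.\<close>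
    define s where "s = 1 / N"
    have "0 \<le> inner (A (x - s *\<^sub>R A x)) (x - s *\<^sub>R A x)" by (rule pos)
    also have "\<dots> = inner (A x) x - 2 * s * (norm (A x))\<^sup>2 + s\<^sup>2 * inner (A (A x)) (A x)"
      unfolding power2_norm_eq_inner
      by (simp add: blinfun.diff_right blinfun.scaleR_right inner_simps
          selfadjoint_inner[OF sa, of "A x" x] power2_eq_square algebra_simps)
    finally have 1: "2 * s * (norm (A x))\<^sup>2 \<le> inner (A x) x + s\<^sup>2 * inner (A (A x)) (A x)" by simp
    have "inner (A (A x)) (A x) \<le> N * (norm (A x))\<^sup>2"
      by (rule order_trans[OF order_trans[OF abs_ge_self inner_le_norm_op]]) (use N in \<open>auto intro: mult_right_mono\<close>)
    then have "s\<^sup>2 * inner (A (A x)) (A x) \<le> s\<^sup>2 * (N * (norm (A x))\<^sup>2)" by (intro mult_left_mono) auto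
    also have "\<dots> = s * (norm (A x))\<^sup>2" using N by (simp add: s_def power2_eq_square)
    finally have "s * (norm (A x))\<^sup>2 \<le> inner (A x) x" using 1 by simp
    moreover have "(c * norm x)\<^sup>2 \<le> (norm (A x))\<^sup>2" using c by (intro power_mono) auto
    then have "s * (c * norm x)\<^sup>2 \<le> s * (norm (A x))\<^sup>2" using N by (intro mult_left_mono) (auto simp: s_def)
    moreover have "s * (c * norm x)\<^sup>2 = m * (norm x)\<^sup>2" by (simp add: s_def m_def power_mult_distrib)
    ultimately show ?thesis by simp
  qed
  have "op_between m (max (norm A) (m + 1)) A"
    unfolding op_between_def
  proof (intro conjI sa allI low)
    fix x
    have "inner (A x) x \<le> norm A * (norm x)\<^sup>2" using inner_le_norm_op[of A x] by simp
    also have "\<dots> \<le> max (norm A) (m + 1) * (norm x)\<^sup>2" by (intro mult_right_mono) auto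
    finally show "inner (A x) x \<le> max (norm A) (m + 1) * (norm x)\<^sup>2" .
  qed
  then show ?thesis using m by (intro exI[of _ m] exI[of _ "max (norm A) (m + 1)"]) auto
qed


section \<open>Polynomials of a self-adjoint operator\<close>

lemma blinfun_compose_assoc: "(A o\<^sub>L B) o\<^sub>L C = A o\<^sub>L (B o\<^sub>L C)"
  by (rule blinfun_eqI) simp

interpretation blinfun_compose: bounded_bilinear "(o\<^sub>L)"
  by (rule bounded_bilinear_blinfun_compose)

lemma blinfun_compose_id [simp]: "id_blinfun o\<^sub>L A = A" "A o\<^sub>L id_blinfun = A"
  by (rule blinfun_eqI, simp)+

lemma poly_op_0 [simp]: "poly_op 0 A = 0"
  by (simp add: poly_op_def)

lemma poly_op_altdef:
  assumes "degree p \<le> n"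
  shows "poly_op p A = (\<Sum>i\<le>n. coeff p i *\<^sub>R (((o\<^sub>L) A ^^ i) id_blinfun))"
  unfolding poly_op_def using assms
  by (intro sum.mono_neutral_left) (auto simp: coeff_eq_0)

lemma poly_op_pCons: "poly_op (pCons c p) A = c *\<^sub>R id_blinfun + (A o\<^sub>L poly_op p A)"
proof -
  have "poly_op (pCons c p) A = (\<Sum>i\<le>Suc (degree p). coeff (pCons c p) i *\<^sub>R (((o\<^sub>L) A ^^ i) id_blinfun))"
    by (intro poly_op_altdef degree_pCons_le)
  also have "\<dots> = c *\<^sub>R id_blinfun + (A o\<^sub>L poly_op p A)"
    by (subst sum.atMost_Suc_shift)
      (simp add: poly_op_def blinfun_compose.sum_right blinfun_compose.scaleR_right)
  finally show ?thesis .
qed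

lemma poly_op_add: "poly_op (p + q) A = poly_op p A + poly_op q A"
  by (induction p q rule: poly_induct2)
    (auto simp: poly_op_pCons blinfun_compose.add_right scaleR_add_left)

lemma poly_op_smult: "poly_op (smult c p) A = c *\<^sub>R poly_op p A"
  by (induction p) (auto simp: poly_op_pCons blinfun_compose.scaleR_right scaleR_add_right)

lemma poly_op_diff: "poly_op (p - q) A = poly_op p A - poly_op q A"
  using poly_op_add[of p "smult (- 1) q" A] poly_op_smult[of "- 1" q A] by simp

lemma poly_op_mult: "poly_op (p * q) A = poly_op p A o\<^sub>L poly_op q A"
  by (induction p)
    (auto simp: poly_op_pCons poly_op_add poly_op_smult blinfun_compose.add_left
      blinfun_compose.scaleR_left blinfun_compose_assoc)

lemma poly_op_X: "poly_op [:0, 1:] A = A"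
  by (simp add: poly_op_pCons)

lemma poly_op_commute: "A o\<^sub>L poly_op p A = poly_op p A o\<^sub>L A"
  by (metis poly_op_mult poly_op_X mult.commute)

lemma poly_op_selfadjoint:
  assumes "selfadjoint A"
  shows "selfadjoint (poly_op p A)"
proof (induction p)
  case (pCons c p)
  have "selfadjoint (A o\<^sub>L poly_op p A)"
  proof (rule selfadjointI)
    show "A o\<^sub>L poly_op p A \<in> bop" using assms pCons by (intro bop_compose selfadjoint_bop)
    show "cinner ((A o\<^sub>L poly_op p A) x) y = cinner x ((A o\<^sub>L poly_op p A) y)" for x y
      by (subst (2) poly_op_commute) (simp add: selfadjointD[OF assms] selfadjointD[OF pCons.IH])
  qed
  then show ?case
    unfolding poly_op_pCons by (intro selfadjoint_add selfadjoint_scaleR selfadjoint_id)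
qed (simp add: selfadjoint_zero)

lemma map_poly_of_real_add:
  "map_poly complex_of_real (p + q) = map_poly of_real p + map_poly of_real q"
  by (rule poly_eqI) (simp add: coeff_map_poly)

lemma map_poly_of_real_mult:
  "map_poly complex_of_real (p * q) = map_poly of_real p * map_poly of_real q"
  by (induction p) (simp_all add: map_poly_of_real_add map_poly_smult map_poly_pCons)

lemma poly_map_poly_of_real:
  "poly (map_poly complex_of_real p) (complex_of_real t) = complex_of_real (poly p t)"
  by (induction p) (simp_all add: map_poly_pCons)

text \<open>The quadratic is (X - z)(X - cnj z). The remainder has degree at most 1, and a real
  polynomial of this kind with a nonreal root has both coefficients equal to 0.\<close>

lemma nonreal_root_quadratic_dvd:
  assumes root: "poly (map_poly complex_of_real q) z = 0" and z: "Im z \<noteq> 0"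
  shows "[:(Re z)\<^sup>2 + (Im z)\<^sup>2, - 2 * Re z, 1:] dvd q"
proof -
  define d where "d = [:(Re z)\<^sup>2 + (Im z)\<^sup>2, - 2 * Re z, 1:]"
  have dz: "poly (map_poly complex_of_real d) z = 0"
    by (simp add: d_def map_poly_pCons complex_eq_iff power2_eq_square algebra_simps)
  have "degree (q mod d) < 2"
    using degree_mod_less[of d q] by (auto simp: d_def)
  moreover obtain u s where us: "q mod d = pCons u s" by (rule pCons_cases)
  ultimately have "degree s = 0" by (cases "s = 0") auto
  then obtain v where "s = [:v:]" by (rule degree_eq_zeroE)
  then have r: "q mod d = [:u, v:]" using us by simp
  have "map_poly complex_of_real q = map_poly of_real (q div d) * map_poly of_real d + map_poly of_real (q mod d)"
    by (metis div_mult_mod_eq map_poly_of_real_add map_poly_of_real_mult)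
  then have "poly (map_poly complex_of_real (q mod d)) z = 0" using root dz by simp
  then have "complex_of_real u + z * complex_of_real v = 0" by (simp add: r map_poly_pCons)
  then have "v = 0" "u = 0" using z by (auto simp: complex_eq_iff)
  then show ?thesis unfolding d_def[symmetric] using r by (simp add: dvd_eq_mod_eq_0)
qed

text \<open>One half of the spectral mapping theorem: \<open>q\<close> splits into real linear and
  quadratic factors, and lower bounds of factors multiply. A linear factor is bounded below because
  its root is off the spectrum, a quadratic factor with nonreal roots because \<open>A\<close> is
  self-adjoint.\<close>

lemma poly_op_bounded_below:
  assumes A: "selfadjoint A"
  shows "q \<noteq> 0 \<Longrightarrow> (\<And>t. complex_of_real t \<in> spectrum A \<Longrightarrow> poly q t \<noteq> 0) \<Longrightarrow>
    \<exists>c>0. \<forall>x. c * norm x \<le> norm (poly_op q A x)"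
proof (induction "degree q" arbitrary: q rule: less_induct)
  case less
  have split: "\<exists>c>0. \<forall>x. c * norm x \<le> norm (poly_op q A x)"
    if q: "q = d * s" "0 < degree d" and d: "0 < c1" "\<And>x. c1 * norm x \<le> norm (poly_op d A x)" for d s c1
  proof -
    have ne: "d \<noteq> 0" "s \<noteq> 0" using less.prems(1) q by auto
    then have "degree s < degree q" using q by (simp add: degree_mult_eq)
    moreover have "poly s t \<noteq> 0" if "complex_of_real t \<in> spectrum A" for t
      using less.prems(2)[OF that] q by auto
    ultimately obtain c2 where c2: "0 < c2" "\<And>x. c2 * norm x \<le> norm (poly_op s A x)"
      using less.hyps[of s] ne by blast
    have "c1 * c2 * norm x \<le> norm (poly_op q A x)" for x
    proof -
      have "c1 * (c2 * norm x) \<le> c1 * norm (poly_op s A x)" using c2 d by (intro mult_left_mono) auto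
      also have "\<dots> \<le> norm (poly_op d A (poly_op s A x))" by (rule d)
      finally show ?thesis by (simp add: q poly_op_mult mult.assoc)
    qed
    then show ?thesis using d c2 by (intro exI[of _ "c1 * c2"]) auto
  qed
  show ?case
  proof (cases "degree q = 0")
    case True
    then obtain k where "q = [:k:]" by (rule degree_eq_zeroE)
    then show ?thesis using less.prems(1)
      by (intro exI[of _ "\<bar>k\<bar>"]) (auto simp: poly_op_pCons blinfun.scaleR_left)
  next
    case False
    then have "\<not> constant (poly (map_poly complex_of_real q))"
      by (simp add: constant_degree degree_map_poly)
    then obtain z where z: "poly (map_poly complex_of_real q) z = 0"
      using fundamental_theorem_of_algebra by blast
    show ?thesis
    proof (cases "Im z = 0")
      case True
      then have zr: "z = complex_of_real (Re z)" by (simp add: complex_eq_iff)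
      then have "poly q (Re z) = 0" using z poly_map_poly_of_real by (metis of_real_eq_0_iff)
      moreover from this obtain s where "q = [:- Re z, 1:] * s" by (auto simp: poly_eq_0_iff_dvd dvd_def)
      moreover have "z \<notin> spectrum A" using less.prems(2) zr \<open>poly q (Re z) = 0\<close> by metis
      then have "invertible_op (A - Re z *\<^sub>R id_blinfun)"
        using zr by (simp add: spectrum_def) (metis scaleC_op_of_real)
      then obtain c where "0 < c" "\<And>x. c * norm x \<le> norm ((A - Re z *\<^sub>R id_blinfun) x)"
        using invertible_op_bounded_below by blast
      moreover have "poly_op [:- Re z, 1:] A = A - Re z *\<^sub>R id_blinfun"
        by (simp add: poly_op_pCons)
      ultimately show ?thesis
        using split[of "[:- Re z, 1:]" s c] by simp
    next
      case False
      define d where "d = [:(Re z)\<^sup>2 + (Im z)\<^sup>2, - 2 * Re z, 1:]"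
      obtain s where "q = d * s"
        using nonreal_root_quadratic_dvd[OF z False] by (auto simp: d_def dvd_def)
      moreover have "0 < degree d" by (simp add: d_def)
      moreover have "(Im z)\<^sup>2 * norm x \<le> norm (poly_op d A x)" for x
      proof (cases "x = 0")
        case False
        let ?B = "A - Re z *\<^sub>R id_blinfun"
        \<comment> \<open>Completing the square: \<open>d\<close> is (X - Re z)^2 + (Im z)^2, so its
          quadratic form dominates (Im z)^2 |x|^2.\<close>
        have "inner (poly_op d A x) x = (norm (?B x))\<^sup>2 + (Im z)\<^sup>2 * (norm x)\<^sup>2"
          unfolding power2_norm_eq_inner
          by (simp add: d_def poly_op_pCons blinfun.bilinear_simps inner_simps
              selfadjoint_inner[OF A, of "A x" x] inner_commute[of x "A x"] power2_eq_square algebra_simps)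
        then have "(Im z)\<^sup>2 * (norm x)\<^sup>2 \<le> norm (poly_op d A x) * norm x"
          using norm_cauchy_schwarz[of "poly_op d A x" x] zero_le_power2[of "norm (?B x)"] by argo
        then show ?thesis using False by (simp add: power2_eq_square[of "norm x"] mult.assoc[symmetric])
      qed simp
      ultimately show ?thesis using split[of d s "(Im z)\<^sup>2"] False by simp
    qed
  qed
qed

text \<open>A self-adjoint \<open>B\<close> has unit vectors \<open>x\<close> with \<open>(\<parallel>B\<parallel>\<^sup>2 - B\<^sup>2) x\<close> arbitrarily small.\<close>

lemma norm_square_minus_square_not_bounded_below:
  fixes B :: "'h::complex_hilbert_space \<Rightarrow>\<^sub>L 'h"
  assumes B: "selfadjoint B" and c: "0 < c"
    and bb: "\<And>x. c * norm x \<le> norm ((norm B)\<^sup>2 *\<^sub>R x - B (B x))"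
  shows "B = 0"
proof (rule ccontr)
  assume "B \<noteq> 0"
  define b where "b = norm B"
  have b: "0 < b" using \<open>B \<noteq> 0\<close> by (simp add: b_def)
  \<comment> \<open>The estimates below turn \<open>bb\<close> into a gap of c^2 / (2 b^2) between
    b^2 |x|^2 and |B x|^2 for unit \<open>x\<close>, impossible for the norm \<open>b\<close>. The
    minimum with b^2 keeps the number under the root nonnegative.\<close>
  define \<delta> where "\<delta> = min (b\<^sup>2) (c\<^sup>2 / (2 * b\<^sup>2))"
  have \<delta>: "0 < \<delta>" "\<delta> \<le> b\<^sup>2" "\<delta> \<le> c\<^sup>2 / (2 * b\<^sup>2)" using b c by (auto simp: \<delta>_def)
  have le: "(norm (B x))\<^sup>2 \<le> (b\<^sup>2 - \<delta>) * (norm x)\<^sup>2" for x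
  proof -
    have "(c * norm x)\<^sup>2 \<le> (norm (b\<^sup>2 *\<^sub>R x - B (B x)))\<^sup>2"
      using bb[of x] c by (intro power_mono) (auto simp: b_def)
    also have "\<dots> = (b\<^sup>2)\<^sup>2 * (norm x)\<^sup>2 - 2 * b\<^sup>2 * (norm (B x))\<^sup>2 + (norm (B (B x)))\<^sup>2"
      unfolding power2_norm_eq_inner
      by (simp add: inner_simps selfadjoint_inner[OF B, of "B x" x] inner_commute[of x "B (B x)"]
          power2_eq_square algebra_simps)
    also have "(norm (B (B x)))\<^sup>2 \<le> (b * norm (B x))\<^sup>2"
      by (intro power_mono) (auto simp: b_def norm_blinfun)
    also have "(b * norm (B x))\<^sup>2 \<le> b\<^sup>2 * (b * norm x)\<^sup>2"
      unfolding power_mult_distrib[of b "norm (B x)"]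
      by (intro mult_left_mono power_mono) (auto simp: b_def norm_blinfun)
    finally have 1: "c\<^sup>2 * (norm x)\<^sup>2 \<le> 2 * b\<^sup>2 * (b\<^sup>2 * (norm x)\<^sup>2 - (norm (B x))\<^sup>2)"
      by (simp add: power_mult_distrib power2_eq_square algebra_simps)
    have "\<delta> * (norm x)\<^sup>2 \<le> (c\<^sup>2 / (2 * b\<^sup>2)) * (norm x)\<^sup>2"
      using \<delta> by (intro mult_right_mono) auto
    also have "\<dots> \<le> b\<^sup>2 * (norm x)\<^sup>2 - (norm (B x))\<^sup>2"
      using 1 b by (simp add: field_simps)
    finally show ?thesis by (simp add: algebra_simps)
  qed
  have "norm B \<le> sqrt (b\<^sup>2 - \<delta>)"
  proof (rule norm_blinfun_bound)
    show "0 \<le> sqrt (b\<^sup>2 - \<delta>)" using \<delta> by simp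
    show "norm (B x) \<le> sqrt (b\<^sup>2 - \<delta>) * norm x" for x
      using real_le_rsqrt[OF le[of x]] by (simp add: real_sqrt_mult)
  qed
  then have "b\<^sup>2 \<le> b\<^sup>2 - \<delta>" using b \<delta> by (metis b_def norm_ge_zero real_sqrt_le_iff real_sqrt_abs abs_of_nonneg)
  then show False using \<delta> by simp
qed

text \<open>Replaces the spectral radius formula: if B = p(A) had norm above \<open>e\<close>, the
  polynomial |B|^2 - p^2 would have no zero on the spectrum, hence be bounded below at
  \<open>A\<close>, which forces B = 0.\<close>

lemma norm_poly_op_le:
  assumes A: "selfadjoint A" and e: "0 \<le> e"
    and p: "\<And>t. complex_of_real t \<in> spectrum A \<Longrightarrow> \<bar>poly p t\<bar> \<le> e"
  shows "norm (poly_op p A) \<le> e"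
proof (rule ccontr)
  assume "\<not> ?thesis"
  then have big: "e < norm (poly_op p A)" by simp
  have key: "B = 0" if B: "B = poly_op s A" and ne: "[:(norm B)\<^sup>2:] - s * s \<noteq> 0"
    and nz: "\<And>t. complex_of_real t \<in> spectrum A \<Longrightarrow> (poly s t)\<^sup>2 \<noteq> (norm B)\<^sup>2" for B s
  proof -
    obtain c where c: "0 < c" "\<And>x. c * norm x \<le> norm (poly_op ([:(norm B)\<^sup>2:] - s * s) A x)"
    proof -
      have "poly ([:(norm B)\<^sup>2:] - s * s) t \<noteq> 0" if "complex_of_real t \<in> spectrum A" for t
        using nz[OF that] by (auto simp: power2_eq_square)
      then show ?thesis using poly_op_bounded_below[OF A ne] that by blast
    qed
    show ?thesis
      using norm_square_minus_square_not_bounded_below[of B c] c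
      by (simp add: B poly_op_selfadjoint[OF A] poly_op_diff poly_op_mult poly_op_pCons blinfun.bilinear_simps)
  qed
  have nz: "(poly p t)\<^sup>2 \<noteq> (norm (poly_op p A))\<^sup>2" if "complex_of_real t \<in> spectrum A" for t
    using p[OF that] big by (metis abs_norm_cancel leD power2_eq_iff abs_minus_cancel)
  have "poly_op p A = 0"
  proof (cases "[:(norm (poly_op p A))\<^sup>2:] - p * p = 0")
    case False
    then show ?thesis using key nz by blast
  next
    \<comment> \<open>Here p^2 is the constant |p(A)|^2, so \<open>nz\<close> leaves no real
      spectral point. Then \<open>key\<close> applied to \<open>A\<close> itself gives A = 0, and
      invertibility of 0 leaves only the zero space.\<close>
    case True
    then have "poly (p * p) t = (norm (poly_op p A))\<^sup>2" for t
      by (metis eq_iff_diff_eq_0 poly_const_conv)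
    then have no: "complex_of_real t \<notin> spectrum A" for t using nz by (auto simp: power2_eq_square)
    have "[:(norm A)\<^sup>2:] - [:0, 1:] * [:0, 1:] \<noteq> 0" by simp
    then have "A = 0" using key[of A "[:0, 1:]"] no by (simp add: poly_op_X)
    have "invertible_op (A - scaleC_op (complex_of_real 0) id_blinfun)"
      using no[of 0] by (simp add: spectrum_def)
    then have "invertible_op (0 :: 'a \<Rightarrow>\<^sub>L 'a)"
      using \<open>A = 0\<close> unfolding scaleC_op_of_real by simp
    then have "id_blinfun = (0 :: 'a \<Rightarrow>\<^sub>L 'a)" by (auto simp: invertible_op_def)
    then show ?thesis by (metis blinfun_compose_id(1) blinfun_compose.zero_left)
  qed
  then show False using big e by simp
qed


section \<open>Continuous functional calculus\<close>

lemma polynomial_approximation: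
  assumes "continuous_on {a..b} (f :: real \<Rightarrow> real)"
  shows "\<exists>p :: nat \<Rightarrow> real poly. uniform_limit {a..b} (\<lambda>n. poly (p n)) f sequentially"
proof -
  have "\<exists>p :: real poly. \<forall>x\<in>{a..b}. \<bar>f x - poly p x\<bar> < e" if e: "0 < e" for e
  proof -
    obtain g where g: "real_polynomial_function g" "\<And>x. x \<in> {a..b} \<Longrightarrow> \<bar>f x - g x\<bar> < e"
      using Stone_Weierstrass_real_polynomial_function[OF compact_Icc assms e] by blast
    obtain c n where "g = (\<lambda>x. \<Sum>i\<le>n. c i * x ^ i)"
      using g(1) real_polynomial_function_iff_sum by blast
    then have "g x = poly (\<Sum>i\<le>n. monom (c i) i) x" for x by (simp add: poly_sum poly_monom)
    then show ?thesis using g(2) by metis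
  qed
  then have "\<forall>n. \<exists>p :: real poly. \<forall>x\<in>{a..b}. \<bar>f x - poly p x\<bar> < 1 / (real n + 1)" by simp
  then obtain p :: "nat \<Rightarrow> real poly" where p: "\<And>n x. x \<in> {a..b} \<Longrightarrow> \<bar>f x - poly (p n) x\<bar> < 1 / (real n + 1)"
    by metis
  have "uniform_limit {a..b} (\<lambda>n. poly (p n)) f sequentially"
  proof (rule uniform_limitI)
    fix e :: real assume e: "0 < e"
    have "(\<lambda>n. 1 / (real n + 1)) \<longlonglongrightarrow> 0" by real_asymp
    then have "\<forall>\<^sub>F n in sequentially. 1 / (real n + 1) < e" using e by (rule order_tendstoD)
    then show "\<forall>\<^sub>F n in sequentially. \<forall>x\<in>{a..b}. dist (poly (p n) x) (f x) < e"
    proof eventually_elim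
      case (elim n)
      then show ?case using less_trans[OF p elim] by (simp add: dist_real_def abs_minus_commute)
    qed
  qed
  then show ?thesis by blast
qed

lemma real_spectrum_between:
  assumes "op_between a b A" "complex_of_real t \<in> spectrum A"
  shows "t \<in> {a..b}"
  using spectrum_between[OF assms(1)] assms(2) by auto

lemma norm_poly_op_le_between:
  assumes "op_between a b A" "0 \<le> e" "\<And>t. t \<in> {a..b} \<Longrightarrow> \<bar>poly p t\<bar> \<le> e"
  shows "norm (poly_op p A) \<le> e"
  using assms real_spectrum_between[OF assms(1)]
  by (intro norm_poly_op_le) (auto simp: op_between_selfadjoint)

lemma poly_op_diff_tendsto_0:
  assumes A: "selfadjoint A"
    and p: "uniform_limit {t. complex_of_real t \<in> spectrum A} (\<lambda>n. poly (p n)) f sequentially"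
    and q: "uniform_limit {t. complex_of_real t \<in> spectrum A} (\<lambda>n. poly (q n)) f sequentially"
  shows "(\<lambda>n::nat. poly_op (q n) A - poly_op (p n) A) \<longlonglongrightarrow> 0"
proof (rule metric_LIMSEQ_I)
  fix r :: real assume r: "0 < r"
  have "\<forall>\<^sub>F n in sequentially. \<forall>x\<in>{t. complex_of_real t \<in> spectrum A}. dist (poly (p n) x) (f x) < r / 4"
    "\<forall>\<^sub>F n in sequentially. \<forall>x\<in>{t. complex_of_real t \<in> spectrum A}. dist (poly (q n) x) (f x) < r / 4"
    using p q r by (auto dest!: uniform_limitD[where e = "r / 4"])
  then have "\<forall>\<^sub>F n in sequentially. dist (poly_op (q n) A - poly_op (p n) A) 0 < r"
  proof eventually_elim
    case (elim n)
    have "norm (poly_op (q n - p n) A) \<le> r / 2"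
    proof (rule norm_poly_op_le[OF A])
      fix t assume "complex_of_real t \<in> spectrum A"
      then have "\<bar>poly (p n) t - f t\<bar> < r / 4" "\<bar>poly (q n) t - f t\<bar> < r / 4"
        using elim by (auto simp: dist_real_def)
      then show "\<bar>poly (q n - p n) t\<bar> \<le> r / 2" unfolding poly_diff by linarith
    qed (use r in simp)
    then show ?case using r by (simp add: poly_op_diff)
  qed
  then show "\<exists>no. \<forall>n\<ge>no. dist (poly_op (q n) A - poly_op (p n) A) 0 < r"
    by (simp add: eventually_sequentially)
qed

text \<open>Makes the definite description in \<open>cfc\<close> usable: a sequence that converges
  on an interval containing the spectrum yields the limit, and any other sequence converging on the
  spectrum differs from it by operators tending to 0. Later results on \<open>cfc\<close> start from
  such intervals.\<close>

lemma cfc_tendsto: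
  assumes A: "op_between a b A" and p: "uniform_limit {a..b} (\<lambda>n. poly (p n)) f sequentially"
  shows "(\<lambda>n. poly_op (p n) A) \<longlonglongrightarrow> cfc f A"
proof -
  let ?\<sigma> = "{t. complex_of_real t \<in> spectrum A}"
  have sa: "selfadjoint A" using A by (rule op_between_selfadjoint)
  have p\<sigma>: "uniform_limit ?\<sigma> (\<lambda>n. poly (p n)) f sequentially"
    by (rule uniform_limit_on_subset[OF p]) (use real_spectrum_between[OF A] in auto)
  have "Cauchy (\<lambda>n. poly_op (p n) A)"
  proof (rule CauchyI)
    fix r :: real assume r: "0 < r"
    then obtain N where N: "\<And>n x. n \<ge> N \<Longrightarrow> x \<in> ?\<sigma> \<Longrightarrow> \<bar>poly (p n) x - f x\<bar> < r / 4"
      using uniform_limitD[OF p\<sigma>, of "r / 4"] by (auto simp: eventually_sequentially dist_real_def)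
    have "norm (poly_op (p m) A - poly_op (p n) A) < r" if mn: "m \<ge> N" "n \<ge> N" for m n
    proof -
      have "norm (poly_op (p m - p n) A) \<le> r / 2"
      proof (rule norm_poly_op_le[OF sa])
        fix t assume "complex_of_real t \<in> spectrum A"
        then have "\<bar>poly (p m) t - f t\<bar> < r / 4" "\<bar>poly (p n) t - f t\<bar> < r / 4"
          using N[OF mn(1)] N[OF mn(2)] by auto
        then show "\<bar>poly (p m - p n) t\<bar> \<le> r / 2" unfolding poly_diff by linarith
      qed (use r in simp)
      then show ?thesis using r by (simp add: poly_op_diff)
    qed
    then show "\<exists>M. \<forall>m\<ge>M. \<forall>n\<ge>M. norm (poly_op (p m) A - poly_op (p n) A) < r" by blast
  qed
  then obtain T where T: "(\<lambda>n. poly_op (p n) A) \<longlonglongrightarrow> T"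
    by (auto simp: Cauchy_convergent_iff convergent_def)
  have "cfc f A = T"
    unfolding cfc_def
  proof (rule the_equality)
    show "\<forall>q. uniform_limit ?\<sigma> (\<lambda>n. poly (q n)) f sequentially \<longrightarrow> (\<lambda>n. poly_op (q n) A) \<longlonglongrightarrow> T"
    proof (intro allI impI)
      fix q :: "nat \<Rightarrow> real poly" assume q: "uniform_limit ?\<sigma> (\<lambda>n. poly (q n)) f sequentially"
      show "(\<lambda>n. poly_op (q n) A) \<longlonglongrightarrow> T"
        using tendsto_add[OF poly_op_diff_tendsto_0[OF sa p\<sigma> q] T] by simp
    qed
    fix S assume "\<forall>q. uniform_limit ?\<sigma> (\<lambda>n. poly (q n)) f sequentially \<longrightarrow> (\<lambda>n. poly_op (q n) A) \<longlonglongrightarrow> S"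
    then show "S = T" using LIMSEQ_unique[OF _ T] p\<sigma> by blast
  qed
  then show ?thesis using T by simp
qed

lemma cfc_approximation:
  assumes "op_between a b A" "continuous_on {a..b} f"
  obtains p where "uniform_limit {a..b} (\<lambda>n. poly (p n)) f sequentially"
    "(\<lambda>n. poly_op (p n) A) \<longlonglongrightarrow> cfc f A"
  using polynomial_approximation[OF assms(2)] cfc_tendsto[OF assms(1)] by blast

lemma cfc_poly:
  assumes "op_between a b A"
  shows "cfc (poly p) A = poly_op p A"
  using cfc_tendsto[OF assms, of "\<lambda>_. p" "poly p"] LIMSEQ_unique[OF _ tendsto_const]
  by (metis uniform_limit_const)

lemma cfc_cong:
  assumes A: "op_between a b A" and f: "continuous_on {a..b} f"
    and eq: "\<And>t. t \<in> {a..b} \<Longrightarrow> f t = g t"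
  shows "cfc f A = cfc g A"
proof -
  obtain p where p: "uniform_limit {a..b} (\<lambda>n. poly (p n)) f sequentially"
    "(\<lambda>n. poly_op (p n) A) \<longlonglongrightarrow> cfc f A"
    using cfc_approximation[OF A f] .
  have "uniform_limit {a..b} (\<lambda>n. poly (p n)) g sequentially"
    using p(1) by (rule uniform_limit_cong'[THEN iffD1, rotated 2]) (auto simp: eq)
  then show ?thesis using LIMSEQ_unique[OF p(2) cfc_tendsto[OF A]] by blast
qed

lemma cfc_selfadjoint:
  assumes "op_between a b A" "continuous_on {a..b} f"
  shows "selfadjoint (cfc f A)"
  by (rule cfc_approximation[OF assms])
    (rule selfadjoint_limit, assumption, rule poly_op_selfadjoint, rule op_between_selfadjoint[OF assms(1)])

lemma cfc_bop:
  assumes "op_between a b A" "continuous_on {a..b} f"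
  shows "cfc f A \<in> bop"
  by (rule selfadjoint_bop) (rule cfc_selfadjoint[OF assms])

lemma cfc_add:
  assumes A: "op_between a b A" and f: "continuous_on {a..b} f" and g: "continuous_on {a..b} g"
  shows "cfc (\<lambda>t. f t + g t) A = cfc f A + cfc g A"
proof -
  obtain p where p: "uniform_limit {a..b} (\<lambda>n. poly (p n)) f sequentially"
    "(\<lambda>n. poly_op (p n) A) \<longlonglongrightarrow> cfc f A" using cfc_approximation[OF A f] .
  obtain q where q: "uniform_limit {a..b} (\<lambda>n. poly (q n)) g sequentially"
    "(\<lambda>n. poly_op (q n) A) \<longlonglongrightarrow> cfc g A" using cfc_approximation[OF A g] .
  have "uniform_limit {a..b} (\<lambda>n. poly (p n + q n)) (\<lambda>t. f t + g t) sequentially"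
    unfolding poly_add by (rule uniform_limit_add[OF p(1) q(1)])
  from cfc_tendsto[OF A this] have "(\<lambda>n. poly_op (p n) A + poly_op (q n) A) \<longlonglongrightarrow> cfc (\<lambda>t. f t + g t) A"
    by (simp add: poly_op_add)
  then show ?thesis using tendsto_add[OF p(2) q(2)] LIMSEQ_unique by blast
qed

lemma cfc_mult:
  assumes A: "op_between a b A" and f: "continuous_on {a..b} f" and g: "continuous_on {a..b} g"
  shows "cfc (\<lambda>t. f t * g t) A = cfc f A o\<^sub>L cfc g A"
proof -
  obtain p where p: "uniform_limit {a..b} (\<lambda>n. poly (p n)) f sequentially"
    "(\<lambda>n. poly_op (p n) A) \<longlonglongrightarrow> cfc f A" using cfc_approximation[OF A f] .
  obtain q where q: "uniform_limit {a..b} (\<lambda>n. poly (q n)) g sequentially"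
    "(\<lambda>n. poly_op (q n) A) \<longlonglongrightarrow> cfc g A" using cfc_approximation[OF A g] .
  have "bounded (f ` {a..b})" "bounded (g ` {a..b})"
    using f g by (auto intro!: compact_imp_bounded compact_continuous_image)
  then have "uniform_limit {a..b} (\<lambda>n. poly (p n * q n)) (\<lambda>t. f t * g t) sequentially"
    unfolding poly_mult by (rule uniform_lim_mult[OF p(1) q(1)])
  from cfc_tendsto[OF A this]
  have "(\<lambda>n. poly_op (p n) A o\<^sub>L poly_op (q n) A) \<longlonglongrightarrow> cfc (\<lambda>t. f t * g t) A"
    by (simp add: poly_op_mult)
  then show ?thesis using blinfun_compose.tendsto[OF p(2) q(2)] LIMSEQ_unique by blast
qed

lemma cfc_const:
  assumes "op_between a b A"
  shows "cfc (\<lambda>t. c) A = c *\<^sub>R id_blinfun"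
proof -
  have "poly [:c:] = (\<lambda>t. c)" by auto
  then show ?thesis using cfc_poly[OF assms, of "[:c:]"] by (simp add: poly_op_pCons)
qed

lemma cfc_id:
  assumes "op_between a b A"
  shows "cfc (\<lambda>t. t) A = A"
proof -
  have "poly [:0, 1:] = (\<lambda>t::real. t)" by (auto simp: fun_eq_iff)
  then show ?thesis using cfc_poly[OF assms, of "[:0, 1:]"] by (simp add: poly_op_X)
qed

lemma cfc_scale:
  assumes A: "op_between a b A" and f: "continuous_on {a..b} f"
  shows "cfc (\<lambda>t. c * f t) A = c *\<^sub>R cfc f A"
  using cfc_mult[OF A continuous_on_const f, of c]
  by (simp add: cfc_const[OF A] blinfun_compose.scaleR_left)

lemma cfc_minus:
  assumes "op_between a b A" "continuous_on {a..b} f"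
  shows "cfc (\<lambda>t. - f t) A = - cfc f A"
  using cfc_scale[OF assms, of "- 1"] by simp

lemma cfc_sum:
  assumes A: "op_between a b A" and f: "\<And>i. i \<in> I \<Longrightarrow> continuous_on {a..b} (f i)"
  shows "cfc (\<lambda>t. \<Sum>i\<in>I. c i * f i t) A = (\<Sum>i\<in>I. c i *\<^sub>R cfc (f i) A)"
  using f
proof (induction I rule: infinite_finite_induct)
  case (insert i I)
  then show ?case
    using cfc_add[OF A, of "\<lambda>t. c i * f i t" "\<lambda>t. \<Sum>i\<in>I. c i * f i t"] cfc_scale[OF A, of "f i" "c i"]
    by (simp add: continuous_intros)
qed (simp_all add: cfc_const[OF A])

lemma cfc_commute:
  assumes "op_between a b A" "continuous_on {a..b} f" "continuous_on {a..b} g"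
  shows "cfc f A o\<^sub>L cfc g A = cfc g A o\<^sub>L cfc f A"
  using cfc_mult[OF assms(1,2,3)] cfc_mult[OF assms(1,3,2)] by (simp add: mult.commute)

lemma cfc_nonneg:
  assumes A: "op_between a b A" and f: "continuous_on {a..b} f"
    and "\<And>t. t \<in> {a..b} \<Longrightarrow> 0 \<le> f t"
  shows "0 \<le> inner (cfc f A x) x"
proof -
  have s: "continuous_on {a..b} (\<lambda>t. sqrt (f t))" by (intro continuous_intros f)
  have "cfc f A = cfc (\<lambda>t. sqrt (f t) * sqrt (f t)) A"
    by (rule cfc_cong[OF A f]) (simp add: assms)
  also have "\<dots> = cfc (\<lambda>t. sqrt (f t)) A o\<^sub>L cfc (\<lambda>t. sqrt (f t)) A"
    by (rule cfc_mult[OF A s s])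
  finally have "inner (cfc f A x) x = inner (cfc (\<lambda>t. sqrt (f t)) A x) (cfc (\<lambda>t. sqrt (f t)) A x)"
    by (simp add: selfadjoint_inner[OF cfc_selfadjoint[OF A s], of _ x])
  then show ?thesis by simp
qed

lemma cfc_mono_inner:
  assumes A: "op_between a b A" and f: "continuous_on {a..b} f" and g: "continuous_on {a..b} g"
    and le: "\<And>t. t \<in> {a..b} \<Longrightarrow> f t \<le> g t"
  shows "inner (cfc f A x) x \<le> inner (cfc g A x) x"
proof -
  have "0 \<le> inner (cfc (\<lambda>t. g t + (- 1) * f t) A x) x"
    by (rule cfc_nonneg[OF A]) (use le in \<open>auto intro!: continuous_intros f g\<close>)
  then show ?thesis
    using cfc_add[OF A g, of "\<lambda>t. (- 1) * f t"] cfc_scale[OF A f, of "- 1"]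
    by (simp add: continuous_intros f blinfun.bilinear_simps inner_simps)
qed

lemma cfc_mono:
  assumes A: "op_between a b A" and f: "continuous_on {a..b} f" and g: "continuous_on {a..b} g"
    and le: "\<And>t. t \<in> {a..b} \<Longrightarrow> f t \<le> g t"
  shows "cfc f A \<le>\<^sub>L cfc g A"
  by (intro loewner_leI cfc_selfadjoint[OF A] f g cfc_mono_inner[OF A f g le])

lemma cfc_positive_op:
  assumes "op_between a b A" "continuous_on {a..b} f" "\<And>t. t \<in> {a..b} \<Longrightarrow> 0 \<le> f t"
  shows "positive_op (cfc f A)"
  using cfc_nonneg[OF assms] cfc_selfadjoint[OF assms(1,2)] by (simp add: positive_op_iff)

lemma cfc_between:
  assumes A: "op_between a b A" and f: "continuous_on {a..b} f"
    and cd: "\<And>t. t \<in> {a..b} \<Longrightarrow> c \<le> f t \<and> f t \<le> d"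
  shows "op_between c d (cfc f A)"
  unfolding op_between_def
proof (intro conjI allI)
  show "selfadjoint (cfc f A)" by (rule cfc_selfadjoint[OF A f])
  fix x
  show "c * (norm x)\<^sup>2 \<le> inner (cfc f A x) x" "inner (cfc f A x) x \<le> d * (norm x)\<^sup>2"
    using cfc_mono_inner[OF A continuous_on_const f, of c x] cd
      cfc_mono_inner[OF A f continuous_on_const, of d x]
    by (auto simp: cfc_const[OF A] blinfun.scaleR_left power2_norm_eq_inner)
qed

text \<open>The numerical radius of a self-adjoint operator is its norm; here this is the norm bound
  for polynomials, applied to the polynomial X.\<close>

lemma op_between_norm_le:
  assumes "op_between (- e) e A" "0 \<le> e"
  shows "norm A \<le> e"
  using norm_poly_op_le_between[OF assms, of "[:0, 1:]"] by (simp add: poly_op_X abs_le_iff)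

lemma norm_cfc_le:
  assumes A: "op_between a b A" and f: "continuous_on {a..b} f" and e: "0 \<le> e"
    and le: "\<And>t. t \<in> {a..b} \<Longrightarrow> \<bar>f t\<bar> \<le> e"
  shows "norm (cfc f A) \<le> e"
  by (rule op_between_norm_le[OF cfc_between[OF A f] e]) (use le in \<open>auto simp: abs_le_iff minus_le_iff\<close>)

lemma norm_cfc_diff_le:
  assumes A: "op_between a b A" and f: "continuous_on {a..b} f" and g: "continuous_on {a..b} g"
    and e: "0 \<le> e" and le: "\<And>t. t \<in> {a..b} \<Longrightarrow> \<bar>f t - g t\<bar> \<le> e"
  shows "norm (cfc f A - cfc g A) \<le> e"
proof -
  have "cfc f A - cfc g A = cfc (\<lambda>t. f t + (- 1) * g t) A"
    using cfc_add[OF A f, of "\<lambda>t. (- 1) * g t"] cfc_scale[OF A g, of "- 1"]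
    by (simp add: continuous_intros g)
  then show ?thesis
    using norm_cfc_le[OF A, of "\<lambda>t. f t + (- 1) * g t" e] e le by (simp add: continuous_intros f g)
qed

lemma poly_op_cfc:
  assumes A: "op_between a b A" and f: "continuous_on {a..b} f"
  shows "poly_op q (cfc f A) = cfc (\<lambda>t. poly q (f t)) A"
proof (induction q)
  case 0
  then show ?case using cfc_const[OF A, of 0] by simp
next
  case (pCons c q)
  have q: "continuous_on {a..b} (\<lambda>t. poly q (f t))" by (intro continuous_intros f)
  show ?case
    using cfc_add[OF A continuous_on_const continuous_on_mult[OF f q], of c] cfc_mult[OF A f q]
    by (simp add: poly_op_pCons pCons cfc_const[OF A])
qed

text \<open>If polynomials q_n tend to \<open>g\<close>, then q_n(f(A)), being the function q_n o f
  of \<open>A\<close>, tends to both sides.\<close>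

lemma cfc_compose:
  assumes A: "op_between a b A" and f: "continuous_on {a..b} f"
    and cd: "\<And>t. t \<in> {a..b} \<Longrightarrow> c \<le> f t \<and> f t \<le> d"
    and g: "continuous_on {c..d} g"
  shows "cfc g (cfc f A) = cfc (\<lambda>t. g (f t)) A"
proof -
  have fA: "op_between c d (cfc f A)" by (rule cfc_between[OF A f cd])
  obtain q where q: "uniform_limit {c..d} (\<lambda>n. poly (q n)) g sequentially"
    "(\<lambda>n. poly_op (q n) (cfc f A)) \<longlonglongrightarrow> cfc g (cfc f A)" using cfc_approximation[OF fA g] .
  have gf: "continuous_on {a..b} (\<lambda>t. g (f t))"
    by (rule continuous_on_compose2[OF g f]) (use cd in auto)
  have "(\<lambda>n. poly_op (q n) (cfc f A)) \<longlonglongrightarrow> cfc (\<lambda>t. g (f t)) A"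
  proof (rule metric_LIMSEQ_I)
    fix r :: real assume r: "0 < r"
    then have "\<forall>\<^sub>F n in sequentially. \<forall>x\<in>{c..d}. dist (poly (q n) x) (g x) < r / 2"
      by (intro uniform_limitD[OF q(1)]) simp
    then have "\<forall>\<^sub>F n in sequentially. dist (poly_op (q n) (cfc f A)) (cfc (\<lambda>t. g (f t)) A) < r"
    proof eventually_elim
      case (elim n)
      have "norm (cfc (\<lambda>t. poly (q n) (f t)) A - cfc (\<lambda>t. g (f t)) A) \<le> r / 2"
        by (rule norm_cfc_diff_le[OF A])
          (use r elim cd in \<open>auto intro!: continuous_intros f gf less_imp_le simp: dist_real_def\<close>)
      then show ?case using r by (simp add: poly_op_cfc[OF A f] dist_norm)
    qed
    then show "\<exists>no. \<forall>n\<ge>no. dist (poly_op (q n) (cfc f A)) (cfc (\<lambda>t. g (f t)) A) < r"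
      by (simp add: eventually_sequentially)
  qed
  then show ?thesis using q(2) LIMSEQ_unique by blast
qed

lemma norm_isometry:
  assumes "U \<in> bop" "adj U o\<^sub>L U = id_blinfun"
  shows "norm (blinfun_apply U x) = norm x"
proof -
  have "inner (U x) (U x) = inner ((adj U o\<^sub>L U) x) x"
    by (simp add: Re_cinner[symmetric] cinner_adj_left assms(1))
  then show ?thesis by (simp add: assms(2) norm_eq_sqrt_inner)
qed

lemma op_between_isometry:
  assumes A: "op_between a b A" and U: "U \<in> bop" "adj U o\<^sub>L U = id_blinfun"
  shows "op_between a b (adj U o\<^sub>L A o\<^sub>L U)"
  using A selfadjoint_congruence[OF _ U(1)] norm_isometry[OF U]
  by (simp add: op_between_def inner_congruence[OF U(1)] del: blinfun_apply_blinfun_compose) metis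

lemma cfc_unitary:
  assumes A: "op_between a b A" and f: "continuous_on {a..b} f"
    and U: "U \<in> bop" "adj U o\<^sub>L U = id_blinfun" "U o\<^sub>L adj U = id_blinfun"
  shows "cfc f (adj U o\<^sub>L A o\<^sub>L U) = adj U o\<^sub>L cfc f A o\<^sub>L U"
proof -
  have id: "U (adj U x) = x" "adj U (U x) = x" for x
    using U by (metis blinfun_apply_blinfun_compose blinfun_apply_id_blinfun)+
  have poly: "poly_op p (adj U o\<^sub>L A o\<^sub>L U) = adj U o\<^sub>L poly_op p A o\<^sub>L U" for p
  proof (induction p)
    case (pCons c p)
    show ?case by (rule blinfun_eqI) (simp add: poly_op_pCons pCons blinfun.bilinear_simps id)
  qed simp
  obtain p where p: "uniform_limit {a..b} (\<lambda>n. poly (p n)) f sequentially"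
    "(\<lambda>n. poly_op (p n) A) \<longlonglongrightarrow> cfc f A" using cfc_approximation[OF A f] .
  have "(\<lambda>n. poly_op (p n) (adj U o\<^sub>L A o\<^sub>L U)) \<longlonglongrightarrow> (adj U o\<^sub>L cfc f A o\<^sub>L U)"
    unfolding poly by (intro blinfun_compose.tendsto p(2) tendsto_const)
  then show ?thesis
    using cfc_tendsto[OF op_between_isometry[OF A U(1,2)] p(1)] LIMSEQ_unique by blast
qed


section \<open>Unital positive maps and Jensen's inequality\<close>

text \<open>The factor 2 leaves room for two approximation errors \<open>e\<close>, one on each side
  of the inequality.\<close>

lemma le_of_le_add_eps:
  fixes a b :: real
  assumes "\<And>e. 0 < e \<Longrightarrow> a \<le> b + 2 * e * (norm x)\<^sup>2"
  shows "a \<le> b"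
proof (rule field_le_epsilon)
  fix d :: real assume d: "0 < d"
  have n: "0 < 2 * ((norm x)\<^sup>2 + 1)" by (simp add: add_nonneg_pos)
  have "2 * (d / (2 * ((norm x)\<^sup>2 + 1))) * (norm x)\<^sup>2 \<le> d"
    using d n by (simp add: pos_divide_le_eq)
  then show "a \<le> b + d" using assms[of "d / (2 * ((norm x)\<^sup>2 + 1))"] d n by simp
qed

lemma linear_map_bopD:
  assumes "linear_map_bop \<Phi>"
  shows "T \<in> bop \<Longrightarrow> \<Phi> T \<in> bop"
    and "S \<in> bop \<Longrightarrow> T \<in> bop \<Longrightarrow> \<Phi> (S + T) = \<Phi> S + \<Phi> T"
    and "T \<in> bop \<Longrightarrow> \<Phi> (c *\<^sub>R T) = c *\<^sub>R \<Phi> T"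
  using assms by (auto simp: linear_map_bop_def scaleC_op_of_real[symmetric])

lemma linear_map_bop_diff:
  assumes \<Phi>: "linear_map_bop \<Phi>" and "S \<in> bop" "T \<in> bop"
  shows "\<Phi> (S - T) = \<Phi> S - \<Phi> T"
  using linear_map_bopD(2)[OF \<Phi> assms(2) bop_scaleR[OF assms(3), of "- 1"]]
    linear_map_bopD(3)[OF \<Phi> assms(3), of "- 1"] by simp

lemma linear_map_bop_sum:
  assumes \<Phi>: "linear_map_bop \<Phi>" and T: "\<And>i. i \<in> I \<Longrightarrow> T i \<in> bop"
  shows "\<Phi> (\<Sum>i\<in>I. c i *\<^sub>R T i) = (\<Sum>i\<in>I. c i *\<^sub>R \<Phi> (T i))"
proof -
  have zero: "\<Phi> 0 = 0" using linear_map_bopD(3)[OF \<Phi> bop_zero, of 0] by simp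
  show ?thesis
    using T
  proof (induction I rule: infinite_finite_induct)
    case (insert i I)
    then show ?case
      using linear_map_bopD(2)[OF \<Phi>, of "c i *\<^sub>R T i" "\<Sum>i\<in>I. c i *\<^sub>R T i"] linear_map_bopD(3)[OF \<Phi>]
      by (simp add: bop_scaleR bop_sum)
  qed (simp_all add: zero)
qed

lemma positive_map_mono:
  assumes "linear_map_bop \<Phi>" "positive_map \<Phi>" "S \<le>\<^sub>L T" "S \<in> bop" "T \<in> bop"
  shows "\<Phi> S \<le>\<^sub>L \<Phi> T"
  using assms by (simp add: loewner_le_def positive_map_def linear_map_bop_diff[symmetric])

text \<open>Positivity of the map speaks of positive operators only, so \<open>T\<close> is shifted
  by its norm; linearity and unitality remove the shift afterwards.\<close>

lemma positive_map_selfadjoint: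
  assumes \<Phi>: "linear_map_bop \<Phi>" "positive_map \<Phi>" "unital_map \<Phi>" and T: "selfadjoint T"
  shows "selfadjoint (\<Phi> T)"
proof -
  let ?N = "norm T *\<^sub>R id_blinfun :: 'a \<Rightarrow>\<^sub>L 'a"
  have sa: "selfadjoint (T + ?N)" by (intro selfadjoint_add selfadjoint_scaleR selfadjoint_id T)
  have "0 \<le> inner ((T + ?N) x) x" for x
    using inner_le_norm_op[of T x]
    by (simp add: blinfun.bilinear_simps inner_simps power2_norm_eq_inner abs_le_iff)
  then have "selfadjoint (\<Phi> (T + ?N))"
    using \<Phi>(2) sa by (simp add: positive_map_def positive_op_iff)
  moreover have "\<Phi> (T + ?N) = \<Phi> T + norm T *\<^sub>R id_blinfun"
    using linear_map_bopD[OF \<Phi>(1)] \<Phi>(3)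
    by (simp add: selfadjoint_bop[OF T] bop_intros unital_map_def)
  ultimately have "selfadjoint ((\<Phi> T + norm T *\<^sub>R id_blinfun) - norm T *\<^sub>R id_blinfun)"
    by (intro selfadjoint_diff selfadjoint_scaleR selfadjoint_id) simp
  then show ?thesis by simp
qed

lemma op_between_loewner:
  "op_between a b A \<longleftrightarrow> selfadjoint A \<and> a *\<^sub>R id_blinfun \<le>\<^sub>L A \<and> A \<le>\<^sub>L b *\<^sub>R id_blinfun"
proof
  assume "op_between a b A"
  then show "selfadjoint A \<and> a *\<^sub>R id_blinfun \<le>\<^sub>L A \<and> A \<le>\<^sub>L b *\<^sub>R id_blinfun"
    unfolding op_between_def
    by (auto intro!: loewner_leI selfadjoint_scaleR selfadjoint_id simp: blinfun.scaleR_left power2_norm_eq_inner)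
next
  assume "selfadjoint A \<and> a *\<^sub>R id_blinfun \<le>\<^sub>L A \<and> A \<le>\<^sub>L b *\<^sub>R id_blinfun"
  then show "op_between a b A"
    unfolding op_between_def
    by (auto dest!: loewner_leD simp: blinfun.scaleR_left power2_norm_eq_inner)
qed

lemma positive_map_between:
  assumes \<Phi>: "linear_map_bop \<Phi>" "positive_map \<Phi>" "unital_map \<Phi>" and T: "op_between a b T"
  shows "op_between a b (\<Phi> T)"
proof -
  have T': "T \<in> bop" using T by (auto intro: selfadjoint_bop op_between_selfadjoint)
  have sc: "\<Phi> (c *\<^sub>R id_blinfun) = c *\<^sub>R id_blinfun" for c
    using linear_map_bopD(3)[OF \<Phi>(1) bop_id, of c] \<Phi>(3) by (simp add: unital_map_def)
  show ?thesis
    using T positive_map_selfadjoint[OF \<Phi>] positive_map_mono[OF \<Phi>(1,2), of "a *\<^sub>R id_blinfun" T]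
      positive_map_mono[OF \<Phi>(1,2), of T "b *\<^sub>R id_blinfun"]
    by (simp add: op_between_loewner sc bop_intros T')
qed

text \<open>
  Jensen's inequality for the unital positive maps \<open>\<complex>\<^bsup>n\<^esup> \<rightarrow> B(K)\<close>, which are given by \<open>n\<close> positive operators
  with sum \<open>1\<close>. Bernstein polynomials reduce the general case to this one.
\<close>

definition discrete_jensen :: "'k::complex_hilbert_space itself \<Rightarrow> (real \<Rightarrow> real) \<Rightarrow> bool" where
  "discrete_jensen _ f \<longleftrightarrow>
    (\<forall>n (C :: nat \<Rightarrow> 'k \<Rightarrow>\<^sub>L 'k) t x.
      (\<forall>i<n. positive_op (C i) \<and> 0 < t i) \<longrightarrow> (\<Sum>i<n. C i) = id_blinfun \<longrightarrow>
      inner (cfc f (\<Sum>i<n. t i *\<^sub>R C i) x) x \<le> (\<Sum>i<n. f (t i) * inner (C i x) x))"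

lemma discrete_jensenD:
  fixes n :: nat
  assumes "discrete_jensen TYPE('k::complex_hilbert_space) f"
    and "\<And>i. i < n \<Longrightarrow> positive_op (C i)" "\<And>i. i < n \<Longrightarrow> 0 < t i"
    and "(\<Sum>i<n. C i) = (id_blinfun :: 'k \<Rightarrow>\<^sub>L 'k)"
  shows "inner (cfc f (\<Sum>i<n. t i *\<^sub>R C i) x) x \<le> (\<Sum>i<n. f (t i) * inner (C i x) x)"
  using assms(1)[unfolded discrete_jensen_def, rule_format, of n C t x] assms(2-4) by simp

text \<open>Bernstein polynomials of \<open>A\<close> are positive operators with sum 1, and
  \<open>\<Phi>\<close> keeps both properties. As Bernstein polynomials reproduce affine functions,
  \<open>\<Phi> A\<close> is exactly the average of the nodes \<open>t k\<close> with weights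
  \<open>C k\<close>; only \<open>f\<close> is approximated.\<close>

theorem Jensen_positive_map:
  fixes \<Phi> :: "('h::complex_hilbert_space \<Rightarrow>\<^sub>L 'h) \<Rightarrow> ('k::complex_hilbert_space \<Rightarrow>\<^sub>L 'k)"
  assumes \<Phi>: "linear_map_bop \<Phi>" "positive_map \<Phi>" "unital_map \<Phi>"
    and dj: "discrete_jensen TYPE('k) f" and cont: "continuous_on {0<..} f"
    and A: "op_between m M A" and m: "0 < m"
  shows "cfc f (\<Phi> A) \<le>\<^sub>L \<Phi> (cfc f A)"
proof -
  \<comment> \<open>A nondegenerate interval, so that it can be rescaled to [0, 1] by a
    division.\<close>
  define M' where "M' = max M (m + 1)"
  have mM: "m < M'" by (simp add: M'_def)
  have A: "op_between m M' A" by (rule op_between_mono[OF A]) (auto simp: M'_def)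
  have f: "continuous_on {m..M'} f" by (rule continuous_on_subset[OF cont]) (use m in auto)
  have fA: "selfadjoint (cfc f A)" by (rule cfc_selfadjoint[OF A f])
  have \<Phi>A: "op_between m M' (\<Phi> A)" by (rule positive_map_between[OF \<Phi> A])
  have approx: "inner (cfc f (\<Phi> A) x) x \<le> inner (\<Phi> (cfc f A) x) x + 2 * e * (norm x)\<^sup>2" if e: "0 < e" for e x
  proof -
    let ?s = "\<lambda>t. (t - m) / (M' - m)"
    let ?F = "\<lambda>s. f (m + (M' - m) * s)"
    have "continuous_on {0..1} ?F"
    proof (rule continuous_on_compose2[OF f])
      have "(M' - m) * s \<in> {0..M' - m}" if "s \<in> {0..1}" for s
        using that mM mult_left_le[of s "M' - m"] by auto
      then show "(\<lambda>s. m + (M' - m) * s) ` {0..1} \<subseteq> {m..M'}" by fastforce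
    qed (intro continuous_intros)
    then obtain N where N: "\<And>n s. N \<le> n \<Longrightarrow> s \<in> {0..1} \<Longrightarrow>
        \<bar>?F s - (\<Sum>k\<le>n. ?F (real k / real n) * Bernstein n k s)\<bar> < e"
      using Bernstein_Weierstrass[of ?F e] e by blast
    \<comment> \<open>The successor keeps the denominator of the nodes nonzero.\<close>
    define n where "n = Suc N"
    define \<beta> where "\<beta> k t = Bernstein n k (?s t)" for k t
    define t where "t k = m + (M' - m) * (real k / real n)" for k
    define C where "C k = \<Phi> (cfc (\<beta> k) A)" for k
    have \<beta>_cont: "continuous_on {m..M'} (\<beta> k)" for k
      unfolding \<beta>_def Bernstein_def by (intro continuous_intros) (use mM in auto)
    have \<beta>_nonneg: "0 \<le> \<beta> k t" if "t \<in> {m..M'}" for k t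
      unfolding \<beta>_def using that mM by (intro Bernstein_nonneg) auto
    have \<beta>_bop: "cfc (\<beta> k) A \<in> bop" for k by (rule cfc_bop[OF A \<beta>_cont])
    have comb: "\<Phi> (cfc (\<lambda>s. \<Sum>k\<le>n. c k * \<beta> k s) A) = (\<Sum>k\<le>n. c k *\<^sub>R C k)" for c
      unfolding C_def
      using cfc_sum[OF A, of "{..n}" \<beta> c] linear_map_bop_sum[OF \<Phi>(1), of "{..n}" "\<lambda>k. cfc (\<beta> k) A" c]
      by (simp add: \<beta>_cont \<beta>_bop)
    have pos: "positive_op (C k)" for k
      using cfc_positive_op[OF A \<beta>_cont \<beta>_nonneg] \<Phi>(2) by (simp add: positive_map_def C_def)
    have one: "(\<Sum>k\<le>n. C k) = id_blinfun"
      using comb[of "\<lambda>_. 1"] \<Phi>(3) by (simp add: \<beta>_def cfc_const[OF A] unital_map_def)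
    have mean: "(\<Sum>k\<le>n. t k * \<beta> k s) = s" for s
    proof -
      have "(\<Sum>k\<le>n. t k * \<beta> k s) =
          m * (\<Sum>k\<le>n. Bernstein n k (?s s)) + (M' - m) / real n * (\<Sum>k\<le>n. real k * Bernstein n k (?s s))"
        unfolding sum_distrib_left sum.distrib[symmetric]
        by (intro sum.cong) (auto simp: t_def \<beta>_def algebra_simps)
      also have "\<dots> = s" using mM by (simp add: n_def)
      finally show ?thesis .
    qed
    have T: "(\<Sum>k\<le>n. t k *\<^sub>R C k) = \<Phi> A"
      using comb[of t] by (simp add: mean cfc_id[OF A])
    have "inner (cfc f (\<Phi> A) x) x \<le> (\<Sum>k\<le>n. f (t k) * inner (C k x) x)"
      unfolding T[symmetric] lessThan_Suc_atMost[symmetric]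
      by (rule discrete_jensenD[OF dj pos])
        (use m mM one in \<open>auto simp: t_def lessThan_Suc_atMost[symmetric] intro!: add_pos_nonneg\<close>)
    \<comment> \<open>By linearity the sum is the image of the Bernstein approximant of
      \<open>f\<close> at \<open>A\<close>, and this approximant stays below f + e.\<close>
    also have "\<dots> = inner (\<Phi> (cfc (\<lambda>s. \<Sum>k\<le>n. f (t k) * \<beta> k s) A) x) x"
      by (simp add: comb blinfun.sum_left inner_sum_left blinfun.scaleR_left)
    also have "\<dots> \<le> inner (\<Phi> (cfc (\<lambda>s. f s + e) A) x) x"
    proof (rule loewner_leD, rule positive_map_mono[OF \<Phi>(1,2)], rule cfc_mono[OF A])
      fix s assume s: "s \<in> {m..M'}"
      then have "?s s \<in> {0..1}" using mM by auto
      then have "\<bar>?F (?s s) - (\<Sum>k\<le>n. ?F (real k / real n) * Bernstein n k (?s s))\<bar> < e"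
        by (intro N) (auto simp: n_def)
      moreover have "m + (M' - m) * ?s s = s" using mM by simp
      ultimately show "(\<Sum>k\<le>n. f (t k) * \<beta> k s) \<le> f s + e" by (simp add: t_def \<beta>_def abs_less_iff)
    qed (auto intro!: cfc_bop[OF A] continuous_intros f \<beta>_cont)
    also have "cfc (\<lambda>s. f s + e) A = cfc f A + e *\<^sub>R id_blinfun"
      using cfc_add[OF A f continuous_on_const] by (simp add: cfc_const[OF A])
    also have "\<Phi> \<dots> = \<Phi> (cfc f A) + e *\<^sub>R id_blinfun"
      using linear_map_bopD[OF \<Phi>(1)] \<Phi>(3) by (simp add: cfc_bop[OF A f] bop_intros unital_map_def)
    finally have "inner (cfc f (\<Phi> A) x) x \<le> inner (\<Phi> (cfc f A) x) x + e * (norm x)\<^sup>2"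
      by (simp add: blinfun.bilinear_simps inner_simps power2_norm_eq_inner)
    moreover have "0 \<le> e * (norm x)\<^sup>2" using e by simp
    ultimately show ?thesis by simp
  qed
  have le: "inner (cfc f (\<Phi> A) x) x \<le> inner (\<Phi> (cfc f A) x) x" for x
    by (rule le_of_le_add_eps[OF approx])
  show ?thesis
    by (intro loewner_leI cfc_selfadjoint[OF \<Phi>A f] positive_map_selfadjoint[OF \<Phi> fA] le)
qed


section \<open>Operator antitone functions satisfying Jensen's inequality\<close>

text \<open>The two properties go together because both hold for constants and resolvents and both
  survive nonnegative combinations and uniform limits on compact intervals. For powers this class
  takes the place of the dilation argument, on any space \<open>'k\<close>.\<close>

definition jensen_antitone :: "'k::complex_hilbert_space itself \<Rightarrow> (real \<Rightarrow> real) \<Rightarrow> bool" where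
  "jensen_antitone K f \<longleftrightarrow> continuous_on {0<..} f \<and> discrete_jensen K f \<and>
    (\<forall>m M (A :: 'k \<Rightarrow>\<^sub>L 'k) B x. 0 < m \<longrightarrow> op_between m M A \<longrightarrow> op_between m M B \<longrightarrow> A \<le>\<^sub>L B \<longrightarrow>
      inner (cfc f B x) x \<le> inner (cfc f A x) x)"

lemma jensen_antitoneI:
  assumes "continuous_on {0<..} f"
    and "\<And>n (C :: nat \<Rightarrow> 'k::complex_hilbert_space \<Rightarrow>\<^sub>L 'k) t m M x.
      (\<And>i. i < n \<Longrightarrow> positive_op (C i)) \<Longrightarrow> (\<And>i. i < n \<Longrightarrow> m \<le> t i \<and> t i \<le> M) \<Longrightarrow> 0 < m \<Longrightarrow>
      (\<Sum>i<n. C i) = id_blinfun \<Longrightarrow> op_between m M (\<Sum>i<n. t i *\<^sub>R C i) \<Longrightarrow>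
      inner (cfc f (\<Sum>i<n. t i *\<^sub>R C i) x) x \<le> (\<Sum>i<n. f (t i) * inner (C i x) x)"
    and "\<And>m M (A :: 'k \<Rightarrow>\<^sub>L 'k) B x. 0 < m \<Longrightarrow> op_between m M A \<Longrightarrow> op_between m M B \<Longrightarrow> A \<le>\<^sub>L B \<Longrightarrow>
      inner (cfc f B x) x \<le> inner (cfc f A x) x"
  shows "jensen_antitone TYPE('k) f"
  unfolding jensen_antitone_def discrete_jensen_def
proof (intro conjI assms(1) allI impI)
  fix n x and t :: "nat \<Rightarrow> real" and C :: "nat \<Rightarrow> 'k \<Rightarrow>\<^sub>L 'k"
  assume C: "\<forall>i<n. positive_op (C i) \<and> 0 < t i" "(\<Sum>i<n. C i) = id_blinfun"
  \<comment> \<open>Inserting 1 keeps minimum and maximum meaningful for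
    \<open>n = 0\<close>.\<close>
  define m where "m = Min (insert 1 (t ` {..<n}))"
  define M where "M = Max (insert 1 (t ` {..<n}))"
  have m: "0 < m" using C(1) by (auto simp: m_def)
  have t: "m \<le> t i \<and> t i \<le> M" if "i < n" for i using that by (simp add: m_def M_def)
  have "op_between m M (\<Sum>i<n. t i *\<^sub>R C i)"
    by (rule op_between_sum) (use C t in auto)
  then show "inner (cfc f (\<Sum>i<n. t i *\<^sub>R C i) x) x \<le> (\<Sum>i<n. f (t i) * inner (C i x) x)"
    using assms(2) C t m by blast
qed (use assms(3) in blast)

lemma jensen_antitoneD:
  fixes n :: nat
  assumes "jensen_antitone TYPE('k::complex_hilbert_space) f"
  shows "continuous_on {0<..} f" "discrete_jensen TYPE('k) f"
    and "0 < m \<Longrightarrow> op_between m M A \<Longrightarrow> op_between m M B \<Longrightarrow> A \<le>\<^sub>L B \<Longrightarrow>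
      inner (cfc f B x) x \<le> inner (cfc f A (x :: 'k)) x"
    and "(\<And>i. i < n \<Longrightarrow> positive_op (C i)) \<Longrightarrow> (\<And>i. i < n \<Longrightarrow> m \<le> t i \<and> t i \<le> M) \<Longrightarrow> 0 < m \<Longrightarrow>
      (\<Sum>i<n. C i) = id_blinfun \<Longrightarrow>
      inner (cfc f (\<Sum>i<n. t i *\<^sub>R C i) x) x \<le> (\<Sum>i<n. f (t i) * inner (C i x) (x :: 'k))"
proof -
  show dj: "discrete_jensen TYPE('k) f" and "continuous_on {0<..} f"
    using assms by (auto simp: jensen_antitone_def)
  show "0 < m \<Longrightarrow> op_between m M A \<Longrightarrow> op_between m M B \<Longrightarrow> A \<le>\<^sub>L B \<Longrightarrow>
      inner (cfc f B x) x \<le> inner (cfc f A x) x"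
    using assms unfolding jensen_antitone_def by blast
  show "(\<And>i. i < n \<Longrightarrow> positive_op (C i)) \<Longrightarrow> (\<And>i. i < n \<Longrightarrow> m \<le> t i \<and> t i \<le> M) \<Longrightarrow> 0 < m \<Longrightarrow>
      (\<Sum>i<n. C i) = id_blinfun \<Longrightarrow>
      inner (cfc f (\<Sum>i<n. t i *\<^sub>R C i) x) x \<le> (\<Sum>i<n. f (t i) * inner (C i x) x)"
    by (rule discrete_jensenD[OF dj]) (auto intro: less_le_trans)
qed

lemma continuous_on_Icc_pos: "continuous_on {0<..} f \<Longrightarrow> 0 < m \<Longrightarrow> continuous_on {m..M} (f :: real \<Rightarrow> real)"
  by (rule continuous_on_subset) auto

lemma sum_inner_POVM:
  fixes C :: "nat \<Rightarrow> 'k::complex_hilbert_space \<Rightarrow>\<^sub>L 'k"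
  assumes "(\<Sum>i\<in>I. C i) = id_blinfun"
  shows "(\<Sum>i\<in>I. inner (C i x) y) = inner x y"
proof -
  have "(\<Sum>i\<in>I. inner (C i x) y) = inner ((\<Sum>i\<in>I. C i) x) y"
    by (simp add: blinfun.sum_left inner_sum_left)
  then show ?thesis by (simp add: assms)
qed

lemma jensen_antitone_const: "jensen_antitone TYPE('k::complex_hilbert_space) (\<lambda>t. c)"
proof (rule jensen_antitoneI)
  fix n t m M x and C :: "nat \<Rightarrow> 'k \<Rightarrow>\<^sub>L 'k"
  assume "(\<Sum>i<n. C i) = id_blinfun" "op_between m M (\<Sum>i<n. t i *\<^sub>R C i)"
  then show "inner (cfc (\<lambda>t. c) (\<Sum>i<n. t i *\<^sub>R C i) x) x \<le> (\<Sum>i<n. c * inner (C i x) x)"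
    by (simp add: cfc_const blinfun.scaleR_left sum_distrib_left[symmetric] sum_inner_POVM)
qed (auto simp: cfc_const)

lemma jensen_antitone_add_scale:
  assumes f: "jensen_antitone TYPE('k::complex_hilbert_space) f"
    and g: "jensen_antitone TYPE('k) g" and c: "0 \<le> c"
  shows "jensen_antitone TYPE('k) (\<lambda>t. f t + c * g t)"
proof -
  note [continuous_intros] = jensen_antitoneD(1)[OF f] jensen_antitoneD(1)[OF g]
  have eq: "inner (cfc (\<lambda>t. f t + c * g t) T x) x = inner (cfc f T x) x + c * inner (cfc g T x) x"
    if T: "op_between m M T" and m: "0 < m" for T :: "'k \<Rightarrow>\<^sub>L 'k" and x m M
  proof -
    have fc: "continuous_on {m..M} f" and gc: "continuous_on {m..M} g"
      using jensen_antitoneD(1)[OF f] jensen_antitoneD(1)[OF g] m by (auto intro: continuous_on_Icc_pos)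
    show ?thesis
      using cfc_add[OF T fc, of "\<lambda>t. c * g t"] cfc_scale[OF T gc, of c]
      by (simp add: continuous_intros gc blinfun.bilinear_simps inner_simps)
  qed
  show ?thesis
  proof (rule jensen_antitoneI)
    fix n t m M x and C :: "nat \<Rightarrow> 'k \<Rightarrow>\<^sub>L 'k"
    assume C: "\<And>i. i < n \<Longrightarrow> positive_op (C i)" "\<And>i. i < n \<Longrightarrow> m \<le> t i \<and> t i \<le> M" "0 < m"
      "(\<Sum>i<n. C i) = id_blinfun" "op_between m M (\<Sum>i<n. t i *\<^sub>R C i)"
    show "inner (cfc (\<lambda>t. f t + c * g t) (\<Sum>i<n. t i *\<^sub>R C i) x) x
        \<le> (\<Sum>i<n. (f (t i) + c * g (t i)) * inner (C i x) x)"
    proof -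
      have "inner (cfc f (\<Sum>i<n. t i *\<^sub>R C i) x) x \<le> (\<Sum>i<n. f (t i) * inner (C i x) x)"
        by (rule jensen_antitoneD(4)[OF f, where m = m and M = M]) (use C in auto)
      moreover have "inner (cfc g (\<Sum>i<n. t i *\<^sub>R C i) x) x \<le> (\<Sum>i<n. g (t i) * inner (C i x) x)"
        by (rule jensen_antitoneD(4)[OF g, where m = m and M = M]) (use C in auto)
      from mult_left_mono[OF this c]
      have "c * inner (cfc g (\<Sum>i<n. t i *\<^sub>R C i) x) x \<le> c * (\<Sum>i<n. g (t i) * inner (C i x) x)" .
      ultimately show ?thesis
        unfolding eq[OF C(5,3)] by (simp add: distrib_right sum.distrib sum_distrib_left mult.assoc)
    qed
  next
    fix m M x and A B :: "'k \<Rightarrow>\<^sub>L 'k"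
    assume h: "0 < m" "op_between m M A" "op_between m M B" "A \<le>\<^sub>L B"
    show "inner (cfc (\<lambda>t. f t + c * g t) B x) x \<le> inner (cfc (\<lambda>t. f t + c * g t) A x) x"
      unfolding eq[OF h(2,1)] eq[OF h(3,1)]
      by (intro add_mono mult_left_mono c jensen_antitoneD(3)[OF f h] jensen_antitoneD(3)[OF g h])
  qed (intro continuous_intros)
qed

lemma jensen_antitone_sum:
  assumes "\<And>i::nat. i < n \<Longrightarrow> jensen_antitone TYPE('k::complex_hilbert_space) (f i)"
  shows "jensen_antitone TYPE('k) (\<lambda>t. \<Sum>i<n. f i t)"
  using assms
proof (induction n)
  case (Suc n)
  then show ?case
    using jensen_antitone_add_scale[OF Suc.IH Suc.prems, of n 1] by simp
qed (simp add: jensen_antitone_const)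

text \<open>Identifies 1 / (t + l) at \<open>T\<close> with the resolvent: \<open>R x\<close> is the
  vector at which the supremum in the variational formula below is attained.\<close>

lemma cfc_resolvent:
  assumes T: "op_between m M T" and m: "0 < m" and l: "0 \<le> l"
  defines "R \<equiv> cfc (\<lambda>t. 1 / (t + l)) T"
  shows "T (R x) + l *\<^sub>R R x = x"
proof -
  have c: "continuous_on {m..M} (\<lambda>t. t + l)" "continuous_on {m..M} (\<lambda>t. 1 / (t + l))"
    using m l by (auto intro!: continuous_intros)
  have "cfc (\<lambda>t. t + l) T o\<^sub>L R = cfc (\<lambda>t. (t + l) * (1 / (t + l))) T"
    unfolding R_def by (rule cfc_mult[OF T c, symmetric])
  also have "\<dots> = cfc (\<lambda>t. 1) T"
    by (rule cfc_cong[OF T continuous_on_mult[OF c]]) (use m l in auto)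
  also have "cfc (\<lambda>t. t + l) T = T + l *\<^sub>R id_blinfun"
    using cfc_add[OF T continuous_on_id continuous_on_const, of l] by (simp add: cfc_const[OF T] cfc_id[OF T])
  finally have "((T + l *\<^sub>R id_blinfun) o\<^sub>L R) x = x" by (simp add: cfc_const[OF T])
  then show ?thesis by (simp add: blinfun.bilinear_simps)
qed

text \<open>Expand <C (x - w u), x - w u> >= 0 and divide by \<open>w\<close>.\<close>

lemma positive_op_quadratic:
  assumes C: "positive_op C" and w: "0 < w"
  shows "2 * inner (C u) x \<le> (1 / w) * inner (C x) x + w * inner (C u) u"
proof -
  have sa: "selfadjoint C" using C by (simp add: positive_op_iff)
  have "0 \<le> inner (C (x - w *\<^sub>R u)) (x - w *\<^sub>R u)" using C by (simp add: positive_op_iff)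
  also have "\<dots> = inner (C x) x - 2 * w * inner (C u) x + w * (w * inner (C u) u)"
    by (simp add: blinfun.bilinear_simps inner_simps selfadjoint_inner[OF sa, of x u] inner_commute[of x] algebra_simps)
  finally have "2 * w * inner (C u) x \<le> inner (C x) x + w * (w * inner (C u) u)" by simp
  then show ?thesis using w by (simp add: field_simps)
qed

text \<open>Both properties use \<open>\<langle>(T + l)\<^bsup>-1\<^esup> x, x\<rangle> = sup\<^sub>u (2 Re \<langle>u, x\<rangle> - \<langle>(T + l) u, u\<rangle>)\<close>.\<close>

lemma jensen_antitone_resolvent:
  assumes l: "0 \<le> l"
  shows "jensen_antitone TYPE('k::complex_hilbert_space) (\<lambda>t. 1 / (t + l))"
proof (rule jensen_antitoneI)
  show "continuous_on {0<..} (\<lambda>t. 1 / (t + l))" using l by (auto intro!: continuous_intros)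
next
  fix n t m M x and C :: "nat \<Rightarrow> 'k \<Rightarrow>\<^sub>L 'k"
  assume C: "\<And>i. i < n \<Longrightarrow> positive_op (C i)" "\<And>i. i < n \<Longrightarrow> m \<le> t i \<and> t i \<le> M" "0 < m"
    "(\<Sum>i<n. C i) = id_blinfun" "op_between m M (\<Sum>i<n. t i *\<^sub>R C i)"
  define T where "T = (\<Sum>i<n. t i *\<^sub>R C i)"
  define u where "u = cfc (\<lambda>t. 1 / (t + l)) T x"
  have ux: "T u + l *\<^sub>R u = x"
    using cfc_resolvent[OF C(5,3) l, of x] by (simp add: u_def T_def)
  \<comment> \<open>With the weight w = t_i + l the sum over \<open>i\<close> gives 2 <u, x> on the
    left and <(T + l) u, u> = <x, u> as the last term on the right, so that one <u, x>
    remains.\<close>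
  have "2 * inner (C i u) x \<le> 1 / (t i + l) * inner (C i x) x + (t i + l) * inner (C i u) u" if "i < n" for i
    by (rule positive_op_quadratic) (use C(1-3) that l in \<open>auto intro: add_pos_nonneg less_le_trans\<close>)
  then have "(\<Sum>i<n. 2 * inner (C i u) x) \<le>
      (\<Sum>i<n. 1 / (t i + l) * inner (C i x) x + (t i + l) * inner (C i u) u)"
    by (intro sum_mono) auto
  moreover have "(\<Sum>i<n. 2 * inner (C i u) x) = 2 * inner u x"
    by (simp add: sum_distrib_left[symmetric] sum_inner_POVM[OF C(4)])
  moreover have "(\<Sum>i<n. (t i + l) * inner (C i u) u) = inner (T u + l *\<^sub>R u) u"
    by (simp add: T_def blinfun.bilinear_simps inner_simps blinfun.sum_left inner_sum_left distrib_right
        sum.distrib sum_distrib_left[symmetric] sum_inner_POVM[OF C(4)])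
  ultimately have "inner u x \<le> (\<Sum>i<n. 1 / (t i + l) * inner (C i x) x)"
    by (simp add: sum.distrib ux inner_commute[of x u])
  then show "inner (cfc (\<lambda>t. 1 / (t + l)) (\<Sum>i<n. t i *\<^sub>R C i) x) x \<le> (\<Sum>i<n. 1 / (t i + l) * inner (C i x) x)"
    by (simp add: u_def T_def)
next
  fix m M x and A B :: "'k \<Rightarrow>\<^sub>L 'k"
  assume h: "0 < m" "op_between m M A" "op_between m M B" "A \<le>\<^sub>L B"
  have sa: "selfadjoint A" using h(2) by (rule op_between_selfadjoint)
  define u where "u = cfc (\<lambda>t. 1 / (t + l)) B x"
  define v where "v = cfc (\<lambda>t. 1 / (t + l)) A x"
  have u: "B u + l *\<^sub>R u = x" and v: "A v + l *\<^sub>R v = x"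
    using cfc_resolvent[OF h(3,1) l, of x] cfc_resolvent[OF h(2,1) l, of x] by (simp_all add: u_def v_def)
  \<comment> \<open>\<open>v\<close> maximises the functional of \<open>A\<close>, while
    \<open>u\<close>, the maximiser for \<open>B\<close>, is only a competitor; the deficit is the
    form of A + l at v - u.\<close>
  let ?w = "v - u"
  have "0 \<le> m * (norm ?w)\<^sup>2" using h(1) by simp
  also have "\<dots> \<le> inner (A ?w) ?w" using h(2) by (simp add: op_between_def)
  finally have "0 \<le> inner (A ?w) ?w + l * inner ?w ?w" using l by simp
  also have "\<dots> = inner (A v + l *\<^sub>R v) v - 2 * inner (A v + l *\<^sub>R v) u + (inner (A u) u + l * inner u u)"
  proof -
    have "inner (A ?w) ?w = inner (A v) v - 2 * inner (A v) u + inner (A u) u"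
      by (simp add: blinfun.diff_right inner_diff_left inner_diff_right selfadjoint_inner[OF sa, of u v]
          inner_commute[of u "A v"])
    moreover have "inner ?w ?w = inner v v - 2 * inner v u + inner u u"
      by (simp add: inner_diff_left inner_diff_right inner_commute[of u v])
    ultimately show ?thesis by (simp add: inner_add_left algebra_simps)
  qed
  also have "\<dots> \<le> inner (A v + l *\<^sub>R v) v - 2 * inner (A v + l *\<^sub>R v) u + inner (B u + l *\<^sub>R u) u"
    using loewner_leD[OF h(4), of u] by (simp add: inner_simps)
  finally have "inner u x \<le> inner v x" unfolding u v by (simp add: inner_commute)
  then show "inner (cfc (\<lambda>t. 1 / (t + l)) B x) x \<le> inner (cfc (\<lambda>t. 1 / (t + l)) A x) x"
    by (simp add: u_def v_def)
qed

lemma jensen_antitone_limit: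
  assumes f: "continuous_on {0<..} f"
    and approx: "\<And>m M e. 0 < m \<Longrightarrow> 0 < e \<Longrightarrow>
      \<exists>\<phi>. jensen_antitone TYPE('k::complex_hilbert_space) \<phi> \<and> (\<forall>t\<in>{m..M}. \<bar>f t - \<phi> t\<bar> \<le> e)"
  shows "jensen_antitone TYPE('k) f"
proof -
  have close: "inner (cfc f T x) x \<le> inner (cfc \<phi> T x) x + e * (norm x)\<^sup>2"
    "inner (cfc \<phi> T x) x \<le> inner (cfc f T x) x + e * (norm x)\<^sup>2"
    if T: "op_between m M T" and m: "0 < m" and \<phi>: "continuous_on {0<..} \<phi>"
      and le: "\<forall>t\<in>{m..M}. \<bar>f t - \<phi> t\<bar> \<le> e" for T :: "'k \<Rightarrow>\<^sub>L 'k" and x m M e \<phi>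
  proof -
    have fc: "continuous_on {m..M} f" and \<phi>c: "continuous_on {m..M} \<phi>"
      using f \<phi> m by (auto intro: continuous_on_Icc_pos)
    have "inner (cfc f T x) x \<le> inner (cfc (\<lambda>t. \<phi> t + e) T x) x"
      by (rule cfc_mono_inner[OF T fc continuous_on_add[OF \<phi>c continuous_on_const]])
        (use le in \<open>fastforce simp: abs_le_iff\<close>)
    moreover have "inner (cfc \<phi> T x) x \<le> inner (cfc (\<lambda>t. f t + e) T x) x"
      by (rule cfc_mono_inner[OF T \<phi>c continuous_on_add[OF fc continuous_on_const]])
        (use le in \<open>fastforce simp: abs_le_iff\<close>)
    ultimately show "inner (cfc f T x) x \<le> inner (cfc \<phi> T x) x + e * (norm x)\<^sup>2"
      "inner (cfc \<phi> T x) x \<le> inner (cfc f T x) x + e * (norm x)\<^sup>2"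
      using cfc_add[OF T \<phi>c continuous_on_const, of e] cfc_add[OF T fc continuous_on_const, of e]
      by (simp_all add: cfc_const[OF T] blinfun.bilinear_simps inner_simps power2_norm_eq_inner)
  qed

  show ?thesis
  proof (rule jensen_antitoneI[OF f])
    fix n t m M x and C :: "nat \<Rightarrow> 'k \<Rightarrow>\<^sub>L 'k"
    assume C: "\<And>i. i < n \<Longrightarrow> positive_op (C i)" "\<And>i. i < n \<Longrightarrow> m \<le> t i \<and> t i \<le> M" "0 < m"
      "(\<Sum>i<n. C i) = id_blinfun" "op_between m M (\<Sum>i<n. t i *\<^sub>R C i)"
    show "inner (cfc f (\<Sum>i<n. t i *\<^sub>R C i) x) x \<le> (\<Sum>i<n. f (t i) * inner (C i x) x)"
    proof (rule le_of_le_add_eps)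
      fix e :: real assume "0 < e"
      then obtain \<phi> where \<phi>: "jensen_antitone TYPE('k) \<phi>" "\<forall>t\<in>{m..M}. \<bar>f t - \<phi> t\<bar> \<le> e"
        using approx[OF C(3)] by blast
      have "(\<Sum>i<n. \<phi> (t i) * inner (C i x) x) \<le> (\<Sum>i<n. (f (t i) + e) * inner (C i x) x)"
      proof (intro sum_mono mult_right_mono)
        fix i assume "i \<in> {..<n}"
        then show "\<phi> (t i) \<le> f (t i) + e" using \<phi>(2)[rule_format, of "t i"] C(2) by (auto simp: abs_le_iff)
        show "0 \<le> inner (C i x) x" using C(1) \<open>i \<in> {..<n}\<close> by (simp add: positive_op_iff)
      qed
      also have "\<dots> = (\<Sum>i<n. f (t i) * inner (C i x) x) + e * (norm x)\<^sup>2"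
        by (simp add: distrib_right sum.distrib sum_distrib_left[symmetric] sum_inner_POVM[OF C(4)] power2_norm_eq_inner)
      finally have "(\<Sum>i<n. \<phi> (t i) * inner (C i x) x) \<le> (\<Sum>i<n. f (t i) * inner (C i x) x) + e * (norm x)\<^sup>2" .
      moreover have "inner (cfc \<phi> (\<Sum>i<n. t i *\<^sub>R C i) x) x \<le> (\<Sum>i<n. \<phi> (t i) * inner (C i x) x)"
        by (rule jensen_antitoneD(4)[OF \<phi>(1), where m = m and M = M]) (use C in auto)
      ultimately show "inner (cfc f (\<Sum>i<n. t i *\<^sub>R C i) x) x \<le> (\<Sum>i<n. f (t i) * inner (C i x) x) + 2 * e * (norm x)\<^sup>2"
        using close(1)[OF C(5,3) jensen_antitoneD(1)[OF \<phi>(1)] \<phi>(2), of x] by simp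
    qed
  next
    fix m M x and A B :: "'k \<Rightarrow>\<^sub>L 'k"
    assume h: "0 < m" "op_between m M A" "op_between m M B" "A \<le>\<^sub>L B"
    show "inner (cfc f B x) x \<le> inner (cfc f A x) x"
    proof (rule le_of_le_add_eps)
      fix e :: real assume "0 < e"
      then obtain \<phi> where \<phi>: "jensen_antitone TYPE('k) \<phi>" "\<forall>t\<in>{m..M}. \<bar>f t - \<phi> t\<bar> \<le> e"
        using approx[OF h(1)] by blast
      show "inner (cfc f B x) x \<le> inner (cfc f A x) x + 2 * e * (norm x)\<^sup>2"
        using close(1)[OF h(3,1) jensen_antitoneD(1)[OF \<phi>(1)] \<phi>(2), of x] jensen_antitoneD(3)[OF \<phi>(1) h, where x = x]
          close(2)[OF h(2,1) jensen_antitoneD(1)[OF \<phi>(1)] \<phi>(2), of x]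
        by simp
    qed
  qed
qed


text \<open>
  With \<open>S t = \<Sum>\<^sub>k q\<^bsup>(1-r)k\<^esup> / (t + q\<^bsup>k\<^esup>)\<close> over all integers \<open>k\<close>, the shift \<open>k \<mapsto> k + 1\<close> gives \<open>S (q t) = q\<^bsup>-r\<^esup> S t\<close>.
  As \<open>S\<close> is decreasing, \<open>S t / S 1\<close> differs from \<open>t\<^bsup>-r\<^esup>\<close> by a factor in \<open>[q\<^bsup>-r\<^esup>, q\<^bsup>r\<^esup>]\<close>.
\<close>

lemma powr_resolvent_approximation:
  fixes r e m M :: real
  assumes r: "0 < r" "r < 1" and m: "0 < m" and e: "0 < e"
  shows "\<exists>(n::nat) c k d l. (\<forall>i. 0 \<le> c i \<and> 0 < k i \<and> 0 \<le> d i \<and> 0 < l i) \<and>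
    (\<forall>t\<in>{m..M}. \<bar>t powr - r - (\<Sum>i<n. c i / (t + k i) + d i / (t + l i))\<bar> \<le> e)"
proof -
  \<comment> \<open>Half of \<open>e\<close> pays for the oscillation of \<open>S t / S 1\<close>
    around the power, half for truncating the series. The oscillation is at most
    \<open>\<delta> * m powr - r\<close>, which fixes \<open>\<delta>\<close>, and then
    \<open>q\<close> through \<open>q powr r = 1 + \<delta>\<close>.\<close>
  define \<delta> where "\<delta> = e / 2 * m powr r"
  have \<delta>: "0 < \<delta>" using e m by (simp add: \<delta>_def)
  define q where "q = (1 + \<delta>) powr (1 / r)"
  have qr: "q powr r = 1 + \<delta>" using r \<delta> by (simp add: q_def powr_powr)
  have q: "1 < q" using r \<delta> by (simp add: q_def)
  define \<rho> where "\<rho> = q powr - r"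
  have \<rho>: "0 < \<rho>" "\<rho> < 1" "\<rho> * (1 + \<delta>) = 1"
    using q r \<delta> qr by (auto simp: \<rho>_def powr_minus field_simps powr_less_one)
  define \<alpha> where "\<alpha> = q * \<rho>"
  have "\<alpha> = q powr (1 - r)"
    using q unfolding \<alpha>_def \<rho>_def by (simp add: powr_diff powr_minus field_simps)
  then have \<alpha>: "1 < \<alpha>" using q r by simp
  \<comment> \<open>\<open>a\<close> carries the indices k >= 0 of the two-sided series and
    \<open>b\<close> the negative ones; \<open>Suc k\<close> prevents the index 0 from being counted
    twice.\<close>
  define a where "a k t = \<alpha> ^ k / (t + q ^ k)" for k :: nat and t
  define b where "b k t = (1 / \<alpha>) ^ Suc k / (t + (1 / q) ^ Suc k)" for k :: nat and t
  have a_nonneg: "0 \<le> a k t" if "0 < t" for k t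
    using that \<alpha> q unfolding a_def by (intro divide_nonneg_nonneg add_nonneg_nonneg) auto
  have b_nonneg: "0 \<le> b k t" if "0 < t" for k t
    using that \<alpha> q unfolding b_def by (intro divide_nonneg_nonneg add_nonneg_nonneg) auto
  \<comment> \<open>The two ends converge for different reasons. Dropping \<open>t\<close> from the
    denominator of \<open>a\<close> leaves a geometric series of ratio \<open>q powr - r\<close>;
    dropping the power of \<open>q\<close> from that of \<open>b\<close> leaves the ratio
    \<open>q powr - (1 - r)\<close>.\<close>
  have a_le: "a k t \<le> \<rho> ^ k" if "0 < t" for k t
  proof -
    have "a k t \<le> \<alpha> ^ k / q ^ k"
      unfolding a_def using that \<alpha> q by (intro divide_left_mono mult_pos_pos add_pos_pos) auto
    also have "\<dots> = \<rho> ^ k" using q by (simp add: \<alpha>_def power_mult_distrib)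
    finally show ?thesis .
  qed
  have b_le: "b k t \<le> (1 / \<alpha>) ^ Suc k / s" if "0 < s" "s \<le> t" for k t s
    unfolding b_def using that \<alpha> q
    by (intro divide_left_mono mult_pos_pos add_pos_pos) (auto intro!: add_increasing2)
  have geo: "summable (\<lambda>k. \<rho> ^ k)" "summable (\<lambda>k. (1 / \<alpha>) ^ Suc k / s)" for s
    using \<rho> \<alpha> by (auto intro!: summable_geometric summable_divide simp: summable_Suc_iff)
  have sum_a: "summable (\<lambda>k. a k t)" if "0 < t" for t
    by (rule summable_comparison_test'[OF geo(1), of 0]) (use a_le[OF that] a_nonneg[OF that] in auto)
  have sum_b: "summable (\<lambda>k. b k t)" if "0 < t" for t
    by (rule summable_comparison_test'[OF geo(2), of 0 _ t])
      (use b_le[OF that order_refl] b_nonneg[OF that] in auto)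
  define S where "S t = (\<Sum>k. a k t) + (\<Sum>k. b k t)" for t
  have shift: "S (q * t) = \<rho> * S t" if t: "0 < t" for t
  proof -
    have qt: "0 < q * t" using q t by simp
    have a_Suc: "a (Suc k) (q * t) = \<rho> * a k t" for k
      using q by (simp add: a_def \<alpha>_def distrib_left[symmetric])
    have b_Suc: "b k (q * t) = \<rho> * b (Suc k) t" for k
    proof -
      have "\<rho> * b (Suc k) t = (\<rho> * (1 / \<alpha>)) * (1 / \<alpha>) ^ Suc k / (t + (1 / q) ^ Suc (Suc k))"
        by (simp add: b_def)
      also have "\<rho> * (1 / \<alpha>) = 1 / q" using \<rho> q by (simp add: \<alpha>_def)
      also have "(1 / q) * (1 / \<alpha>) ^ Suc k / (t + (1 / q) ^ Suc (Suc k))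
          = (1 / \<alpha>) ^ Suc k / (q * (t + (1 / q) ^ Suc (Suc k)))" by simp
      also have "q * (t + (1 / q) ^ Suc (Suc k)) = q * t + (1 / q) ^ Suc k"
        using q by (simp add: distrib_left)
      finally show ?thesis by (simp add: b_def)
    qed
    \<comment> \<open>The one term that crosses from \<open>b\<close> to \<open>a\<close> under the
      shift of indices.\<close>
    have ab: "a 0 (q * t) = \<rho> * b 0 t"
    proof -
      have "\<rho> * b 0 t = (\<rho> * (1 / \<alpha>)) / (t + 1 / q)" by (simp add: b_def)
      also have "\<rho> * (1 / \<alpha>) = 1 / q" using \<rho> q by (simp add: \<alpha>_def)
      also have "(1 / q) / (t + 1 / q) = 1 / (q * (t + 1 / q))" by simp
      also have "q * (t + 1 / q) = q * t + 1" using q by (simp add: distrib_left)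
      finally show ?thesis by (simp add: a_def)
    qed
    have "(\<Sum>k. a k (q * t)) = \<rho> * (\<Sum>k. a k t) + a 0 (q * t)"
      using suminf_split_head[OF sum_a[OF qt]] suminf_mult[OF sum_a[OF t], of \<rho>] by (simp add: a_Suc)
    moreover have "(\<Sum>k. b k (q * t)) = \<rho> * ((\<Sum>k. b k t) - b 0 t)"
    proof -
      have "summable (\<lambda>k. b (Suc k) t)" using sum_b[OF t] summable_Suc_iff[of "\<lambda>k. b k t"] by blast
      from suminf_mult[OF this, of \<rho>] show ?thesis
        using suminf_split_head[OF sum_b[OF t]] by (simp add: b_Suc)
    qed
    ultimately show ?thesis by (simp add: S_def ab algebra_simps)
  qed
  have anti: "S t \<le> S s" if "0 < s" "s \<le> t" for s t
    unfolding S_def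
  proof (intro add_mono suminf_le sum_a sum_b)
    show "a k t \<le> a k s" "b k t \<le> b k s" for k
      unfolding a_def b_def using that \<alpha> q
      by (intro divide_left_mono mult_pos_pos add_pos_pos; simp)+
  qed (use that in auto)
  have S1: "0 < S 1"
  proof -
    have "0 < (\<Sum>k. a k 1)"
      by (rule suminf_pos[OF sum_a]) (use \<alpha> q in \<open>auto simp: a_def intro!: divide_pos_pos add_pos_pos\<close>)
    moreover have "0 \<le> (\<Sum>k. b k 1)" by (rule suminf_nonneg[OF sum_b]) (auto intro: b_nonneg)
    ultimately show ?thesis by (simp add: S_def)
  qed
  have shift_pow: "S (q ^ k * t) = \<rho> ^ k * S t" if t: "0 < t" for k t
  proof (induction k)
    case (Suc k)
    then show ?case using shift[of "q ^ k * t"] q t by (simp add: mult.assoc)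
  qed simp
  have S_powr: "S (q powr real_of_int j) = S 1 * (q powr real_of_int j) powr - r" for j
  proof -
    have pr: "\<rho> ^ k = (q powr real k) powr - r" for k
      using q by (simp add: \<rho>_def powr_powr powr_realpow[symmetric] mult.commute)
    show ?thesis
    proof (cases "0 \<le> j")
      case True
      then obtain k where j: "j = int k" using nonneg_int_cases by blast
      show ?thesis using shift_pow[of 1 k] pr[of k] q by (simp add: j powr_realpow)
    next
      case False
      then obtain k where j: "j = - int k" by (metis nat_0_le minus_minus int_nat_eq linorder_le_cases neg_0_le_iff_le)
      have "q ^ k * q powr real_of_int j = 1"
        using q by (simp add: j powr_minus powr_realpow)
      then have "S 1 = \<rho> ^ k * S (q powr real_of_int j)"
        using shift_pow[of "q powr real_of_int j" k] q by simp
      moreover have "\<rho> ^ k * (q powr real_of_int j) powr - r = 1"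
        using q by (simp add: pr j powr_powr powr_add[symmetric])
      ultimately show ?thesis using \<rho> by (metis mult.assoc mult.commute mult.right_neutral)
    qed
  qed
  have near: "\<bar>t powr - r - S t / S 1\<bar> \<le> e / 2" if t: "m \<le> t" for t
  proof -
    have t0: "0 < t" using m t by simp
    \<comment> \<open>The power of \<open>q\<close> with s <= t <= q s. At both ends
      \<open>S\<close> is known exactly, and monotonicity encloses its value at
      \<open>t\<close>.\<close>
    define s where "s = q powr real_of_int \<lfloor>log q t\<rfloor>"
    have s0: "0 < s" using q by (simp add: s_def)
    have st: "s \<le> t" "t \<le> q * s"
    proof -
      have "s \<le> q powr log q t" unfolding s_def using q by (intro powr_mono) auto
      then show "s \<le> t" using q t0 by simp
      have "q powr log q t \<le> q powr (real_of_int \<lfloor>log q t\<rfloor> + 1)" using q by (intro powr_mono) linarith+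
      then show "t \<le> q * s" using q t0 by (simp add: s_def powr_add mult.commute)
    qed
    have Ss: "S s = S 1 * s powr - r" using S_powr by (simp add: s_def)
    have Sqs: "S (q * s) = S 1 * (\<rho> * s powr - r)" using shift[OF s0] Ss by simp
    have qs: "(q * s) powr - r = \<rho> * s powr - r" using q s0 by (simp add: powr_mult \<rho>_def)
    have 1: "\<rho> * s powr - r \<le> S t / S 1" "S t / S 1 \<le> s powr - r"
      using anti[OF t0 st(2)] anti[OF s0 st(1)] S1 by (auto simp: Ss Sqs field_simps)
    have 2: "\<rho> * s powr - r \<le> t powr - r" "t powr - r \<le> s powr - r"
      using powr_mono2'[of "- r" t "q * s"] powr_mono2'[of "- r" s t] r t0 s0 st by (auto simp: qs)
    have "\<bar>t powr - r - S t / S 1\<bar> \<le> s powr - r - \<rho> * s powr - r" using 1 2 by linarith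
    also have "\<dots> = (\<rho> * s powr - r) * (1 + \<delta>) - \<rho> * s powr - r"
      using \<rho>(3) by (simp add: mult.commute mult.left_commute)
    also have "\<dots> = \<delta> * (\<rho> * s powr - r)" by (simp add: algebra_simps)
    also have "\<dots> \<le> \<delta> * m powr - r"
    proof (rule mult_left_mono)
      have "t powr - r \<le> m powr - r" using m t r by (intro powr_mono2') auto
      then show "\<rho> * s powr - r \<le> m powr - r" using 2 by simp
    qed (use \<delta> in simp)
    also have "\<dots> = e / 2" using m by (simp add: \<delta>_def powr_minus)
    finally show ?thesis .
  qed
  have "uniform_limit {m..M} (\<lambda>n t. \<Sum>k<n. a k t + b k t) (\<lambda>t. \<Sum>k. a k t + b k t) sequentially"
  proof (rule Weierstrass_m_test)
    show "norm (a k t + b k t) \<le> \<rho> ^ k + (1 / \<alpha>) ^ Suc k / m" if "t \<in> {m..M}" for k t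
      using that m a_nonneg[of t k] b_nonneg[of t k] a_le[of t k] b_le[OF m, of t k] by auto
    show "summable (\<lambda>k. \<rho> ^ k + (1 / \<alpha>) ^ Suc k / m)" by (intro summable_add geo)
  qed
  then have "\<forall>\<^sub>F n in sequentially. \<forall>t\<in>{m..M}. dist (\<Sum>k<n. a k t + b k t) (\<Sum>k. a k t + b k t) < S 1 * (e / 2)"
    using S1 e by (intro uniform_limitD) auto
  then obtain n where "\<forall>t\<in>{m..M}. dist (\<Sum>k<n. a k t + b k t) (\<Sum>k. a k t + b k t) < S 1 * (e / 2)"
    using eventually_happens'[OF sequentially_bot] by blast
  then have n: "\<bar>(\<Sum>k<n. a k t + b k t) - (\<Sum>k. a k t + b k t)\<bar> < S 1 * (e / 2)" if "t \<in> {m..M}" for t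
    using that by (simp add: dist_real_def)
  have fin: "\<bar>t powr - r - (\<Sum>i<n. \<alpha> ^ i / S 1 / (t + q ^ i) + (1 / \<alpha>) ^ Suc i / S 1 / (t + (1 / q) ^ Suc i))\<bar> \<le> e"
    if t: "t \<in> {m..M}" for t
  proof -
    have t0: "0 < t" using t m by auto
    have "(\<Sum>k. a k t + b k t) = S t"
      unfolding S_def by (rule suminf_add[symmetric]) (intro sum_a sum_b t0)+
    then have "\<bar>(\<Sum>k<n. a k t + b k t) - S t\<bar> / S 1 \<le> e / 2"
      using n[OF t] S1 by (simp add: divide_le_eq mult.commute)
    then have "\<bar>(\<Sum>k<n. a k t + b k t) / S 1 - S t / S 1\<bar> \<le> e / 2"
      using S1 by (simp add: diff_divide_distrib[symmetric] abs_divide)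
    moreover have "\<bar>t powr - r - S t / S 1\<bar> \<le> e / 2" using near t by simp
    moreover have "(\<Sum>k<n. a k t + b k t) / S 1 =
        (\<Sum>i<n. \<alpha> ^ i / S 1 / (t + q ^ i) + (1 / \<alpha>) ^ Suc i / S 1 / (t + (1 / q) ^ Suc i))"
      unfolding sum_divide_distrib a_def b_def
      by (intro sum.cong refl) (simp only: add_divide_distrib divide_divide_eq_left mult.commute)
    ultimately show ?thesis by linarith
  qed
  show ?thesis
    by (rule exI[of _ n], rule exI[of _ "\<lambda>i. \<alpha> ^ i / S 1"], rule exI[of _ "\<lambda>i. q ^ i"],
        rule exI[of _ "\<lambda>i. (1 / \<alpha>) ^ Suc i / S 1"], rule exI[of _ "\<lambda>i. (1 / q) ^ Suc i"])
      (use fin \<alpha> q S1 in auto)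
qed

lemma jensen_antitone_powr_minus:
  assumes "0 \<le> r" "r \<le> 1"
  shows "jensen_antitone TYPE('k::complex_hilbert_space) (\<lambda>t. t powr - r)"
proof (rule jensen_antitone_limit)
  show "continuous_on {0<..} (\<lambda>t. t powr - r)" by (auto intro!: continuous_intros)
  fix m M e :: real assume m: "0 < m" and e: "0 < e"
  \<comment> \<open>At the two end points one side of the series diverges, but there the function is
    a constant or the resolvent with l = 0.\<close>
  consider "r = 0" | "r = 1" | "0 < r" "r < 1" using assms by linarith
  then show "\<exists>\<phi>. jensen_antitone TYPE('k) \<phi> \<and> (\<forall>t\<in>{m..M}. \<bar>t powr - r - \<phi> t\<bar> \<le> e)"
  proof cases
    case 1
    then show ?thesis using m e jensen_antitone_const[of 1] by (intro exI[of _ "\<lambda>_. 1"]) auto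
  next
    case 2
    then show ?thesis using m e jensen_antitone_resolvent[of 0]
      by (intro exI[of _ "\<lambda>t. 1 / (t + 0)"]) (auto simp: powr_minus field_simps)
  next
    case 3
    obtain n c k d l where pos: "\<forall>i. 0 \<le> c i \<and> 0 < k i \<and> 0 \<le> d i \<and> 0 < l i"
      and near: "\<forall>t\<in>{m..M}. \<bar>t powr - r - (\<Sum>i<(n::nat). c i / (t + k i) + d i / (t + l i))\<bar> \<le> e"
      using powr_resolvent_approximation[OF 3 m e] by blast
    have "jensen_antitone TYPE('k) (\<lambda>t. \<Sum>i<n. (0 + c i * (1 / (t + k i))) + d i * (1 / (t + l i)))"
      using pos by (intro jensen_antitone_sum jensen_antitone_add_scale jensen_antitone_const
          jensen_antitone_resolvent) (auto intro: less_imp_le)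
    then show ?thesis using near by (auto intro!: exI)
  qed
qed

text \<open>Write t^s as t times t^(s - 1) and approximate the second factor by resolvents. Since t
  c / (t + k) = c - c k / (t + k), the negative of the product is a constant plus a nonnegative
  combination of resolvents.\<close>

lemma jensen_antitone_uminus_powr:
  assumes "0 \<le> s" "s < 1"
  shows "jensen_antitone TYPE('k::complex_hilbert_space) (\<lambda>t. - (t powr s))"
proof (rule jensen_antitone_limit)
  show "continuous_on {0<..} (\<lambda>t. - (t powr s))" by (auto intro!: continuous_intros)
  fix m M e :: real assume m: "0 < m" and e: "0 < e"
  consider "s = 0" | "0 < s" using assms by linarith
  then show "\<exists>\<phi>. jensen_antitone TYPE('k) \<phi> \<and> (\<forall>t\<in>{m..M}. \<bar>- (t powr s) - \<phi> t\<bar> \<le> e)"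
  proof cases
    case 1
    then show ?thesis using m e jensen_antitone_const[of "- 1"] by (intro exI[of _ "\<lambda>_. - 1"]) auto
  next
    case 2
    \<comment> \<open>The error of the approximation gets multiplied by \<open>t\<close>, which is
      at most \<open>M\<close>.\<close>
    define e' where "e' = e / (\<bar>M\<bar> + 1)"
    have e': "0 < e'" using e by (simp add: e'_def add_nonneg_pos)
    obtain n c k d l where pos: "\<forall>i. 0 \<le> c i \<and> 0 < k i \<and> 0 \<le> d i \<and> 0 < l i"
      and near: "\<forall>t\<in>{m..M}. \<bar>t powr - (1 - s) - (\<Sum>i<(n::nat). c i / (t + k i) + d i / (t + l i))\<bar> \<le> e'"
    proof -
      have "0 < 1 - s" "1 - s < 1" using 2 assms by auto
      from powr_resolvent_approximation[OF this m e', of M] show ?thesis using that by blast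
    qed
    define \<phi> where "\<phi> t = (\<Sum>i<n. (- (c i + d i) + (c i * k i) * (1 / (t + k i))) + (d i * l i) * (1 / (t + l i)))" for t
    have "jensen_antitone TYPE('k) \<phi>"
      unfolding \<phi>_def using pos
      by (intro jensen_antitone_sum jensen_antitone_add_scale jensen_antitone_const
          jensen_antitone_resolvent) (auto intro: less_imp_le mult_nonneg_nonneg)
    moreover have "\<bar>- (t powr s) - \<phi> t\<bar> \<le> e" if t: "t \<in> {m..M}" for t
    proof -
      let ?g = "\<Sum>i<n. c i / (t + k i) + d i / (t + l i)"
      have t0: "0 < t" "t \<le> M" using t m by auto
      have ne: "t + k i \<noteq> 0" "t + l i \<noteq> 0" for i using pos t0 by (metis add_pos_pos less_irrefl)+
      have "\<phi> t = - t * ?g"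
        unfolding \<phi>_def sum_distrib_left
      proof (rule sum.cong[OF refl])
        fix i
        have "c i * k i * (1 / (t + k i)) - c i = - t * (c i / (t + k i))"
          "d i * l i * (1 / (t + l i)) - d i = - t * (d i / (t + l i))"
          using ne[of i] by (simp_all add: field_simps)
        then show "- (c i + d i) + c i * k i * (1 / (t + k i)) + d i * l i * (1 / (t + l i)) =
            - t * (c i / (t + k i) + d i / (t + l i))" by (simp add: distrib_left)
      qed
      moreover have "t powr s = t * t powr - (1 - s)"
        using t0 powr_mult_base[of t "s - 1"] by simp
      ultimately have "- (t powr s) - \<phi> t = - t * (t powr - (1 - s) - ?g)" by (simp add: right_diff_distrib)
      then have "\<bar>- (t powr s) - \<phi> t\<bar> = t * \<bar>t powr - (1 - s) - ?g\<bar>" using t0 by (simp add: abs_mult)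
      also have "\<dots> \<le> (\<bar>M\<bar> + 1) * e'" using near t t0 by (intro mult_mono) auto
      also have "\<dots> = e" by (simp add: e'_def add_nonneg_pos)
      finally show ?thesis .
    qed
    ultimately show ?thesis by blast
  qed
qed


section \<open>Operator convex functions satisfy Jensen's inequality\<close>

lemma cinner_sum_scaleC_left:
  "cinner (\<Sum>i\<in>I. c i *\<^sub>C e i) y = (\<Sum>i\<in>I. c i * cinner (e i) y)"
  by (simp add: cinner.sum_left cinner_scaleC_left)

lemma cinner_sum_scaleC_right:
  "cinner y (\<Sum>i\<in>I. c i *\<^sub>C e i) = (\<Sum>i\<in>I. cnj (c i) * cinner y (e i))"
  by (simp add: cinner.sum_right cinner_scaleC_right)

text \<open>Dependent vectors are allowed: they contribute the vector \<open>0\<close> to the orthonormal system.\<close>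

lemma orthonormalisation:
  fixes u :: "nat \<Rightarrow> 'a::complex_hilbert_space"
  shows "\<exists>e. (\<forall>a<n. \<forall>b<n. cinner (e a) (e b) = (if a = b \<and> e a \<noteq> 0 then 1 else 0)) \<and>
    (\<forall>a<n. u a = (\<Sum>b<n. cinner (u a) (e b) *\<^sub>C e b))"
proof (induction n)
  case (Suc n)
  then obtain e where
    on: "\<And>a b. a < n \<Longrightarrow> b < n \<Longrightarrow> cinner (e a) (e b) = (if a = b \<and> e a \<noteq> 0 then 1 else 0)"
    and ex: "\<And>a. a < n \<Longrightarrow> u a = (\<Sum>b<n. cinner (u a) (e b) *\<^sub>C e b)" by blast
  define s where "s = (\<Sum>b<n. cinner (u n) (e b) *\<^sub>C e b)"
  define w where "w = u n - s"
  have sa: "cinner s (e a) = cinner (u n) (e a)" if a: "a < n" for a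
  proof -
    have "cinner s (e a) = (\<Sum>b<n. cinner (u n) (e b) * cinner (e b) (e a))"
      by (simp add: s_def cinner_sum_scaleC_left)
    also have "\<dots> = (\<Sum>b<n. if b = a then cinner (u n) (e a) else 0)"
      by (intro sum.cong refl) (auto simp: on a cinner.zero_right)
    finally show ?thesis using a by simp
  qed
  have we: "cinner w (e a) = 0" if "a < n" for a using sa[OF that] by (simp add: w_def cinner.diff_left)
  then have ew: "cinner (e a) w = 0" if "a < n" for a using that by (subst cinner_commute) simp
  have uw: "cinner (u a) w = 0" if "a < n" for a
    by (subst ex[OF that]) (simp add: cinner_sum_scaleC_left ew)
  have "cinner s w = 0" by (simp add: s_def cinner_sum_scaleC_left ew)
  then have unw: "cinner (u n) w = complex_of_real ((norm w)\<^sup>2)"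
    using cinner_same[of w] by (simp add: w_def cinner.diff_left)
  \<comment> \<open>If \<open>w = 0\<close>, division by zero makes \<open>g = 0\<close>, the null
    vector that the statement tolerates.\<close>
  define g where "g = (1 / norm w) *\<^sub>R w"
  have gg: "cinner g g = (if g \<noteq> 0 then 1 else 0)"
    by (auto simp: g_def cinner.scaleR_left cinner.scaleR_right cinner_same power2_eq_square
        scaleR_conv_of_real cinner.zero_left)
  have eg: "cinner (e a) g = 0" "cinner g (e a) = 0" if "a < n" for a
    using ew[OF that] we[OF that] by (simp_all add: g_def cinner.scaleR_right cinner.scaleR_left)
  have ug: "cinner (u n) g *\<^sub>C g = w"
  proof (cases "w = 0")
    case False
    then have "cinner (u n) g = complex_of_real (norm w)"
      by (simp add: g_def cinner.scaleR_right unw scaleR_conv_of_real power2_eq_square)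
    then show ?thesis using False by (simp add: scaleC_of_real g_def)
  qed (simp add: g_def cinner.zero_right)
  have zero: "0 *\<^sub>C x = 0" for x :: 'a using scaleC_of_real[of 0 x] by simp
  define e' where "e' = e(n := g)"
  have "cinner (e' a) (e' b) = (if a = b \<and> e' a \<noteq> 0 then 1 else 0)" if "a < Suc n" "b < Suc n" for a b
    using that on gg eg by (auto simp: e'_def less_Suc_eq cinner.zero_right)
  moreover have "u a = (\<Sum>b<Suc n. cinner (u a) (e' b) *\<^sub>C e' b)" if "a < Suc n" for a
  proof -
    have eq: "(\<Sum>b<Suc n. cinner (u a) (e' b) *\<^sub>C e' b) =
        (\<Sum>b<n. cinner (u a) (e b) *\<^sub>C e b) + cinner (u a) g *\<^sub>C g" by (simp add: e'_def)
    show ?thesis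
    proof (cases "a = n")
      case True
      then show ?thesis unfolding eq using ug by (simp add: s_def[symmetric] w_def)
    next
      case False
      then have a: "a < n" using that by simp
      have "cinner (u a) g = 0" using uw[OF a] by (simp add: g_def cinner.scaleR_right)
      then show ?thesis unfolding eq using ex[OF a] by (simp add: zero)
    qed
  qed
  ultimately show ?case by blast
qed simp

section \<open>Coordinate projections of the sequence space and finite dilations\<close>

lift_definition restrict_ell2 :: "nat set \<Rightarrow> ell2 \<Rightarrow> ell2" is "\<lambda>S x j. if j \<in> S then x j else 0"
proof -
  fix S and x :: "nat \<Rightarrow> complex" assume "summable (\<lambda>n. (cmod (x n))\<^sup>2)"
  then show "summable (\<lambda>n. (cmod (if n \<in> S then x n else 0))\<^sup>2)"
    by (rule summable_comparison_test'[of _ 0]) auto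
qed

lift_definition basis_ell2 :: "nat \<Rightarrow> ell2" is "\<lambda>k j. if j = k then 1 else 0"
proof -
  fix k :: nat
  show "summable (\<lambda>n. (cmod (if n = k then 1 else 0))\<^sup>2)"
    by (rule summable_finite[of "{k}"]) auto
qed

lemma cinner_restrict_ell2: "cinner (restrict_ell2 S x) y = cinner x (restrict_ell2 S y)"
  unfolding cinner_ell2_def cinner_ell2_aux_def restrict_ell2.rep_eq
  by (intro arg_cong[where f = suminf]) auto

lemma cinner_basis_ell2: "cinner (basis_ell2 j) (basis_ell2 k) = (if j = k then 1 else 0)"
proof -
  have "cinner (basis_ell2 j) (basis_ell2 k) =
      (\<Sum>n\<in>{j}. (if n = j then 1 else 0) * cnj (if n = k then 1 else 0))"
    unfolding cinner_ell2_def cinner_ell2_aux_def basis_ell2.rep_eq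
    by (rule suminf_finite) auto
  then show ?thesis by simp
qed

lemma restrict_ell2_restrict: "restrict_ell2 S (restrict_ell2 S' x) = restrict_ell2 (S \<inter> S') x"
  by (rule ell2_eqI) (simp add: restrict_ell2.rep_eq)

lemma restrict_basis_ell2: "restrict_ell2 S (basis_ell2 j) = (if j \<in> S then basis_ell2 j else 0)"
  by (rule ell2_eqI) (simp add: restrict_ell2.rep_eq basis_ell2.rep_eq)

definition ell2_proj :: "nat set \<Rightarrow> ell2 \<Rightarrow>\<^sub>L ell2" where
  "ell2_proj S = Blinfun (restrict_ell2 S)"

lemma ell2_proj_apply: "blinfun_apply (ell2_proj S) = restrict_ell2 S"
  unfolding ell2_proj_def
proof (rule bounded_linear_Blinfun_apply, rule bounded_linear_intro[where K = 1])
  fix x y :: ell2 and r :: real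
  show "restrict_ell2 S (x + y) = restrict_ell2 S x + restrict_ell2 S y"
    "restrict_ell2 S (r *\<^sub>R x) = r *\<^sub>R restrict_ell2 S x"
    by (rule ell2_eqI, simp add: restrict_ell2.rep_eq)+
  have "(norm (restrict_ell2 S x))\<^sup>2 = inner x (restrict_ell2 S x)"
    by (simp add: power2_norm_eq_inner Re_cinner[symmetric] cinner_restrict_ell2 restrict_ell2_restrict)
  also have "\<dots> \<le> norm x * norm (restrict_ell2 S x)" by (rule norm_cauchy_schwarz)
  finally show "norm (restrict_ell2 S x) \<le> norm x * 1"
    by (cases "norm (restrict_ell2 S x) = 0") (simp_all add: power2_eq_square)
qed

lemma ell2_proj_bop: "ell2_proj S \<in> bop"
  by (auto intro!: ell2_eqI simp: bop_def ell2_proj_apply restrict_ell2.rep_eq scaleC_ell2.rep_eq)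

lemma ell2_proj_basis:
  "ell2_proj S (c *\<^sub>C basis_ell2 j) = (if j \<in> S then c *\<^sub>C basis_ell2 j else 0)"
  unfolding bopD[OF ell2_proj_bop] by (simp add: ell2_proj_apply restrict_basis_ell2)

lemma positive_op_ell2_proj: "positive_op (ell2_proj S)"
proof -
  have "inner (restrict_ell2 S x) x = (norm (restrict_ell2 S x))\<^sup>2" for x
    using cinner_restrict_ell2[of S "restrict_ell2 S x" x]
    by (simp add: power2_norm_eq_inner Re_cinner[symmetric] restrict_ell2_restrict)
  then show ?thesis
    by (auto simp: positive_op_iff ell2_proj_apply cinner_restrict_ell2 intro!: selfadjointI ell2_proj_bop)
qed

lemma ell2_nth_sum: "ell2_nth (\<Sum>i\<in>I. x i) j = (\<Sum>i\<in>I. ell2_nth (x i) j)"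
  by (induction I rule: infinite_finite_induct) auto

text \<open>
  Naimark dilation of a finite family of positive operators with sum \<open>1\<close>, restricted to the span of
  finitely many vectors, so that the dilation space may be taken to be \<open>\<ell>\<^sup>2\<close>.
\<close>

lemma Naimark_ell2:
  fixes C :: "nat \<Rightarrow> 'k::complex_hilbert_space \<Rightarrow>\<^sub>L 'k" and e :: "nat \<Rightarrow> 'k"
  assumes C: "\<And>i. i < n \<Longrightarrow> positive_op (C i)" and n: "0 < n"
  shows "\<exists>P w. (\<Sum>i<n. ell2_proj (P i)) = id_blinfun \<and> (\<forall>i j. i \<noteq> j \<longrightarrow> P i \<inter> P j = {}) \<and>
    (\<forall>i<n. \<forall>a<d. \<forall>b<d. cinner (ell2_proj (P i) (w a)) (w b) = cinner (C i (e a)) (e b))"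
proof -
  \<comment> \<open>The square root of \<open>C i\<close> applied to \<open>e a\<close>: for fixed
    \<open>i\<close> these vectors have the required Gram matrix, and placing different
    \<open>i\<close> in orthogonal blocks gives the dilation.\<close>
  define u where "u i a = cfc sqrt (C i) (e a)" for i a
  have uu: "cinner (u i a) (u i b) = cinner (C i (e a)) (e b)" if "i < n" for i a b
  proof -
    have bt: "op_between 0 (norm (C i)) (C i)"
      using C[OF that] op_between_norm[of "C i"] by (auto simp: op_between_def positive_op_iff)
    have c: "continuous_on {0..norm (C i)} sqrt" by (intro continuous_intros)
    have "C i = cfc (\<lambda>t. sqrt t * sqrt t) (C i)"
      using cfc_cong[OF bt continuous_on_id, of "\<lambda>t. sqrt t * sqrt t"] cfc_id[OF bt] by simp
    also have "\<dots> = cfc sqrt (C i) o\<^sub>L cfc sqrt (C i)" by (rule cfc_mult[OF bt c c])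
    finally have "C i (e a) = cfc sqrt (C i) (cfc sqrt (C i) (e a))"
      by (metis blinfun_apply_blinfun_compose)
    then show ?thesis by (simp add: u_def selfadjointD[OF cfc_selfadjoint[OF bt c]])
  qed
  have "finite (prod_encode ` ({..<n} \<times> {..<d}))" by simp
  then obtain N where N: "\<And>i a. i < n \<Longrightarrow> a < d \<Longrightarrow> prod_encode (i, a) < N"
    by (auto simp: finite_nat_set_iff_bounded)
  obtain h where hh: "\<And>a b. a < N \<Longrightarrow> b < N \<Longrightarrow> cinner (h a) (h b) = (if a = b \<and> h a \<noteq> 0 then 1 else 0)"
    and ex: "\<And>k. k < N \<Longrightarrow> case_prod u (prod_decode k) = (\<Sum>b<N. cinner (case_prod u (prod_decode k)) (h b) *\<^sub>C h b)"
    using orthonormalisation[of N "\<lambda>k. case_prod u (prod_decode k)"] by blast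
  have uex: "u i a = (\<Sum>b<N. cinner (u i a) (h b) *\<^sub>C h b)" if "i < n" "a < d" for i a
    using ex[OF N[OF that]] by simp
  \<comment> \<open>Block \<open>i\<close> of the sequence space consists of the indices
    \<open>prod_encode (i, b)\<close>; it receives the coordinates of \<open>u i a\<close> in the
    finite orthonormal system \<open>h\<close>.\<close>
  define v where "v i a = (\<Sum>b<N. cinner (u i a) (h b) *\<^sub>C basis_ell2 (prod_encode (i, b)))" for i a
  \<comment> \<open>Indices outside the first \<open>n\<close> blocks are assigned to block 0, so
    that the projections sum to the identity of the whole space. The vectors \<open>v i a\<close>
    with \<open>i < n\<close> vanish at those indices.\<close>
  define \<kappa> where "\<kappa> j = (if fst (prod_decode j) < n then fst (prod_decode j) else 0)" for j
  define P where "P i = {j. \<kappa> j = i}" for i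
  define w where "w a = (\<Sum>i<n. v i a)" for a
  have vv: "cinner (v i a) (v k b) = (if i = k then cinner (u i a) (u i b) else 0)"
    if "i < n" "k < n" "a < d" "b < d" for i k a b
  proof -
    have "cinner (v i a) (v k b) =
        (\<Sum>b'<N. \<Sum>c<N. cinner (u i a) (h c) * (cnj (cinner (u k b) (h b')) * (if (i, c) = (k, b') then 1 else 0)))"
      by (simp add: v_def cinner_sum_scaleC_left cinner_sum_scaleC_right cinner_basis_ell2
          sum_distrib_left mult.left_commute)
    also have "\<dots> = (if i = k then \<Sum>c<N. cinner (u i a) (h c) * cnj (cinner (u i b) (h c)) else 0)"
      by (auto simp: if_distrib[of "\<lambda>x. _ * x"] cong: if_cong)
    also have "(\<Sum>c<N. cinner (u i a) (h c) * cnj (cinner (u i b) (h c))) = cinner (u i a) (u i b)"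
      by (subst (2) uex[OF that(1,4)]) (simp add: cinner_sum_scaleC_right mult.commute)
    finally show ?thesis .
  qed
  have Pv: "ell2_proj (P k) (v i a) = (if i = k then v i a else 0)" if "i < n" for i k a
    unfolding v_def blinfun.sum_right
    by (auto simp: ell2_proj_basis P_def \<kappa>_def that)
  have Pw: "ell2_proj (P k) (w a) = v k a" if "k < n" for k a
    unfolding w_def blinfun.sum_right using that by (simp add: Pv)
  have "cinner (ell2_proj (P i) (w a)) (w b) = cinner (C i (e a)) (e b)" if "i < n" "a < d" "b < d" for i a b
  proof -
    have "cinner (ell2_proj (P i) (w a)) (w b) = cinner (v i a) (w b)"
      by (simp only: Pw[OF that(1)])
    also have "\<dots> = (\<Sum>k<n. if i = k then cinner (u i a) (u i b) else 0)"
      unfolding w_def cinner.sum_right using that by (intro sum.cong) (auto simp: vv)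
    finally have "cinner (ell2_proj (P i) (w a)) (w b) =
        (\<Sum>k<n. if i = k then cinner (u i a) (u i b) else 0)" .
    then show ?thesis using that by (simp add: uu)
  qed
  moreover have "(\<Sum>i<n. ell2_proj (P i)) = id_blinfun"
  proof (rule blinfun_eqI, rule ell2_eqI)
    fix x j
    have "\<kappa> j < n" using n by (simp add: \<kappa>_def)
    then show "ell2_nth ((\<Sum>i<n. ell2_proj (P i)) x) j = ell2_nth (id_blinfun x) j"
      by (simp add: blinfun.sum_left ell2_nth_sum ell2_proj_apply restrict_ell2.rep_eq P_def)
  qed
  moreover have "\<forall>i j. i \<noteq> j \<longrightarrow> P i \<inter> P j = {}" by (auto simp: P_def)
  ultimately show ?thesis by (intro exI[of _ P] exI[of _ w]) blast
qed

text \<open>Projections onto disjoint coordinate sets multiply to 0, so a polynomial acts on each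
  summand separately, and so does a limit of polynomials.\<close>

lemma cfc_sum_ell2_proj:
  fixes t :: "nat \<Rightarrow> real"
  assumes one: "(\<Sum>i<n. ell2_proj (P i)) = id_blinfun"
    and disj: "\<forall>i j. i \<noteq> j \<longrightarrow> P i \<inter> P j = {}"
    and t: "\<And>i. i < n \<Longrightarrow> m \<le> t i \<and> t i \<le> M" and f: "continuous_on {m..M} f"
  shows "cfc f (\<Sum>i<n. t i *\<^sub>R ell2_proj (P i)) = (\<Sum>i<n. f (t i) *\<^sub>R ell2_proj (P i))"
proof -
  let ?B = "\<Sum>i<n. t i *\<^sub>R ell2_proj (P i)"
  have prod: "ell2_proj (P i) o\<^sub>L ell2_proj (P j) = (if i = j then ell2_proj (P i) else 0)" for i j
    using disj
    by (auto intro!: blinfun_eqI ell2_eqI simp: ell2_proj_apply restrict_ell2_restrict restrict_ell2.rep_eq)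
  have poly: "poly_op p ?B = (\<Sum>i<n. poly p (t i) *\<^sub>R ell2_proj (P i))" for p
  proof (induction p)
    case (pCons c p)
    have "(ell2_proj (P i)) o\<^sub>L (\<Sum>j<n. poly p (t j) *\<^sub>R ell2_proj (P j)) = poly p (t i) *\<^sub>R ell2_proj (P i)"
      if "i < n" for i
      using that by (simp add: blinfun_compose.sum_right blinfun_compose.scaleR_right prod if_distrib[of "\<lambda>x. _ *\<^sub>R x"] cong: if_cong)
    then show ?case
      unfolding poly_op_pCons pCons.IH one[symmetric] blinfun_compose.sum_left
      by (simp add: blinfun_compose.scaleR_left scaleR_sum_right sum.distrib[symmetric] scaleR_add_left)
  qed simp
  have B: "op_between m M ?B" by (rule op_between_sum) (use one t positive_op_ell2_proj in auto)
  obtain p where p: "uniform_limit {m..M} (\<lambda>n. poly (p n)) f sequentially"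
    "(\<lambda>n. poly_op (p n) ?B) \<longlonglongrightarrow> cfc f ?B" using cfc_approximation[OF B f] .
  have "(\<lambda>k. poly_op (p k) ?B) \<longlonglongrightarrow> (\<Sum>i<n. f (t i) *\<^sub>R ell2_proj (P i))"
    unfolding poly
    by (intro tendsto_sum tendsto_scaleR tendsto_const tendsto_uniform_limitI[OF p(1)]) (use t in auto)
  then show ?thesis using p(2) LIMSEQ_unique by blast
qed

lemma op_between_convex:
  assumes "op_between a b A" "op_between a b B" "0 \<le> u" "u \<le> 1"
  shows "op_between a b (u *\<^sub>R A + (1 - u) *\<^sub>R B)"
  unfolding op_between_def
proof (intro conjI allI)
  show "selfadjoint (u *\<^sub>R A + (1 - u) *\<^sub>R B)"
    using assms by (intro selfadjoint_add selfadjoint_scaleR op_between_selfadjoint)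
  fix x
  have "u * (a * (norm x)\<^sup>2) \<le> u * inner (A x) x" "(1 - u) * (a * (norm x)\<^sup>2) \<le> (1 - u) * inner (B x) x"
    "u * inner (A x) x \<le> u * (b * (norm x)\<^sup>2)" "(1 - u) * inner (B x) x \<le> (1 - u) * (b * (norm x)\<^sup>2)"
    using assms by (auto simp: op_between_def intro!: mult_left_mono)
  moreover have "u * z + (1 - u) * z = z" for z :: real by (simp add: algebra_simps)
  ultimately show "a * (norm x)\<^sup>2 \<le> inner ((u *\<^sub>R A + (1 - u) *\<^sub>R B) x) x"
    "inner ((u *\<^sub>R A + (1 - u) *\<^sub>R B) x) x \<le> b * (norm x)\<^sup>2"
    by (simp_all add: blinfun.bilinear_simps inner_simps) (smt (verit))+
qed

lemma inner_cfc_poly_close: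
  assumes A: "op_between m M A" and f: "continuous_on {m..M} f" and e: "0 \<le> e"
    and p: "\<And>t. t \<in> {m..M} \<Longrightarrow> \<bar>f t - poly p t\<bar> \<le> e"
  shows "\<bar>inner (cfc f A x) x - inner (poly_op p A x) x\<bar> \<le> e * (norm x)\<^sup>2"
proof -
  have pc: "continuous_on {m..M} (poly p)" by (intro continuous_intros)
  have "norm (cfc f A - poly_op p A) \<le> e"
    using norm_cfc_diff_le[OF A f pc e p] cfc_poly[OF A] by simp
  then have "norm (cfc f A - poly_op p A) * (norm x)\<^sup>2 \<le> e * (norm x)\<^sup>2" by (rule mult_right_mono) simp
  then show ?thesis
    using inner_le_norm_op[of "cfc f A - poly_op p A" x] by (simp add: blinfun.diff_left inner_diff_left)
qed

lemma poly_op_apply_power: "poly_op p A x = (\<Sum>i\<le>degree p. coeff p i *\<^sub>R ((blinfun_apply A ^^ i) x))"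
proof -
  have "blinfun_apply (((o\<^sub>L) A ^^ i) id_blinfun) x = (blinfun_apply A ^^ i) x" for i
    by (induction i) auto
  then show ?thesis by (simp add: poly_op_def blinfun.sum_left blinfun.scaleR_left)
qed

lemma operator_convexD:
  fixes A B :: "ell2 \<Rightarrow>\<^sub>L ell2"
  assumes "operator_convex J f" "selfadjoint A" "selfadjoint B"
    "spectrum A \<subseteq> complex_of_real ` J" "spectrum B \<subseteq> complex_of_real ` J" "0 \<le> u" "u \<le> 1"
  shows "cfc f (u *\<^sub>R A + (1 - u) *\<^sub>R B) \<le>\<^sub>L u *\<^sub>R cfc f A + (1 - u) *\<^sub>R cfc f B"
proof -
  have "u \<in> {0..1}" using assms by simp
  with assms show ?thesis unfolding operator_convex_def by blast
qed

text \<open>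
  For \<open>T = \<Sum>\<^sub>i t\<^sub>i C\<^sub>i\<close>, compress a dilation \<open>B\<close> of \<open>T\<close> to the Krylov space of \<open>x\<close>: with \<open>S = 2 Q - 1\<close> for the
  projection \<open>Q\<close> onto that space, \<open>(B + S B S) / 2\<close> acts on it as \<open>T\<close> does, and convexity is applied
  to \<open>B\<close> and \<open>S B S\<close>. The Krylov space of dimension \<open>> deg p\<close> suffices to compute \<open>p(T) x\<close>.
\<close>

lemma operator_convex_discrete_jensen:
  assumes f: "operator_convex {0<..} f"
  shows "discrete_jensen TYPE('k::complex_hilbert_space) f"
  unfolding discrete_jensen_def
proof (intro allI impI)
  fix n x and t :: "nat \<Rightarrow> real" and C :: "nat \<Rightarrow> 'k \<Rightarrow>\<^sub>L 'k"
  assume Ct: "\<forall>i<n. positive_op (C i) \<and> 0 < t i" and one: "(\<Sum>i<n. C i) = id_blinfun"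
  define T where "T = (\<Sum>i<n. t i *\<^sub>R C i)"
  show "inner (cfc f T x) x \<le> (\<Sum>i<n. f (t i) * inner (C i x) x)"
  \<comment> \<open>For the empty family the identity is an empty sum, so the space is zero;
    otherwise \<open>m\<close> and \<open>M\<close> below exist.\<close>
  proof (cases "n = 0")
    case True
    then have "x = 0" using one by (metis blinfun.zero_left blinfun_apply_id_blinfun lessThan_0 sum.empty)
    then show ?thesis by simp
  next
    case False
    then have n: "0 < n" by simp
    define m where "m = Min (t ` {..<n})"
    define M where "M = Max (t ` {..<n})"
    have ne: "t ` {..<n} \<noteq> {}" "finite (t ` {..<n})" using n by auto
    have m: "0 < m" using Ct ne by (auto simp: m_def)
    have t: "m \<le> t i \<and> t i \<le> M" if "i < n" for i using that by (simp add: m_def M_def)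
    have C: "positive_op (C i)" if "i < n" for i using Ct that by simp
    have T: "op_between m M T" unfolding T_def by (rule op_between_sum) (use Ct one t in auto)
    have fc: "continuous_on {m..M} f"
      using f m by (auto simp: operator_convex_def intro: continuous_on_Icc_pos)
    have "inner (cfc f T x) x \<le> (\<Sum>i<n. f (t i) * inner (C i x) x) + 2 * \<epsilon> * (norm x)\<^sup>2" if \<epsilon>: "0 < \<epsilon>" for \<epsilon>
    proof -
      obtain p where p: "\<And>s. s \<in> {m..M} \<Longrightarrow> \<bar>f s - poly p s\<bar> \<le> \<epsilon>"
      proof -
        obtain q :: "nat \<Rightarrow> real poly" where "uniform_limit {m..M} (\<lambda>n. poly (q n)) f sequentially"
          using polynomial_approximation[OF fc] by blast
        from uniform_limitD[OF this \<epsilon>] obtain k where "\<forall>s\<in>{m..M}. dist (poly (q k) s) (f s) < \<epsilon>"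
          by (auto simp: eventually_sequentially)
        then have "\<bar>f s - poly (q k) s\<bar> \<le> \<epsilon>" if "s \<in> {m..M}" for s
          using that by (force simp: dist_real_def abs_minus_commute)
        then show ?thesis using that by blast
      qed
      define d where "d = Suc (degree p)"
      define y where "y k = (blinfun_apply T ^^ k) x" for k
      obtain e where ee: "\<And>a b. a < d \<Longrightarrow> b < d \<Longrightarrow> cinner (e a) (e b) = (if a = b \<and> e a \<noteq> 0 then 1 else 0)"
        and yex: "\<And>k. k < d \<Longrightarrow> y k = (\<Sum>b<d. cinner (y k) (e b) *\<^sub>C e b)"
        using orthonormalisation[of d y] by blast
      obtain P w where P: "(\<Sum>i<n. ell2_proj (P i)) = id_blinfun" "\<forall>i j. i \<noteq> j \<longrightarrow> P i \<inter> P j = {}"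
        and Pw': "\<forall>i<n. \<forall>a<d. \<forall>b<d. cinner (ell2_proj (P i) (w a)) (w b) = cinner (C i (e a)) (e b)"
        using Naimark_ell2[of n C d e, OF C n] by blast
      have Pw: "cinner (ell2_proj (P i) (w a)) (w b) = cinner (C i (e a)) (e b)"
        if "i < n" "a < d" "b < d" for i a b
        using Pw' that by blast
      \<comment> \<open>\<open>E z\<close> says that \<open>z\<close> lies in the span of the system
        \<open>e\<close>. \<open>W\<close> embeds this span isometrically into the sequence space;
        off the span it projects first.\<close>
      define E where "E z \<longleftrightarrow> z = (\<Sum>b<d. cinner z (e b) *\<^sub>C e b)" for z
      define W where "W z = (\<Sum>b<d. cinner z (e b) *\<^sub>C w b)" for z
      have PW: "cinner (ell2_proj (P i) (W z)) (W z') = cinner (C i z) z'" if "i < n" "E z" "E z'" for i z z'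
      proof -
        have Ci: "C i \<in> bop" using Ct that by (auto simp: positive_op_iff intro: selfadjoint_bop)
        have "cinner (ell2_proj (P i) (W z)) (W z') =
            (\<Sum>b<d. \<Sum>a<d. cnj (cinner z' (e b)) * (cinner z (e a) * cinner (C i (e a)) (e b)))"
          unfolding W_def using that
          by (simp add: blinfun.sum_right bopD[OF ell2_proj_bop] cinner_sum_scaleC_left
              cinner_sum_scaleC_right sum_distrib_left Pw)
        also have "\<dots> = cinner (C i (\<Sum>b<d. cinner z (e b) *\<^sub>C e b)) (\<Sum>b<d. cinner z' (e b) *\<^sub>C e b)"
          by (simp add: blinfun.sum_right bopD[OF Ci] cinner_sum_scaleC_left
              cinner_sum_scaleC_right sum_distrib_left)
        finally show ?thesis using that by (simp add: E_def)
      qed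
      have WW: "cinner (W z) (W z') = cinner z z'" if "E z" "E z'" for z z'
      proof -
        have "cinner ((\<Sum>i<n. ell2_proj (P i)) (W z)) (W z') = cinner ((\<Sum>i<n. C i) z) z'"
          unfolding blinfun.sum_left cinner.sum_left using that by (intro sum.cong) (auto simp: PW)
        then show ?thesis by (simp add: P one)
      qed
      have zero: "0 *\<^sub>C z = 0" for z :: "'b::complex_hilbert_space" using scaleC_of_real[of 0 z] by simp
      have oneC: "1 *\<^sub>C z = z" for z :: "'b::complex_hilbert_space" using scaleC_of_real[of 1 z] by simp
      \<comment> \<open>The system may contain null vectors, for which \<open>w a = 0\<close> has to
        be derived from \<open>e a = 0\<close>; the dilation identities summed over \<open>i\<close>
        give it.\<close>
      have Ee: "E (e a)" and We: "W (e a) = w a" if a: "a < d" for a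
      proof -
        have "(\<Sum>b<d. cinner (e a) (e b) *\<^sub>C e b) = (\<Sum>b<d. if b = a then e a else 0)"
          by (intro sum.cong refl) (auto simp: ee a zero oneC)
        then show E: "E (e a)" using a by (simp add: E_def)
        show "W (e a) = w a"
        proof (cases "e a = 0")
          case True
          then have "cinner (w a) (w a) = (\<Sum>i<n. cinner (ell2_proj (P i) (w a)) (w a))"
            using P(1) by (metis (no_types) blinfun_apply_id_blinfun blinfun.sum_left cinner.sum_left)
          also have "\<dots> = 0" using a True by (simp add: Pw cinner.zero_right)
          finally have "w a = 0" by (simp add: cinner_same)
          then show ?thesis using True by (simp add: W_def cinner.zero_left zero)
        next
          case False
          have "W (e a) = (\<Sum>b<d. if b = a then w a else 0)"
            unfolding W_def by (intro sum.cong refl) (auto simp: ee a zero oneC False)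
          then show ?thesis using a by simp
        qed
      qed
      have ww: "cinner (w a) (w b) = cinner (e a) (e b)" if "a < d" "b < d" for a b
        using WW[OF Ee Ee, of a b] We that by simp
      \<comment> \<open>The orthogonal projection onto the span of the \<open>w a\<close>, which are
        orthonormal up to null vectors by \<open>ww\<close>.\<close>
      define q where "q z = (\<Sum>a<d. cinner z (w a) *\<^sub>C w a)" for z
      have sC: "bounded_linear (\<lambda>c. c *\<^sub>C v)" for v :: ell2
        by (rule bounded_linear_intro[where K = "norm v"])
          (auto simp: scaleC_add_left norm_scaleC scaleR_conv_of_real scaleC_scaleC[symmetric] scaleC_of_real)
      have "bounded_linear q"
        unfolding q_def
        by (intro bounded_linear_sum bounded_linear_compose[OF sC] cinner.bounded_linear_left)
      then have q: "blinfun_apply (Blinfun q) = q" by (rule bounded_linear_Blinfun_apply)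
      define Q where "Q = Blinfun q"
      have Q: "Q z = (\<Sum>a<d. cinner z (w a) *\<^sub>C w a)" for z by (simp add: Q_def q q_def)
      have "linear ((*\<^sub>C) c :: ell2 \<Rightarrow> ell2)" for c
        by (rule linearI) (auto simp: scaleC_add_right scaleC_scaleR)
      then have sum_scaleC: "c *\<^sub>C (\<Sum>a<d. v a) = (\<Sum>a<d. c *\<^sub>C v a)" for c and v :: "nat \<Rightarrow> ell2"
        by (rule linear_sum)
      have Qbop: "Q \<in> bop"
        by (simp add: bop_def Q cinner_scaleC_left sum_scaleC scaleC_scaleC)
      have Qsa: "selfadjoint Q"
      proof (rule selfadjointI[OF Qbop])
        show "cinner (Q z) z' = cinner z (Q z')" for z z'
          unfolding Q cinner_sum_scaleC_left cinner_sum_scaleC_right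
          by (intro sum.cong refl) (subst (3) cinner_commute, simp add: mult.commute)
      qed
      have Qw: "Q (w a) = w a" if a: "a < d" for a
      proof -
        have "Q (w a) = W (e a)" unfolding Q W_def using a by (intro sum.cong) (auto simp: ww)
        then show ?thesis using We[OF a] by simp
      qed
      have QW: "Q (W z) = W z" for z
        by (simp add: W_def blinfun.sum_right bopD[OF Qbop] Qw)
      have QQ: "Q (Q z) = Q z" for z
        by (simp add: Q[of z] blinfun.sum_right bopD[OF Qbop] Qw)
      define S where "S = 2 *\<^sub>R Q - id_blinfun"
      have Ssa: "selfadjoint S" unfolding S_def by (intro selfadjoint_diff selfadjoint_scaleR selfadjoint_id Qsa)
      have Sbop: "S \<in> bop" using Ssa by (rule selfadjoint_bop)
      have SS: "S o\<^sub>L S = id_blinfun"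
        by (rule blinfun_eqI) (simp add: S_def blinfun.bilinear_simps QQ scaleR_2)
      have adjS: "adj S = S" using Ssa by (rule selfadjoint_adj)
      have SW: "S (W z) = W z" for z by (simp add: S_def blinfun.bilinear_simps QW scaleR_2)
      define B where "B = (\<Sum>i<n. t i *\<^sub>R ell2_proj (P i))"
      have B: "op_between m M B"
        unfolding B_def by (rule op_between_sum) (use P t positive_op_ell2_proj in auto)
      define B' where "B' = adj S o\<^sub>L B o\<^sub>L S"
      have B': "op_between m M B'"
        unfolding B'_def by (rule op_between_isometry[OF B Sbop]) (simp add: adjS SS)
      have fB': "cfc f B' = adj S o\<^sub>L cfc f B o\<^sub>L S"
        unfolding B'_def by (rule cfc_unitary[OF B fc Sbop]) (simp_all add: adjS SS)
      define R where "R = (1/2) *\<^sub>R B + (1 - 1/2) *\<^sub>R B'"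
      have R: "op_between m M R" unfolding R_def by (rule op_between_convex[OF B B']) auto
      have spec: "spectrum D \<subseteq> complex_of_real ` {0<..}" if "op_between m M D" for D :: "ell2 \<Rightarrow>\<^sub>L ell2"
        by (rule order_trans[OF spectrum_between[OF that] image_mono]) (use m in auto)
      have "cfc f R \<le>\<^sub>L (1/2) *\<^sub>R cfc f B + (1 - 1/2) *\<^sub>R cfc f B'"
        unfolding R_def
        by (rule operator_convexD[OF f]) (use B B' in \<open>auto simp: op_between_selfadjoint spec\<close>)
      \<comment> \<open>\<open>S\<close> fixes \<open>W x\<close>, so both summands on the right
        have the same quadratic form there, namely that of \<open>cfc f B\<close>.\<close>
      from loewner_leD[OF this, of "W x"]
      have "inner (cfc f R (W x)) (W x) \<le> inner (cfc f B (W x)) (W x)"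
        using selfadjoint_inner[OF Ssa]
        by (simp add: fB' adjS blinfun.bilinear_simps inner_simps SW)
      also have "\<dots> = (\<Sum>i<n. f (t i) * inner (C i x) x)"
      proof -
        have "E x" using yex[of 0] by (simp add: E_def y_def d_def)
        moreover have "cfc f B = (\<Sum>i<n. f (t i) *\<^sub>R ell2_proj (P i))"
          unfolding B_def by (rule cfc_sum_ell2_proj[OF P _ fc]) (rule t)
        ultimately show ?thesis
          by (auto simp: blinfun.sum_left blinfun.scaleR_left Re_cinner[symmetric] cinner.sum_left
              cinner.scaleR_left PW intro!: sum.cong)
      qed
      finally have main: "inner (cfc f R (W x)) (W x) \<le> (\<Sum>i<n. f (t i) * inner (C i x) x)" .
      \<comment> \<open>\<open>T z\<close> may leave the span; \<open>W\<close> then projects it, as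
        \<open>Q\<close> does on the dilation side.\<close>
      have QBW: "Q (B (W z)) = W (T z)" if "E z" for z
      proof -
        have "cinner (B (W z)) (w a) = cinner (T z) (e a)" if "a < d" for a
          unfolding B_def T_def blinfun.sum_left cinner.sum_left
          using PW[OF _ \<open>E z\<close> Ee[OF that]] We[OF that]
          by (intro sum.cong) (auto simp: blinfun.scaleR_left cinner.scaleR_left)
        then show ?thesis by (simp add: Q W_def)
      qed
      have RW: "R (W z) = W (T z)" if "E z" for z
      proof -
        have "R (W z) = (1/2) *\<^sub>R (B (W z) + S (B (W z)))"
          by (simp add: R_def B'_def adjS SW blinfun.bilinear_simps scaleR_add_right)
        also have "\<dots> = Q (B (W z))" by (simp add: S_def blinfun.bilinear_simps)
        finally show ?thesis using QBW[OF that] by simp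
      qed
      have Ey: "E (y k)" if "k < d" for k using yex[OF that] by (simp add: E_def)
      \<comment> \<open>Each step requires the preceding Krylov vector to lie in the span, which
        holds for indices below \<open>d\<close>. So \<open>R\<close> reproduces the powers of
        \<open>T\<close> up to \<open>degree p\<close>.\<close>
      have "(blinfun_apply R ^^ k) (W x) = W (y k)" if "k < d" for k
        using that
      proof (induction k)
        case (Suc k)
        then show ?case using RW[OF Ey[of k]] by (simp add: y_def)
      qed (simp add: y_def)
      then have "inner (poly_op p R (W x)) (W x) = (\<Sum>i\<le>degree p. coeff p i * inner (W (y i)) (W (y 0)))"
        by (simp add: poly_op_apply_power inner_sum_left d_def y_def)
      also have "\<dots> = (\<Sum>i\<le>degree p. coeff p i * inner (y i) (y 0))"
        by (intro sum.cong refl) (simp add: Re_cinner[symmetric] WW Ey d_def)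
      also have "\<dots> = inner (poly_op p T x) x"
        by (simp add: poly_op_apply_power inner_sum_left y_def)
      finally have "inner (poly_op p R (W x)) (W x) = inner (poly_op p T x) x" .
      moreover have "norm (W x) = norm x"
        using WW[OF Ey[of 0] Ey[of 0]] by (simp add: d_def y_def norm_eq_sqrt_inner Re_cinner[symmetric])
      \<comment> \<open>One error comes from replacing \<open>f\<close> by \<open>p\<close> at
        \<open>R\<close>, the other from going back at \<open>T\<close>.\<close>
      ultimately show ?thesis
        using inner_cfc_poly_close[OF R fc less_imp_le[OF \<epsilon>] p, of "W x"]
          inner_cfc_poly_close[OF T fc less_imp_le[OF \<epsilon>] p, of x] main by simp
    qed
    then show ?thesis by (rule le_of_le_add_eps)
  qed
qed


section \<open>Polar decomposition of invertible operators\<close>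

lemma invertible_op_bop: "invertible_op T \<Longrightarrow> T \<in> bop"
  by (simp add: invertible_op_def)

lemma invertible_op_compose:
  assumes "invertible_op S" "invertible_op T"
  shows "invertible_op (S o\<^sub>L T)"
proof -
  obtain S' where S: "S \<in> bop" "S' \<in> bop" "S' o\<^sub>L S = id_blinfun" "S o\<^sub>L S' = id_blinfun"
    using assms(1) by (auto simp: invertible_op_def)
  obtain T' where T: "T \<in> bop" "T' \<in> bop" "T' o\<^sub>L T = id_blinfun" "T o\<^sub>L T' = id_blinfun"
    using assms(2) by (auto simp: invertible_op_def)
  have ap: "S' (S x) = x" "S (S' x) = x" "T' (T x) = x" "T (T' x) = x" for x
    using S T by (metis blinfun_apply_blinfun_compose blinfun_apply_id_blinfun)+
  show ?thesis
    by (rule invertible_opI[where S = "T' o\<^sub>L S'"]) (auto intro!: bop_compose S T blinfun_eqI simp: ap)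
qed

lemma invertible_op_adj:
  assumes "invertible_op T"
  shows "invertible_op (adj T)"
proof -
  obtain T' where T: "T \<in> bop" "T' \<in> bop" "T' o\<^sub>L T = id_blinfun" "T o\<^sub>L T' = id_blinfun"
    using assms by (auto simp: invertible_op_def)
  have "adj id_blinfun = id_blinfun" by (rule selfadjoint_adj[OF selfadjoint_id])
  then show ?thesis
    using T by (intro invertible_opI[where S = "adj T'"]) (auto intro: adj_bop simp: adj_compose[symmetric])
qed

lemma positive_op_adj_compose:
  assumes "X \<in> bop"
  shows "positive_op (adj X o\<^sub>L X)"
proof -
  have "selfadjoint (adj X o\<^sub>L id_blinfun o\<^sub>L X)" by (rule selfadjoint_congruence[OF selfadjoint_id assms])
  moreover have "inner ((adj X o\<^sub>L id_blinfun o\<^sub>L X) x) x = inner (X x) (X x)" for x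
    using inner_congruence[OF assms, of id_blinfun x] by simp
  ultimately show ?thesis by (simp add: positive_op_iff)
qed

lemma adj_compose_between:
  assumes "invertible_op X"
  shows "\<exists>c d. 0 < c \<and> op_between c d (adj X o\<^sub>L X)"
  using positive_invertible_op_between[OF positive_op_adj_compose invertible_op_compose]
    assms invertible_op_adj invertible_op_bop by blast

lemma cfc_invertible:
  assumes A: "op_between a b A" and f: "continuous_on {a..b} f" and pos: "\<And>t. t \<in> {a..b} \<Longrightarrow> 0 < f t"
  shows "invertible_op (cfc f A)"
proof (rule invertible_opI[where S = "cfc (\<lambda>t. 1 / f t) A"])
  have c: "continuous_on {a..b} (\<lambda>t. 1 / f t)" using pos by (intro continuous_intros f) fastforce
  show "cfc f A \<in> bop" "cfc (\<lambda>t. 1 / f t) A \<in> bop" by (rule cfc_bop[OF A f] cfc_bop[OF A c])+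
  have "cfc f A o\<^sub>L cfc (\<lambda>t. 1 / f t) A = cfc (\<lambda>t. f t * (1 / f t)) A" by (rule cfc_mult[OF A f c, symmetric])
  also have "\<dots> = cfc (\<lambda>t. 1) A"
    by (rule cfc_cong[OF A continuous_on_mult[OF f c]]) (use pos in fastforce)
  finally show "cfc f A o\<^sub>L cfc (\<lambda>t. 1 / f t) A = id_blinfun" by (simp add: cfc_const[OF A])
  then show "cfc (\<lambda>t. 1 / f t) A o\<^sub>L cfc f A = id_blinfun" using cfc_commute[OF A f c] by simp
qed

lemma continuous_on_powr_Icc:
  assumes "continuous_on {a..b} f" "\<And>t. t \<in> {a..b} \<Longrightarrow> 0 < f t"
  shows "continuous_on {a..b} (\<lambda>t. f t powr s :: real)"
  by (intro continuous_on_powr assms continuous_on_const) (use assms(2) in fastforce)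

text \<open>\<open>U\<close> is \<open>Y\<close> times the inverse of its modulus, unitary because
  \<open>Y\<close> is invertible. Conjugation by \<open>U\<close> turns
  \<open>Y o\<^sub>L adj Y\<close> into \<open>adj Y o\<^sub>L Y\<close>, and the square root
  commutes with this conjugation.\<close>

lemma polar_decomposition_abs:
  assumes Y: "invertible_op Y"
  shows "\<exists>U\<in>bop. adj U o\<^sub>L U = id_blinfun \<and> U o\<^sub>L adj U = id_blinfun \<and>
    op_abs Y = adj U o\<^sub>L op_abs (adj Y) o\<^sub>L U"
proof -
  have Yb: "Y \<in> bop" using Y by (rule invertible_op_bop)
  define Z where "Z = adj Y o\<^sub>L Y"
  obtain c d where c: "0 < c" and Z: "op_between c d Z" using adj_compose_between[OF Y] Z_def by blast
  obtain c' d' where c': "0 < c'" and Z': "op_between c' d' (Y o\<^sub>L adj Y)"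
    using adj_compose_between[OF invertible_op_adj[OF Y]] by (auto simp: adj_adj[OF Yb])
  have hc: "continuous_on {c..d} (\<lambda>t. t powr (- 1 / 2))" "continuous_on {c'..d'} (\<lambda>t. t powr (1 / 2))"
    using c c' by (auto intro!: continuous_on_powr_Icc continuous_intros)
  define H where "H = cfc (\<lambda>t. t powr (- 1 / 2)) Z"
  have H: "selfadjoint H" unfolding H_def by (rule cfc_selfadjoint[OF Z hc(1)])
  have "H o\<^sub>L H = cfc (\<lambda>t. t powr (- 1 / 2) * t powr (- 1 / 2)) Z"
    unfolding H_def by (rule cfc_mult[OF Z hc(1) hc(1), symmetric])
  moreover have "Z = cfc (\<lambda>t. t) Z" by (rule cfc_id[OF Z, symmetric])
  ultimately have "(H o\<^sub>L H) o\<^sub>L Z = cfc (\<lambda>t. (t powr (- 1 / 2) * t powr (- 1 / 2)) * t) Z"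
    using cfc_mult[OF Z continuous_on_mult[OF hc(1) hc(1)] continuous_on_id] by metis
  also have "\<dots> = cfc (\<lambda>t. 1) Z"
    by (rule cfc_cong[OF Z])
      (use c in \<open>auto intro!: continuous_intros hc(1) simp: powr_add[symmetric] powr_minus field_simps\<close>)
  finally have HHZ: "(H o\<^sub>L H) o\<^sub>L Z = id_blinfun" by (simp add: cfc_const[OF Z])
  have HZ: "H o\<^sub>L Z = Z o\<^sub>L H"
    using cfc_commute[OF Z hc(1) continuous_on_id] by (simp add: cfc_id[OF Z] H_def)
  have ap: "H (H (adj Y (Y x))) = x" and HZx: "H (adj Y (Y x)) = adj Y (Y (H x))" for x
    using arg_cong[OF HHZ, of "\<lambda>T. blinfun_apply T x"] arg_cong[OF HZ, of "\<lambda>T. blinfun_apply T x"]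
    by (simp_all add: Z_def)
  define U where "U = Y o\<^sub>L H"
  have U: "U \<in> bop" unfolding U_def by (intro bop_compose Yb selfadjoint_bop[OF H])
  have adjU: "adj U = H o\<^sub>L adj Y"
    unfolding U_def by (simp add: adj_compose Yb selfadjoint_bop[OF H] selfadjoint_adj[OF H])
  have UU: "adj U o\<^sub>L U = id_blinfun"
    unfolding adjU by (rule blinfun_eqI) (simp add: U_def HZx[symmetric] ap)
  obtain Y' where Y': "\<And>x. Y (Y' x) = x"
    using Y unfolding invertible_op_def by (metis blinfun_apply_blinfun_compose blinfun_apply_id_blinfun)
  have "U (adj U (Y x)) = Y x" for x unfolding adjU by (simp add: U_def ap)
  then have "U (adj U x) = x" for x by (metis Y')
  then have UU': "U o\<^sub>L adj U = id_blinfun" by (intro blinfun_eqI) simp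
  have "adj U o\<^sub>L (Y o\<^sub>L adj Y) o\<^sub>L U = Z"
    unfolding adjU by (rule blinfun_eqI) (simp add: U_def HZx[symmetric] ap Z_def)
  then have "op_abs Y = cfc (\<lambda>t. t powr (1 / 2)) (adj U o\<^sub>L (Y o\<^sub>L adj Y) o\<^sub>L U)"
    by (simp add: op_abs_def op_powr_def Z_def)
  also have "\<dots> = adj U o\<^sub>L cfc (\<lambda>t. t powr (1 / 2)) (Y o\<^sub>L adj Y) o\<^sub>L U"
    by (rule cfc_unitary[OF Z' hc(2) U UU UU'])
  also have "cfc (\<lambda>t. t powr (1 / 2)) (Y o\<^sub>L adj Y) = op_abs (adj Y)"
    by (simp add: op_abs_def op_powr_def adj_adj[OF Yb])
  finally show ?thesis using U UU UU' by blast
qed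


section \<open>Powers and the Loewner order\<close>

lemma op_between_common:
  assumes "op_between m M A" "op_between m' M' B" "0 < m" "0 < m'"
  obtains c d where "0 < c" "op_between c d A" "op_between c d B"
  using assms op_between_mono[OF assms(1), of "min m m'" "max M M'"]
    op_between_mono[OF assms(2), of "min m m'" "max M M'"] that[of "min m m'" "max M M'"] by simp

text \<open>The Loewner-Heinz inequality, read off from the antitonicity of -t^s. It serves with
  exponent 1/2 for moduli and with exponent r in part (2).\<close>

lemma cfc_powr_mono:
  assumes AB: "A \<le>\<^sub>L B" and A: "op_between m M A" and B: "op_between m' M' B" and m: "0 < m" "0 < m'"
    and s: "0 \<le> s" "s < 1"
  shows "cfc (\<lambda>t. t powr s) A \<le>\<^sub>L cfc (\<lambda>t. t powr s) B"
proof -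
  obtain c d where c: "0 < c" and Ac: "op_between c d A" and Bc: "op_between c d B"
    using op_between_common[OF A B m] .
  have cont: "continuous_on {c..d} (\<lambda>t. t powr s)"
    using c by (intro continuous_on_powr_Icc continuous_intros) auto
  have "inner (cfc (\<lambda>t. - (t powr s)) B x) x \<le> inner (cfc (\<lambda>t. - (t powr s)) A x) x" for x
    by (rule jensen_antitoneD(3)[OF jensen_antitone_uminus_powr[OF s] c Ac Bc AB])
  then show ?thesis
    by (intro loewner_leI cfc_selfadjoint[OF Ac cont] cfc_selfadjoint[OF Bc cont])
      (simp add: cfc_minus[OF Ac cont] cfc_minus[OF Bc cont] blinfun.minus_left)
qed

text \<open>The exponent 1 is included for the case 2r = 1.\<close>

lemma cfc_powr_antimono:
  assumes AB: "A \<le>\<^sub>L B" and A: "op_between m M A" and B: "op_between m' M' B" and m: "0 < m" "0 < m'"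
    and s: "0 \<le> s" "s \<le> 1"
  shows "cfc (\<lambda>t. t powr - s) B \<le>\<^sub>L cfc (\<lambda>t. t powr - s) A"
proof -
  obtain c d where c: "0 < c" and Ac: "op_between c d A" and Bc: "op_between c d B"
    using op_between_common[OF A B m] .
  have cont: "continuous_on {c..d} (\<lambda>t. t powr - s)"
    using c by (intro continuous_on_powr_Icc continuous_intros) auto
  show ?thesis
    by (intro loewner_leI cfc_selfadjoint[OF Ac cont] cfc_selfadjoint[OF Bc cont]
        jensen_antitoneD(3)[OF jensen_antitone_powr_minus[OF s] c Ac Bc AB])
qed

lemma continuous_positive_bounds:
  assumes f: "continuous_on {a..b} f" and pos: "\<And>t. t \<in> {a..b} \<Longrightarrow> 0 < (f t :: real)"
  obtains c d where "0 < c" "\<And>t. t \<in> {a..b::real} \<Longrightarrow> c \<le> f t \<and> f t \<le> d"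
proof (cases "a \<le> b")
  case True
  then have ne: "{a..b} \<noteq> {}" by simp
  obtain u where u: "u \<in> {a..b}" "\<forall>t\<in>{a..b}. f u \<le> f t"
    using continuous_attains_inf[OF compact_Icc ne f] by blast
  obtain v where v: "v \<in> {a..b}" "\<forall>t\<in>{a..b}. f t \<le> f v"
    using continuous_attains_sup[OF compact_Icc ne f] by blast
  show ?thesis using that[of "f u" "f v"] pos u v by blast
next
  \<comment> \<open>An empty interval can occur when the space is zero; the bounds are then vacuous
    and any positive lower constant will do.\<close>
  case False
  then show ?thesis using that[of 1 0] by auto
qed

lemma cfc_powr_cfc:
  assumes A: "op_between a b A" and f: "continuous_on {a..b} f" and pos: "\<And>t. t \<in> {a..b} \<Longrightarrow> 0 < f t"
    and g: "\<And>t. t \<in> {a..b} \<Longrightarrow> f t powr s = g t"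
  shows "cfc (\<lambda>t. t powr s) (cfc f A) = cfc g A"
proof -
  obtain c d where c: "0 < c" and cd: "\<And>t. t \<in> {a..b} \<Longrightarrow> c \<le> f t \<and> f t \<le> d"
    using continuous_positive_bounds[OF f pos] by blast
  have "continuous_on {c..d} (\<lambda>t. t powr s)" using c by (intro continuous_on_powr_Icc continuous_intros) auto
  then have "cfc (\<lambda>t. t powr s) (cfc f A) = cfc (\<lambda>t. f t powr s) A"
    using cd by (intro cfc_compose[OF A f, of c d]) auto
  also have "\<dots> = cfc g A"
    by (rule cfc_cong[OF A continuous_on_powr_Icc[OF f pos] g])
  finally show ?thesis .
qed

text \<open>The square root is operator monotone while squaring is not, so all comparisons are made
  between squares and the root is taken last. Invertibility keeps the squares away from 0, as the
  results on powers require.\<close>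

lemma op_abs_mono:
  assumes X: "invertible_op X" and Y: "invertible_op Y" and le: "adj X o\<^sub>L X \<le>\<^sub>L adj Y o\<^sub>L Y"
  shows "op_abs X \<le>\<^sub>L op_abs Y"
proof -
  obtain c d c' d' where b: "0 < c" "op_between c d (adj X o\<^sub>L X)" "0 < c'" "op_between c' d' (adj Y o\<^sub>L Y)"
    using adj_compose_between[OF X] adj_compose_between[OF Y] by blast
  show ?thesis
    unfolding op_abs_def op_powr_def by (rule cfc_powr_mono[OF le b(2,4,1,3)]) auto
qed

lemma unitary_partial_isometry:
  assumes "U \<in> bop" "adj U o\<^sub>L U = id_blinfun"
  shows "partial_isometry U"
  using assms norm_isometry[OF assms] by (simp add: partial_isometry_def)

text \<open>
  With \<open>X = F\<^bsup>-r\<^esup> P\<^bsup>r\<^esup> G\<^bsup>-r\<^esup>\<close> and \<open>Y = f(P)\<^bsup>-r\<^esup> P\<^bsup>r\<^esup> G\<^bsup>-r\<^esup>\<close> the hypothesis on \<open>F\<close> compares \<open>|X|\<^sup>2\<close> with \<open>|Y|\<^sup>2\<close>,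
  the one on \<open>G\<close> compares \<open>|Y\<^sup>*|\<^sup>2\<close> with a function of \<open>P\<close>, and the partial isometry is the unitary \<open>U\<close>
  with \<open>|Y| = U\<^sup>* |Y\<^sup>*| U\<close>.
\<close>

lemma op_abs_triple_product:
  fixes P F G :: "'k::complex_hilbert_space \<Rightarrow>\<^sub>L 'k" and r :: real
  assumes P: "op_between m M P" and m: "0 < m"
    and F: "op_between c d F" "0 < c" and G: "op_between c' d' G" "0 < c'"
    and f: "continuous_on {m..M} f" "\<And>t. t \<in> {m..M} \<Longrightarrow> 0 < f t"
    and g: "continuous_on {m..M} g" "\<And>t. t \<in> {m..M} \<Longrightarrow> 0 < g t"
  defines "X \<equiv> F powr\<^sub>o (- r) o\<^sub>L P powr\<^sub>o r o\<^sub>L G powr\<^sub>o (- r)"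
    and "\<kappa> \<equiv> \<lambda>t. f t powr - r * t powr r * g t powr - r"
  shows "cfc (\<lambda>t. t powr - (2 * r)) F \<le>\<^sub>L cfc (\<lambda>t. t powr - (2 * r)) (cfc f P) \<Longrightarrow>
      cfc (\<lambda>t. t powr - (2 * r)) G \<le>\<^sub>L cfc (\<lambda>t. t powr - (2 * r)) (cfc g P) \<Longrightarrow>
      \<exists>V\<in>bop. partial_isometry V \<and> op_abs X \<le>\<^sub>L adj V o\<^sub>L cfc \<kappa> P o\<^sub>L V"
    and "cfc (\<lambda>t. t powr - (2 * r)) (cfc f P) \<le>\<^sub>L cfc (\<lambda>t. t powr - (2 * r)) F \<Longrightarrow>
      cfc (\<lambda>t. t powr - (2 * r)) (cfc g P) \<le>\<^sub>L cfc (\<lambda>t. t powr - (2 * r)) G \<Longrightarrow>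
      \<exists>V\<in>bop. partial_isometry V \<and> adj V o\<^sub>L cfc \<kappa> P o\<^sub>L V \<le>\<^sub>L op_abs X"
proof -
  have cP: "continuous_on {m..M} (\<lambda>t. t powr s)" "continuous_on {m..M} (\<lambda>t. f t powr s)"
    "continuous_on {m..M} (\<lambda>t. g t powr s)" for s
    using m f g by (auto intro!: continuous_on_powr_Icc continuous_intros)
  have cF: "continuous_on {c..d} (\<lambda>t. t powr s)" and cG: "continuous_on {c'..d'} (\<lambda>t. t powr s)" for s
    using F(2) G(2) by (auto intro!: continuous_on_powr_Icc continuous_intros)
  have cD: "continuous_on {m..M} (\<lambda>t. f t powr - r * t powr r)" by (intro continuous_on_mult cP)
  have c\<kappa>: "continuous_on {m..M} \<kappa>" unfolding \<kappa>_def by (intro continuous_on_mult cP)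
  have \<kappa>_pos: "0 < \<kappa> t" if "t \<in> {m..M}" for t using that m f(2)[OF that] g(2)[OF that] by (auto simp: \<kappa>_def)
  define F' where "F' = cfc (\<lambda>t. t powr - r) F"
  define G' where "G' = cfc (\<lambda>t. t powr - r) G"
  define R where "R = cfc (\<lambda>t. t powr r) P"
  define fP where "fP = cfc (\<lambda>t. f t powr - r) P"
  define D where "D = cfc (\<lambda>t. f t powr - r * t powr r) P"
  define Y where "Y = D o\<^sub>L G'"
  note defs = F'_def G'_def R_def fP_def D_def
  have sa: "selfadjoint F'" "selfadjoint G'" "selfadjoint R" "selfadjoint fP" "selfadjoint D"
    unfolding defs by (intro cfc_selfadjoint[OF F(1) cF] cfc_selfadjoint[OF G(1) cG]
        cfc_selfadjoint[OF P cP(1)] cfc_selfadjoint[OF P cP(2)] cfc_selfadjoint[OF P cD])+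
  note bop = sa[THEN selfadjoint_bop] and adj = sa[THEN selfadjoint_adj]
  have D_pos: "0 < f t powr - r * t powr r" if "t \<in> {m..M}" for t
    using that m f(2)[OF that] by auto
  have inv: "invertible_op F'" "invertible_op G'" "invertible_op R" "invertible_op D"
    unfolding defs using m F(2) G(2)
    by (intro cfc_invertible[OF F(1) cF] cfc_invertible[OF G(1) cG]
        cfc_invertible[OF P cP(1)] cfc_invertible[OF P cD D_pos]; auto)+
  have X: "X = F' o\<^sub>L R o\<^sub>L G'" by (simp add: X_def op_powr_def F'_def R_def G'_def)
  have D: "D = fP o\<^sub>L R" unfolding defs by (rule cfc_mult[OF P cP(2) cP(1)])
  have Xinv: "invertible_op X" unfolding X by (intro invertible_op_compose inv)
  have Yinv: "invertible_op Y" unfolding Y_def by (intro invertible_op_compose inv)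
  have sq: "cfc (\<lambda>t. t powr - r) T o\<^sub>L cfc (\<lambda>t. t powr - r) T = cfc (\<lambda>t. t powr - (2 * r)) T"
    if "op_between a b T" "0 < a" for T :: "'k \<Rightarrow>\<^sub>L 'k" and a b
  proof -
    have "continuous_on {a..b} (\<lambda>t. t powr - r)"
      using that by (intro continuous_on_powr_Icc continuous_intros) auto
    from cfc_mult[OF that(1) this this] show ?thesis by (simp add: powr_add[symmetric])
  qed
  obtain a b where a: "0 < a" "\<And>t. t \<in> {m..M} \<Longrightarrow> a \<le> f t \<and> f t \<le> b"
    using continuous_positive_bounds[OF f] by blast
  obtain a' b' where a': "0 < a'" "\<And>t. t \<in> {m..M} \<Longrightarrow> a' \<le> g t \<and> g t \<le> b'"
    using continuous_positive_bounds[OF g] by blast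
  have fPb: "op_between a b (cfc f P)" by (rule cfc_between[OF P f(1) a(2)])
  have gPb: "op_between a' b' (cfc g P)" by (rule cfc_between[OF P g(1) a'(2)])
  have fP: "fP o\<^sub>L fP = cfc (\<lambda>t. t powr - (2 * r)) (cfc f P)"
    using sq[OF fPb a(1)] cfc_powr_cfc[OF P f refl] by (simp add: fP_def)
  have gP: "cfc (\<lambda>t. g t powr - r) P o\<^sub>L cfc (\<lambda>t. g t powr - r) P = cfc (\<lambda>t. t powr - (2 * r)) (cfc g P)"
    using sq[OF gPb a'(1)] cfc_powr_cfc[OF P g refl] by simp
  \<comment> \<open>The right factor common to \<open>X\<close> and \<open>Y\<close>; the squares of
    their moduli are congruences by \<open>Z\<close> of powers of \<open>F\<close> and of
    \<open>cfc f P\<close>.\<close>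
  define Z where "Z = R o\<^sub>L G'"
  have Zb: "Z \<in> bop" unfolding Z_def by (intro bop_compose bop)
  have adjZ: "adj Z = G' o\<^sub>L R" by (simp add: Z_def adj_compose bop adj)
  have XX: "adj X o\<^sub>L X = adj Z o\<^sub>L cfc (\<lambda>t. t powr - (2 * r)) F o\<^sub>L Z"
    unfolding sq[OF F, symmetric]
    by (simp add: X adj_compose bop_compose bop adj adjZ Z_def blinfun_compose_assoc flip: F'_def)
  have YY: "adj Y o\<^sub>L Y = adj Z o\<^sub>L cfc (\<lambda>t. t powr - (2 * r)) (cfc f P) o\<^sub>L Z"
  proof -
    have "Y = fP o\<^sub>L R o\<^sub>L G'" by (simp add: Y_def D)
    then show ?thesis
      unfolding fP[symmetric]
      by (simp add: adj_compose bop_compose bop adj adjZ Z_def blinfun_compose_assoc)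
  qed
  \<comment> \<open>The adjoint moves the power of \<open>G\<close> to the middle. The double
    adjoint is kept in order to match \<open>op_abs (adj Y)\<close>.\<close>
  have Y'Y': "adj (adj Y) o\<^sub>L adj Y = adj D o\<^sub>L cfc (\<lambda>t. t powr - (2 * r)) G o\<^sub>L D"
    unfolding sq[OF G, symmetric]
    by (simp add: Y_def adj_adj adj_compose bop_compose bop adj blinfun_compose_assoc flip: G'_def)
  have \<kappa>D: "cfc \<kappa> P = D o\<^sub>L cfc (\<lambda>t. g t powr - r) P"
    unfolding \<kappa>_def D_def by (rule cfc_mult[OF P cD cP(3)])
  have sa\<kappa>: "selfadjoint (cfc \<kappa> P)" by (rule cfc_selfadjoint[OF P c\<kappa>])
  \<comment> \<open>Functions of \<open>P\<close> commute, so the power of \<open>cfc g P\<close>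
    can be brought between two factors \<open>D\<close>, where it is comparable with the power of
    \<open>G\<close>.\<close>
  have \<kappa>\<kappa>: "adj (cfc \<kappa> P) o\<^sub>L cfc \<kappa> P = adj D o\<^sub>L cfc (\<lambda>t. t powr - (2 * r)) (cfc g P) o\<^sub>L D"
  proof -
    have "cfc \<kappa> P = cfc (\<lambda>t. g t powr - r) P o\<^sub>L D"
      unfolding \<kappa>D D_def by (rule cfc_commute[OF P cD cP(3)])
    then have "cfc \<kappa> P o\<^sub>L cfc \<kappa> P =
        (D o\<^sub>L cfc (\<lambda>t. g t powr - r) P) o\<^sub>L (cfc (\<lambda>t. g t powr - r) P o\<^sub>L D)"
      using \<kappa>D by simp
    then show ?thesis
      unfolding gP[symmetric] selfadjoint_adj[OF sa\<kappa>] by (simp add: adj blinfun_compose_assoc)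
  qed
  have \<kappa>inv: "invertible_op (cfc \<kappa> P)" by (rule cfc_invertible[OF P c\<kappa> \<kappa>_pos])
  have abs\<kappa>: "op_abs (cfc \<kappa> P) = cfc \<kappa> P"
  proof -
    have pos2: "0 < \<kappa> t * \<kappa> t" if "t \<in> {m..M}" for t using \<kappa>_pos[OF that] by simp
    have "op_abs (cfc \<kappa> P) = cfc (\<lambda>t. t powr (1 / 2)) (cfc (\<lambda>t. \<kappa> t * \<kappa> t) P)"
      by (simp add: op_abs_def op_powr_def selfadjoint_adj[OF sa\<kappa>] cfc_mult[OF P c\<kappa> c\<kappa>])
    also have "\<dots> = cfc \<kappa> P"
      by (rule cfc_powr_cfc[OF P continuous_on_mult[OF c\<kappa> c\<kappa>] pos2])
        (use \<kappa>_pos in \<open>auto simp: powr_half_sqrt less_imp_le\<close>)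
    finally show ?thesis .
  qed
  obtain U where U: "U \<in> bop" "adj U o\<^sub>L U = id_blinfun" and absY: "op_abs Y = adj U o\<^sub>L op_abs (adj Y) o\<^sub>L U"
    using polar_decomposition_abs[OF Yinv] by blast
  have saT: "selfadjoint (cfc (\<lambda>t. t powr - (2 * r)) T)" if "op_between a b T" "0 < a" for T :: "'k \<Rightarrow>\<^sub>L 'k" and a b
    using that by (intro cfc_selfadjoint[OF that(1)] continuous_on_powr_Icc continuous_intros) auto
  have saabs: "selfadjoint (op_abs T)" if T: "invertible_op T" for T :: "'k \<Rightarrow>\<^sub>L 'k"
  proof -
    obtain a b where "0 < a" "op_between a b (adj T o\<^sub>L T)" using adj_compose_between[OF T] by blast
    then show ?thesis
      unfolding op_abs_def op_powr_def
      by (intro cfc_selfadjoint[of a b] continuous_on_powr_Icc continuous_intros) auto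
  qed
  note sas = saT[OF F] saT[OF G] saT[OF fPb a(1)] saT[OF gPb a'(1)]
  note abs_sa = saabs[OF invertible_op_adj[OF Yinv]] sa\<kappa>
  show "\<exists>V\<in>bop. partial_isometry V \<and> op_abs X \<le>\<^sub>L adj V o\<^sub>L cfc \<kappa> P o\<^sub>L V"
    if "cfc (\<lambda>t. t powr - (2 * r)) F \<le>\<^sub>L cfc (\<lambda>t. t powr - (2 * r)) (cfc f P)"
      "cfc (\<lambda>t. t powr - (2 * r)) G \<le>\<^sub>L cfc (\<lambda>t. t powr - (2 * r)) (cfc g P)"
  proof -
    have "op_abs X \<le>\<^sub>L op_abs Y"
      using loewner_le_congruence[OF that(1) sas(1,3) Zb] by (intro op_abs_mono Xinv Yinv) (simp add: XX YY)
    also have "op_abs (adj Y) \<le>\<^sub>L op_abs (cfc \<kappa> P)"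
      using loewner_le_congruence[OF that(2) sas(2,4) bop(5)]
      by (intro op_abs_mono invertible_op_adj Yinv \<kappa>inv) (simp only: Y'Y' \<kappa>\<kappa>)
    then have "op_abs Y \<le>\<^sub>L adj U o\<^sub>L cfc \<kappa> P o\<^sub>L U"
      unfolding absY abs\<kappa> by (rule loewner_le_congruence[OF _ abs_sa U(1)])
    finally show ?thesis using U unitary_partial_isometry by blast
  qed
  show "\<exists>V\<in>bop. partial_isometry V \<and> adj V o\<^sub>L cfc \<kappa> P o\<^sub>L V \<le>\<^sub>L op_abs X"
    if "cfc (\<lambda>t. t powr - (2 * r)) (cfc f P) \<le>\<^sub>L cfc (\<lambda>t. t powr - (2 * r)) F"
      "cfc (\<lambda>t. t powr - (2 * r)) (cfc g P) \<le>\<^sub>L cfc (\<lambda>t. t powr - (2 * r)) G"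
  proof -
    have "op_abs (cfc \<kappa> P) \<le>\<^sub>L op_abs (adj Y)"
      using loewner_le_congruence[OF that(2) sas(4,2) bop(5)]
      by (intro op_abs_mono invertible_op_adj Yinv \<kappa>inv) (simp only: Y'Y' \<kappa>\<kappa>)
    then have "adj U o\<^sub>L cfc \<kappa> P o\<^sub>L U \<le>\<^sub>L op_abs Y"
      unfolding absY abs\<kappa> by (rule loewner_le_congruence[OF _ abs_sa(2,1) U(1)])
    also have "op_abs Y \<le>\<^sub>L op_abs X"
      using loewner_le_congruence[OF that(1) sas(3,1) Zb] by (intro op_abs_mono Xinv Yinv) (simp add: XX YY)
    finally show ?thesis using U unitary_partial_isometry by blast
  qed
qed

section \<open>Concave form of Jensen's inequality and the final comparison\<close>

lemma Jensen_positive_map_concave: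
  fixes \<Phi> :: "('h::complex_hilbert_space \<Rightarrow>\<^sub>L 'h) \<Rightarrow> ('k::complex_hilbert_space \<Rightarrow>\<^sub>L 'k)"
  assumes \<Phi>: "linear_map_bop \<Phi>" "positive_map \<Phi>" "unital_map \<Phi>"
    and dj: "discrete_jensen TYPE('k) (\<lambda>t. - f t)" and cont: "continuous_on {0<..} f"
    and A: "op_between m M A" and m: "0 < m"
  shows "\<Phi> (cfc f A) \<le>\<^sub>L cfc f (\<Phi> A)"
proof -
  have f: "continuous_on {m..M} f" by (rule continuous_on_Icc_pos[OF cont m])
  have \<Phi>A: "op_between m M (\<Phi> A)" by (rule positive_map_between[OF \<Phi> A])
  have "cfc (\<lambda>t. - f t) (\<Phi> A) \<le>\<^sub>L \<Phi> (cfc (\<lambda>t. - f t) A)"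
    by (rule Jensen_positive_map[OF \<Phi> dj _ A m]) (intro continuous_intros cont)
  moreover have "\<Phi> (- cfc f A) = - \<Phi> (cfc f A)"
    using linear_map_bopD(3)[OF \<Phi>(1) cfc_bop[OF A f], of "- 1"] by simp
  ultimately show ?thesis
    by (simp add: loewner_le_def cfc_minus[OF A f] cfc_minus[OF \<Phi>A f])
qed

lemma operator_convex_continuous: "operator_convex J f \<Longrightarrow> continuous_on J f"
  by (simp add: operator_convex_def)

lemma operator_concave_continuous: "operator_concave J f \<Longrightarrow> continuous_on J f"
  using operator_convex_continuous[of J "\<lambda>t. - f t"] continuous_on_minus[of J "\<lambda>t. - f t"]
  by (simp add: operator_concave_def)

lemma operator_concave_discrete_jensen:
  "operator_concave {0<..} f \<Longrightarrow> discrete_jensen TYPE('k::complex_hilbert_space) (\<lambda>t. - f t)"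
  unfolding operator_concave_def by (rule operator_convex_discrete_jensen)

theorem theorem2p2:
  fixes \<Phi> :: "('h::complex_hilbert_space \<Rightarrow>\<^sub>L 'h) \<Rightarrow> ('k::complex_hilbert_space \<Rightarrow>\<^sub>L 'k)"
    and r :: real
  assumes "linear_map_bop \<Phi>" and "positive_map \<Phi>" and "unital_map \<Phi>"
    and "0 \<le> r" and "r \<le> 1/2"
  shows
    "(\<forall>f g :: real \<Rightarrow> real.
        (\<forall>t>0. f t > 0) \<and> (\<forall>t>0. g t > 0) \<and>
        operator_convex {0<..} f \<and> operator_convex {0<..} g \<and>
        operator_concave {0<..} (\<lambda>t. f t * g t / t) \<longrightarrow>
        (\<forall>A :: 'h \<Rightarrow>\<^sub>L 'h. positive_op A \<and> invertible_op A \<longrightarrow>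
          (\<exists>V :: 'k \<Rightarrow>\<^sub>L 'k. partial_isometry V \<and>
            op_abs (\<Phi> (cfc f A) powr\<^sub>o (-r) o\<^sub>L \<Phi> A powr\<^sub>o r o\<^sub>L \<Phi> (cfc g A) powr\<^sub>o (-r))
            \<le>\<^sub>L adj V o\<^sub>L \<Phi> (cfc f A powr\<^sub>o (-r) o\<^sub>L A powr\<^sub>o r o\<^sub>L cfc g A powr\<^sub>o (-r)) o\<^sub>L V)))
     \<and>
     (\<forall>f g :: real \<Rightarrow> real.
        (\<forall>t>0. f t > 0) \<and> (\<forall>t>0. g t > 0) \<and>
        operator_concave {0<..} f \<and> operator_concave {0<..} g \<and>
        operator_concave {0<..} (\<lambda>t. t / (f t * g t)) \<longrightarrow>
        (\<forall>A :: 'h \<Rightarrow>\<^sub>L 'h. positive_op A \<and> invertible_op A \<longrightarrow>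
          (\<exists>V :: 'k \<Rightarrow>\<^sub>L 'k. partial_isometry V \<and>
            adj V o\<^sub>L \<Phi> (cfc f A powr\<^sub>o (-r) o\<^sub>L A powr\<^sub>o r o\<^sub>L cfc g A powr\<^sub>o (-r)) o\<^sub>L V
            \<le>\<^sub>L op_abs (\<Phi> (cfc f A) powr\<^sub>o (-r) o\<^sub>L \<Phi> A powr\<^sub>o r o\<^sub>L \<Phi> (cfc g A) powr\<^sub>o (-r)))))"
proof -
  note \<Phi> = assms(1-3)
  have r: "0 \<le> 2 * r" "2 * r \<le> 1" "0 \<le> r" "r \<le> 1" "r < 1" using assms(4,5) by auto
  \<comment> \<open>All three factors are functions of \<open>A\<close>, so the operator under
    \<open>\<Phi>\<close> on the larger side of part (1) is a single function of
    \<open>A\<close>.\<close>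
  have product: "cfc f A powr\<^sub>o (- r) o\<^sub>L A powr\<^sub>o r o\<^sub>L cfc g A powr\<^sub>o (- r) =
      cfc (\<lambda>t. f t powr - r * t powr r * g t powr - r) A"
    if A: "op_between m M A" and m: "0 < m" and f: "continuous_on {m..M} f" "\<And>t. t \<in> {m..M} \<Longrightarrow> 0 < f t"
      and g: "continuous_on {m..M} g" "\<And>t. t \<in> {m..M} \<Longrightarrow> 0 < g t"
    for m M f g and A :: "'h \<Rightarrow>\<^sub>L 'h"
  proof -
    have c: "continuous_on {m..M} (\<lambda>t. f t powr - r)" "continuous_on {m..M} (\<lambda>t. g t powr - r)"
      "continuous_on {m..M} (\<lambda>t. t powr r)"
      using m f g by (auto intro!: continuous_on_powr_Icc continuous_intros)
    have "cfc (\<lambda>t. t powr - r) (cfc f A) = cfc (\<lambda>t. f t powr - r) A"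
      by (rule cfc_powr_cfc[OF A f refl])
    moreover have "cfc (\<lambda>t. t powr - r) (cfc g A) = cfc (\<lambda>t. g t powr - r) A"
      by (rule cfc_powr_cfc[OF A g refl])
    ultimately show ?thesis
      by (simp add: op_powr_def cfc_mult[OF A continuous_on_mult[OF c(1,3)] c(2)] cfc_mult[OF A c(1,3)])
  qed
  have one: "\<exists>V :: 'k \<Rightarrow>\<^sub>L 'k. partial_isometry V \<and>
        op_abs (\<Phi> (cfc f A) powr\<^sub>o (-r) o\<^sub>L \<Phi> A powr\<^sub>o r o\<^sub>L \<Phi> (cfc g A) powr\<^sub>o (-r))
        \<le>\<^sub>L adj V o\<^sub>L \<Phi> (cfc f A powr\<^sub>o (-r) o\<^sub>L A powr\<^sub>o r o\<^sub>L cfc g A powr\<^sub>o (-r)) o\<^sub>L V"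
    if pos: "\<forall>t>0. f t > 0" "\<forall>t>0. g t > 0"
      and convex: "operator_convex {0<..} f" "operator_convex {0<..} g"
      and concave: "operator_concave {0<..} (\<lambda>t. f t * g t / t)"
      and A0: "positive_op A" "invertible_op A" for f g and A :: "'h \<Rightarrow>\<^sub>L 'h"
  proof -
    define h where "h t = f t * g t / t" for t
    obtain m M where m: "0 < m" and A: "op_between m M A"
      using positive_invertible_op_between[OF A0] by blast
    have P: "op_between m M (\<Phi> A)" by (rule positive_map_between[OF \<Phi> A])
    have cont: "continuous_on {0<..} f" "continuous_on {0<..} g" "continuous_on {0<..} h"
      using operator_convex_continuous[OF convex(1)] operator_convex_continuous[OF convex(2)]
        operator_concave_continuous[OF concave] by (simp_all add: h_def[abs_def])
    note Icc = cont[THEN continuous_on_Icc_pos, OF m, of M]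
    have pos': "0 < f t" "0 < g t" "0 < h t" if "t \<in> {m..M}" for t
      using pos m that by (auto simp: h_def)
    obtain c d where c: "0 < c" "\<And>t. t \<in> {m..M} \<Longrightarrow> c \<le> f t \<and> f t \<le> d"
      using continuous_positive_bounds[OF Icc(1) pos'(1)] by blast
    obtain c' d' where c': "0 < c'" "\<And>t. t \<in> {m..M} \<Longrightarrow> c' \<le> g t \<and> g t \<le> d'"
      using continuous_positive_bounds[OF Icc(2) pos'(2)] by blast
    obtain a b where a: "0 < a" "\<And>t. t \<in> {m..M} \<Longrightarrow> a \<le> h t \<and> h t \<le> b"
      using continuous_positive_bounds[OF Icc(3) pos'(3)] by blast
    have F: "op_between c d (\<Phi> (cfc f A))" "op_between c d (cfc f (\<Phi> A))"
      by (rule positive_map_between[OF \<Phi> cfc_between[OF A Icc(1) c(2)]], assumption,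
          rule cfc_between[OF P Icc(1) c(2)])
    have G: "op_between c' d' (\<Phi> (cfc g A))" "op_between c' d' (cfc g (\<Phi> A))"
      by (rule positive_map_between[OF \<Phi> cfc_between[OF A Icc(2) c'(2)]], assumption,
          rule cfc_between[OF P Icc(2) c'(2)])
    have hA: "op_between a b (cfc h A)" by (rule cfc_between[OF A Icc(3) a(2)])
    have hP: "op_between a b (cfc h (\<Phi> A))" by (rule cfc_between[OF P Icc(3) a(2)])
    have \<Phi>hA: "op_between a b (\<Phi> (cfc h A))" by (rule positive_map_between[OF \<Phi> hA])
    define \<kappa> where "\<kappa> t = f t powr - r * t powr r * g t powr - r" for t
    \<comment> \<open>This identity lets the hypothesis on \<open>h\<close> act on the function
      \<open>\<kappa>\<close> that the triple product leaves.\<close>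
    have h\<kappa>: "h t powr - r = \<kappa> t" if "t \<in> {m..M}" for t
      using pos'[OF that] m that
      by (simp add: h_def \<kappa>_def powr_mult powr_divide powr_minus field_simps)
    have h\<kappa>A: "cfc (\<lambda>t. t powr - r) (cfc h A) = cfc \<kappa> A"
      by (rule cfc_powr_cfc[OF A Icc(3) pos'(3) h\<kappa>])
    have h\<kappa>P: "cfc (\<lambda>t. t powr - r) (cfc h (\<Phi> A)) = cfc \<kappa> (\<Phi> A)"
      by (rule cfc_powr_cfc[OF P Icc(3) pos'(3) h\<kappa>])
    have pw: "continuous_on {0<..} (\<lambda>t::real. t powr - r)" by (auto intro!: continuous_intros)
    have "\<Phi> (cfc h A) \<le>\<^sub>L cfc h (\<Phi> A)"
      by (rule Jensen_positive_map_concave[OF \<Phi> _ cont(3) A m])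
        (use operator_concave_discrete_jensen[OF concave] in \<open>simp add: h_def[abs_def]\<close>)
    then have "cfc (\<lambda>t. t powr - r) (cfc h (\<Phi> A)) \<le>\<^sub>L cfc (\<lambda>t. t powr - r) (\<Phi> (cfc h A))"
      by (rule cfc_powr_antimono[OF _ \<Phi>hA hP a(1) a(1) r(3,4)])
    also have "\<dots> \<le>\<^sub>L \<Phi> (cfc (\<lambda>t. t powr - r) (cfc h A))"
      by (rule Jensen_positive_map[OF \<Phi> jensen_antitoneD(2)[OF jensen_antitone_powr_minus[OF r(3,4)]] pw hA a(1)])
    finally have \<kappa>: "cfc \<kappa> (\<Phi> A) \<le>\<^sub>L \<Phi> (cfc \<kappa> A)"
      unfolding h\<kappa>A h\<kappa>P .
    have c\<kappa>: "continuous_on {m..M} \<kappa>"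
      unfolding \<kappa>_def[abs_def] using m pos'
      by (intro continuous_on_mult continuous_on_powr_Icc Icc continuous_on_id) auto
    have "cfc f (\<Phi> A) \<le>\<^sub>L \<Phi> (cfc f A)"
      by (rule Jensen_positive_map[OF \<Phi> operator_convex_discrete_jensen[OF convex(1)] cont(1) A m])
    then have 1: "cfc (\<lambda>t. t powr - (2 * r)) (\<Phi> (cfc f A)) \<le>\<^sub>L cfc (\<lambda>t. t powr - (2 * r)) (cfc f (\<Phi> A))"
      by (rule cfc_powr_antimono[OF _ F(2,1) c(1) c(1) r(1,2)])
    have "cfc g (\<Phi> A) \<le>\<^sub>L \<Phi> (cfc g A)"
      by (rule Jensen_positive_map[OF \<Phi> operator_convex_discrete_jensen[OF convex(2)] cont(2) A m])
    then have 2: "cfc (\<lambda>t. t powr - (2 * r)) (\<Phi> (cfc g A)) \<le>\<^sub>L cfc (\<lambda>t. t powr - (2 * r)) (cfc g (\<Phi> A))"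
      by (rule cfc_powr_antimono[OF _ G(2,1) c'(1) c'(1) r(1,2)])
    obtain V where V: "V \<in> bop" "partial_isometry V"
      and le: "op_abs (\<Phi> (cfc f A) powr\<^sub>o (-r) o\<^sub>L \<Phi> A powr\<^sub>o r o\<^sub>L \<Phi> (cfc g A) powr\<^sub>o (-r))
        \<le>\<^sub>L adj V o\<^sub>L cfc \<kappa> (\<Phi> A) o\<^sub>L V"
      using op_abs_triple_product(1)[OF P m F(1) c(1) G(1) c'(1) Icc(1) pos'(1) Icc(2) pos'(2) 1 2]
      unfolding \<kappa>_def[abs_def] by blast
    note le
    \<comment> \<open>Congruence by \<open>V\<close> preserves the order, so passing from
      \<open>\<kappa>\<close> of \<open>\<Phi> A\<close> to the image of
      \<open>cfc \<kappa> A\<close> does not change the partial isometry.\<close>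
    also have "adj V o\<^sub>L cfc \<kappa> (\<Phi> A) o\<^sub>L V \<le>\<^sub>L adj V o\<^sub>L \<Phi> (cfc \<kappa> A) o\<^sub>L V"
      by (rule loewner_le_congruence[OF \<kappa> cfc_selfadjoint[OF P c\<kappa>]
            positive_map_selfadjoint[OF \<Phi> cfc_selfadjoint[OF A c\<kappa>]] V(1)])
    finally show ?thesis
      using V(2) product[OF A m Icc(1) pos'(1) Icc(2) pos'(2)] by (auto simp: \<kappa>_def[abs_def])
  qed
  have two: "\<exists>V :: 'k \<Rightarrow>\<^sub>L 'k. partial_isometry V \<and>
        adj V o\<^sub>L \<Phi> (cfc f A powr\<^sub>o (-r) o\<^sub>L A powr\<^sub>o r o\<^sub>L cfc g A powr\<^sub>o (-r)) o\<^sub>L V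
        \<le>\<^sub>L op_abs (\<Phi> (cfc f A) powr\<^sub>o (-r) o\<^sub>L \<Phi> A powr\<^sub>o r o\<^sub>L \<Phi> (cfc g A) powr\<^sub>o (-r))"
    if pos: "\<forall>t>0. f t > 0" "\<forall>t>0. g t > 0"
      and concave: "operator_concave {0<..} f" "operator_concave {0<..} g"
        "operator_concave {0<..} (\<lambda>t. t / (f t * g t))"
      and A0: "positive_op A" "invertible_op A" for f g and A :: "'h \<Rightarrow>\<^sub>L 'h"
  proof -
    \<comment> \<open>The reciprocal of the function in part (1). Now \<open>\<kappa>\<close> is a
      positive power of \<open>h\<close>, and the chain below rests on t^r being operator monotone
      and operator concave.\<close>
    define h where "h t = t / (f t * g t)" for t
    obtain m M where m: "0 < m" and A: "op_between m M A"
      using positive_invertible_op_between[OF A0] by blast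
    have P: "op_between m M (\<Phi> A)" by (rule positive_map_between[OF \<Phi> A])
    have cont: "continuous_on {0<..} f" "continuous_on {0<..} g" "continuous_on {0<..} h"
      using concave[THEN operator_concave_continuous] by (simp_all add: h_def[abs_def])
    note Icc = cont[THEN continuous_on_Icc_pos, OF m, of M]
    have pos': "0 < f t" "0 < g t" "0 < h t" if "t \<in> {m..M}" for t
      using pos m that by (auto simp: h_def)
    obtain c d where c: "0 < c" "\<And>t. t \<in> {m..M} \<Longrightarrow> c \<le> f t \<and> f t \<le> d"
      using continuous_positive_bounds[OF Icc(1) pos'(1)] by blast
    obtain c' d' where c': "0 < c'" "\<And>t. t \<in> {m..M} \<Longrightarrow> c' \<le> g t \<and> g t \<le> d'"
      using continuous_positive_bounds[OF Icc(2) pos'(2)] by blast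
    obtain a b where a: "0 < a" "\<And>t. t \<in> {m..M} \<Longrightarrow> a \<le> h t \<and> h t \<le> b"
      using continuous_positive_bounds[OF Icc(3) pos'(3)] by blast
    have F: "op_between c d (\<Phi> (cfc f A))" "op_between c d (cfc f (\<Phi> A))"
      by (rule positive_map_between[OF \<Phi> cfc_between[OF A Icc(1) c(2)]], assumption,
          rule cfc_between[OF P Icc(1) c(2)])
    have G: "op_between c' d' (\<Phi> (cfc g A))" "op_between c' d' (cfc g (\<Phi> A))"
      by (rule positive_map_between[OF \<Phi> cfc_between[OF A Icc(2) c'(2)]], assumption,
          rule cfc_between[OF P Icc(2) c'(2)])
    have hA: "op_between a b (cfc h A)" by (rule cfc_between[OF A Icc(3) a(2)])
    have hP: "op_between a b (cfc h (\<Phi> A))" by (rule cfc_between[OF P Icc(3) a(2)])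
    have \<Phi>hA: "op_between a b (\<Phi> (cfc h A))" by (rule positive_map_between[OF \<Phi> hA])
    define \<kappa> where "\<kappa> t = f t powr - r * t powr r * g t powr - r" for t
    have h\<kappa>: "h t powr r = \<kappa> t" if "t \<in> {m..M}" for t
      using pos'[OF that] m that
      by (simp add: h_def \<kappa>_def powr_mult powr_divide powr_minus field_simps)
    have h\<kappa>A: "cfc (\<lambda>t. t powr r) (cfc h A) = cfc \<kappa> A"
      by (rule cfc_powr_cfc[OF A Icc(3) pos'(3) h\<kappa>])
    have h\<kappa>P: "cfc (\<lambda>t. t powr r) (cfc h (\<Phi> A)) = cfc \<kappa> (\<Phi> A)"
      by (rule cfc_powr_cfc[OF P Icc(3) pos'(3) h\<kappa>])
    have pw: "continuous_on {0<..} (\<lambda>t::real. t powr r)" by (auto intro!: continuous_intros)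
    have "\<Phi> (cfc (\<lambda>t. t powr r) (cfc h A)) \<le>\<^sub>L cfc (\<lambda>t. t powr r) (\<Phi> (cfc h A))"
      by (rule Jensen_positive_map_concave[OF \<Phi> jensen_antitoneD(2)[OF jensen_antitone_uminus_powr[OF r(3,5)]] pw hA a(1)])
    also have "\<Phi> (cfc h A) \<le>\<^sub>L cfc h (\<Phi> A)"
      by (rule Jensen_positive_map_concave[OF \<Phi> _ cont(3) A m])
        (use operator_concave_discrete_jensen[OF concave(3)] in \<open>simp add: h_def[abs_def]\<close>)
    then have "cfc (\<lambda>t. t powr r) (\<Phi> (cfc h A)) \<le>\<^sub>L cfc (\<lambda>t. t powr r) (cfc h (\<Phi> A))"
      by (rule cfc_powr_mono[OF _ \<Phi>hA hP a(1) a(1) r(3,5)])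
    finally have \<kappa>: "\<Phi> (cfc \<kappa> A) \<le>\<^sub>L cfc \<kappa> (\<Phi> A)"
      unfolding h\<kappa>A h\<kappa>P .
    have c\<kappa>: "continuous_on {m..M} \<kappa>"
      unfolding \<kappa>_def[abs_def] using m pos'
      by (intro continuous_on_mult continuous_on_powr_Icc Icc continuous_on_id) auto
    have "\<Phi> (cfc f A) \<le>\<^sub>L cfc f (\<Phi> A)"
      by (rule Jensen_positive_map_concave[OF \<Phi> operator_concave_discrete_jensen[OF concave(1)] cont(1) A m])
    then have 1: "cfc (\<lambda>t. t powr - (2 * r)) (cfc f (\<Phi> A)) \<le>\<^sub>L cfc (\<lambda>t. t powr - (2 * r)) (\<Phi> (cfc f A))"
      by (rule cfc_powr_antimono[OF _ F(1,2) c(1) c(1) r(1,2)])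
    have "\<Phi> (cfc g A) \<le>\<^sub>L cfc g (\<Phi> A)"
      by (rule Jensen_positive_map_concave[OF \<Phi> operator_concave_discrete_jensen[OF concave(2)] cont(2) A m])
    then have 2: "cfc (\<lambda>t. t powr - (2 * r)) (cfc g (\<Phi> A)) \<le>\<^sub>L cfc (\<lambda>t. t powr - (2 * r)) (\<Phi> (cfc g A))"
      by (rule cfc_powr_antimono[OF _ G(1,2) c'(1) c'(1) r(1,2)])
    obtain V where V: "V \<in> bop" "partial_isometry V"
      and le: "adj V o\<^sub>L cfc \<kappa> (\<Phi> A) o\<^sub>L V \<le>\<^sub>L
        op_abs (\<Phi> (cfc f A) powr\<^sub>o (-r) o\<^sub>L \<Phi> A powr\<^sub>o r o\<^sub>L \<Phi> (cfc g A) powr\<^sub>o (-r))"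
      using op_abs_triple_product(2)[OF P m F(1) c(1) G(1) c'(1) Icc(1) pos'(1) Icc(2) pos'(2) 1 2]
      unfolding \<kappa>_def[abs_def] by blast
    have "adj V o\<^sub>L \<Phi> (cfc \<kappa> A) o\<^sub>L V \<le>\<^sub>L adj V o\<^sub>L cfc \<kappa> (\<Phi> A) o\<^sub>L V"
      by (rule loewner_le_congruence[OF \<kappa> positive_map_selfadjoint[OF \<Phi> cfc_selfadjoint[OF A c\<kappa>]]
            cfc_selfadjoint[OF P c\<kappa>] V(1)])
    also note le
    finally show ?thesis
      using V(2) product[OF A m Icc(1) pos'(1) Icc(2) pos'(2)] by (auto simp: \<kappa>_def[abs_def])
  qed
  show ?thesis using one two by blast
qed

end
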